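(* For $0<\alpha<1$, the minimum $R$ for which the metric space $(B_2^n,d_2^\alpha)$ may be isometrically embedded on the surface of a Hilbert sphere of radius $R$ is $$\sqrt{\frac{\mathfrak m_{2\alpha}\,\pi^{1/2}\,\Gamma\left(\alpha+\frac n2\right)}{2\,\Gamma\left(\alpha+\frac12\right)\Gamma\left(\frac n2\right)}}=n^{\alpha/2}\left(\sqrt{\frac{\mathfrak m_{2\alpha}\,\pi^{1/2}}{2\,\Gamma\left(\alpha+\frac12\right)}}+o(1)\right).$$
   Context: $n\in\mathbb N$ and $B_2^n$ is the closed Euclidean unit ball of $\mathbb R^n$; $d_2(x,y)=\|x-y\|_2$ is the Euclidean distance and $d_2^\alpha(x,y)=\|x-y\|_2^\alpha$. An isometric embedding of $(B_2^n,d_2^\alpha)$ on the surface of a Hilbert sphere of radius $R$ is a map $j:B_2^n\to R\cdot S_{\ell_2}=\{z\in\ell_2:\|z\|_{\ell_2}=R\}$ into the real Hilbert space $\ell_2$ with $\|j(x)-j(y)\|_{\ell_2}=\|x-y\|_2^\alpha$ for all $x,y\in B_2^n$. For $0<p<2$, $\mathfrak m_p:=\sup\int_{-1}^1\int_{-1}^1|u-v|^p\,d\mu(u)d\mu(v)$, the supremum being over all finite signed Borel measures $\mu$ on $[-1,1]$ with $\mu([-1,1])=1$; $\mathfrak m_{2\alpha}$ is this quantity for $p=2\alpha$. The term $o(1)$ refers to $n\to\infty$ with $\alpha$ fixed.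
   Formalization: In the asymptotic expression the constant 2Γ(α+1/2) under the root is corrected to 2^{1+α}Γ(α+1/2), because Γ(α+n/2)/Γ(n/2) ~ (n/2)^α makes the printed equality false for every 0<α<1; the exact minimum radius is unchanged. *)

theory Defs
  imports "HOL-Analysis.Analysis" "HOL-Library.Landau_Symbols"
begin

section \<open>The real Hilbert space of square-summable sequences\<close>

typedef ell2 = "{x :: nat \<Rightarrow> real. summable (\<lambda>i. (x i)\<^sup>2)}"
  morphisms ell2_nth Abs_ell2
  by (rule exI[of _ "\<lambda>_. 0"]) simp

setup_lifting type_definition_ell2

lemma summable_mult_of_summable_squares:
  fixes x y :: "nat \<Rightarrow> real"
  assumes "summable (\<lambda>i. (x i)\<^sup>2)" "summable (\<lambda>i. (y i)\<^sup>2)"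
  shows "summable (\<lambda>i. x i * y i)"
proof (rule summable_comparison_test'[where N = 0])
  show "summable (\<lambda>i. (x i)\<^sup>2 + (y i)\<^sup>2)"
    using assms by (rule summable_add)
  fix i
  have "2 * (\<bar>x i\<bar> * \<bar>y i\<bar>) \<le> (x i)\<^sup>2 + (y i)\<^sup>2"
    using sum_squares_bound[of "\<bar>x i\<bar>" "\<bar>y i\<bar>"] by simp
  moreover have "0 \<le> \<bar>x i\<bar> * \<bar>y i\<bar>" by simp
  ultimately show "norm (x i * y i) \<le> (x i)\<^sup>2 + (y i)\<^sup>2"
    unfolding real_norm_def abs_mult by linarith
qed

lemma summable_add_squares:
  fixes x y :: "nat \<Rightarrow> real"
  assumes "summable (\<lambda>i. (x i)\<^sup>2)" "summable (\<lambda>i. (y i)\<^sup>2)"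
  shows "summable (\<lambda>i. (x i + y i)\<^sup>2)"
  unfolding power2_sum using assms summable_mult_of_summable_squares[OF assms]
  by (simp add: summable_add summable_mult mult.assoc)

lemma summable_ell2_mult: "summable (\<lambda>i. ell2_nth x i * ell2_nth y i)"
  using ell2_nth[of x] ell2_nth[of y] by (auto intro: summable_mult_of_summable_squares)

instantiation ell2 :: real_vector
begin

lift_definition zero_ell2 :: ell2 is "\<lambda>_. 0" by simp
lift_definition plus_ell2 :: "ell2 \<Rightarrow> ell2 \<Rightarrow> ell2" is "\<lambda>x y i. x i + y i"
  by (rule summable_add_squares)
lift_definition uminus_ell2 :: "ell2 \<Rightarrow> ell2" is "\<lambda>x i. - x i" by simp
lift_definition minus_ell2 :: "ell2 \<Rightarrow> ell2 \<Rightarrow> ell2" is "\<lambda>x y i. x i - y i"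
  using summable_add_squares[of _ "\<lambda>i. - _ i"] by simp
lift_definition scaleR_ell2 :: "real \<Rightarrow> ell2 \<Rightarrow> ell2" is "\<lambda>c x i. c * x i"
  by (simp add: power_mult_distrib summable_mult)

instance
  by standard (transfer; simp add: algebra_simps)+

end

instantiation ell2 :: real_inner
begin

lift_definition inner_ell2 :: "ell2 \<Rightarrow> ell2 \<Rightarrow> real" is "\<lambda>x y. \<Sum>i. x i * y i" .

definition norm_ell2 :: "ell2 \<Rightarrow> real" where "norm_ell2 x = sqrt (inner x x)"
definition sgn_ell2 :: "ell2 \<Rightarrow> ell2" where "sgn_ell2 x = x /\<^sub>R norm x"
definition dist_ell2 :: "ell2 \<Rightarrow> ell2 \<Rightarrow> real" where "dist_ell2 x y = norm (x - y)"
definition uniformity_ell2 :: "(ell2 \<times> ell2) filter"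
  where "uniformity_ell2 = (INF e\<in>{0<..}. principal {(x, y). dist x y < e})"
definition open_ell2 :: "ell2 set \<Rightarrow> bool"
  where "open_ell2 U \<longleftrightarrow> (\<forall>x\<in>U. \<forall>\<^sub>F (x', y) in uniformity. x' = x \<longrightarrow> y \<in> U)"

instance
proof
  fix x y z :: ell2 and r :: real and U :: "ell2 set"
  show "dist x y = norm (x - y)" by (rule dist_ell2_def)
  show "sgn x = x /\<^sub>R norm x" by (rule sgn_ell2_def)
  show "uniformity = (INF e\<in>{0<..}. principal {(x, y :: ell2). dist x y < e})"
    by (rule uniformity_ell2_def)
  show "open U \<longleftrightarrow> (\<forall>x\<in>U. \<forall>\<^sub>F (x', y) in uniformity. x' = x \<longrightarrow> y \<in> U)"
    by (rule open_ell2_def)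
  show "inner x y = inner y x" by transfer (simp add: mult.commute)
  show "inner (x + y) z = inner x z + inner y z"
    by transfer (simp add: distrib_right suminf_add summable_mult_of_summable_squares)
  show "inner (r *\<^sub>R x) y = r * inner x y"
    by transfer (simp add: mult.assoc suminf_mult summable_mult_of_summable_squares)
  show "0 \<le> inner x x"
    by transfer (simp add: suminf_nonneg flip: power2_eq_square)
  show "inner x x = 0 \<longleftrightarrow> x = 0"
    by transfer (auto simp: suminf_eq_zero_iff fun_eq_iff simp flip: power2_eq_square)
  show "norm x = sqrt (inner x x)" by (rule norm_ell2_def)
qed

end

lemma norm_ell2_eq: "norm x = sqrt (\<Sum>i. (ell2_nth x i)\<^sup>2)"
  unfolding norm_ell2_def by transfer (simp add: power2_eq_square)


section \<open>Finite signed measures\<close>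

text \<open>A finite signed measure on the measurable space underlying \<open>M\<close> is a countably additive
  real-valued set function; only \<open>space M\<close> and \<open>sets M\<close> matter, and the values of \<open>\<mu>\<close> outside
  \<open>sets M\<close> are irrelevant.\<close>

definition signed_measure :: "'a measure \<Rightarrow> ('a set \<Rightarrow> real) \<Rightarrow> bool" where
  "signed_measure M \<mu> \<longleftrightarrow>
     \<mu> {} = 0 \<and>
     (\<forall>A :: nat \<Rightarrow> 'a set. range A \<subseteq> sets M \<longrightarrow> disjoint_family A \<longrightarrow>
        (\<lambda>i. \<mu> (A i)) sums \<mu> (\<Union>i. A i))"

text \<open>The positive part \<open>\<mu>\<^sup>+(A) = sup {\<mu>(B) | B \<subseteq> A measurable}\<close> of the Jordan decomposition
  \<open>\<mu> = \<mu>\<^sup>+ - \<mu>\<^sup>-\<close>; the negative part is \<open>\<mu>\<^sup>- = (-\<mu>)\<^sup>+\<close>. The coercion to the extended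
  nonnegative reals sends negative values to 0, which does not affect the supremum because
  \<open>B = {}\<close> contributes 0.\<close>

definition positive_part :: "'a measure \<Rightarrow> ('a set \<Rightarrow> real) \<Rightarrow> 'a measure" where
  "positive_part M \<mu> =
     measure_of (space M) (sets M) (\<lambda>A. SUP B\<in>{B \<in> sets M. B \<subseteq> A}. ennreal (\<mu> B))"

definition signed_integral :: "'a measure \<Rightarrow> ('a set \<Rightarrow> real) \<Rightarrow> ('a \<Rightarrow> real) \<Rightarrow> real" where
  "signed_integral M \<mu> f =
     (\<integral>x. f x \<partial>positive_part M \<mu>) - (\<integral>x. f x \<partial>positive_part M (\<lambda>A. - \<mu> A))"


section \<open>The extremal energy of the interval\<close>

abbreviation borel_interval :: "real measure" where
  "borel_interval \<equiv> restrict_space borel {-1..1}"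

definition energies :: "real \<Rightarrow> real set" where
  "energies p =
     {signed_integral borel_interval \<mu>
        (\<lambda>v. signed_integral borel_interval \<mu> (\<lambda>u. \<bar>u - v\<bar> powr p)) | \<mu>.
      signed_measure borel_interval \<mu> \<and> \<mu> {-1..1} = 1}"

definition max_energy :: "real \<Rightarrow> real" where
  "max_energy p = Sup (energies p)"


section \<open>Snowflake embeddings of the Euclidean ball into Hilbert spheres\<close>

definition embeds_ball_in_sphere ::
    "real \<Rightarrow> real \<Rightarrow> (real ^ 'n \<Rightarrow> ell2) \<Rightarrow> bool" where
  "embeds_ball_in_sphere \<alpha> R j \<longleftrightarrow>
     j \<in> cball 0 1 \<rightarrow> sphere 0 R \<and>
     (\<forall>x\<in>cball 0 1. \<forall>y\<in>cball 0 1. dist (j x) (j y) = dist x y powr \<alpha>)"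

text \<open>For fixed \<open>\<alpha>\<close>, \<open>Gamma (\<alpha> + n / 2) / Gamma (n / 2)\<close> is asymptotic to \<open>(n / 2) powr \<alpha>\<close>, so the
  limit of \<open>optimal_radius \<alpha> n / n powr (\<alpha> / 2)\<close> carries a factor \<open>2 powr (- \<alpha> / 2)\<close>. The published
  asymptotic formula omits this factor, and with its constant (\<open>2\<close> in place of \<open>2 powr (1 + \<alpha>)\<close> in the
  denominator under the root) it would contradict the exact formula below.\<close>

definition optimal_radius :: "real \<Rightarrow> nat \<Rightarrow> real" where
  "optimal_radius \<alpha> n =
     sqrt (max_energy (2 * \<alpha>) * pi powr (1 / 2) * Gamma (\<alpha> + real n / 2) /
           (2 * Gamma (\<alpha> + 1 / 2) * Gamma (real n / 2)))"

end

(* Write p = 2 alpha. A kernel dist^p embeds a set into a Hilbert sphere of radius R iff the kernel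
   R^2 - dist^p / 2 is positive semidefinite, i.e. iff every finite signed measure nu on the set has
   energy at most 2 R^2 nu(1)^2. Averaging |<x - y, theta>|^p over directions theta gives a constant
   multiple c^-1 of |x - y|^p, so the energy of a measure on the ball is c times the average of the
   energies of its projections to [-1,1]; this bounds it by c m_p and proves that the radius
   sqrt (c m_p / 2) is attained. Conversely, a radial signed measure on the ball has the same
   projection in every direction, and projections of the densities (1 - |x|^2)^m produce every density
   (1 - t^2)^((n-1)/2) P(1 - t^2) with P a polynomial. With P suitable powers these concentrate at a pair
   of points +-u, and passing to the even part of a measure does not decrease its energy; so an
   embedding of the ball into a sphere of radius R forces m_p <= 2 R^2 / c. Finiteness of m_p comes from
   writing a constant minus |t|^p on [-2,2] as a positive mixture of dilates of the cubic B-spline. *)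
theory Submission
  imports Defs "HOL-Computational_Algebra.Polynomial"
begin

section \<open>Positive semidefinite kernels\<close>

text \<open>All bounds are tested on finitely supported weights, although \<open>max_energy\<close>
  is a supremum over signed measures and the measures on the ball have densities. The passage
  between the two is made by the embedding itself: on a sphere of radius R the energy of a measure
  nu is 2 R^2 nu(1)^2 - 2 |v|^2, where v is the integral of the embedding against nu. A bound for
  finite sums is therefore first turned into a map into \<open>ell2\<close>, and the map then bounds
  every measure. In the converse direction a pair of point masses cannot be lifted directly to a
  radial density on the ball, and inverting the projection for general densities is an equation of
  Abel type. Polynomials in 1 - t^2 avoid the inversion, since each power lifts to an explicit
  density. All projections obtained in this way are even, so they see the distance kernel only after
  averaging over signs. Directions are averaged over the solid ball with the weight |theta|^p that
  comes from homogeneity, so Lebesgue measure takes the place of surface measure; the integral of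
  this weight enters the constant \<open>proj_const\<close>.\<close>

definition psd_on :: "'a set \<Rightarrow> ('a \<Rightarrow> 'a \<Rightarrow> real) \<Rightarrow> bool" where
  "psd_on S K \<longleftrightarrow> (\<forall>x\<in>S. \<forall>y\<in>S. K x y = K y x) \<and>
     (\<forall>F a. finite F \<longrightarrow> F \<subseteq> S \<longrightarrow> 0 \<le> (\<Sum>x\<in>F. \<Sum>y\<in>F. a x * a y * K x y))"

lemma psd_on_sum: "psd_on S K \<Longrightarrow> finite F \<Longrightarrow> F \<subseteq> S \<Longrightarrow> 0 \<le> (\<Sum>x\<in>F. \<Sum>y\<in>F. a x * a y * K x y)"
  by (simp add: psd_on_def)

text \<open>The form at the weights 1 and \<open>t\<close>. As a nonnegative polynomial in
  \<open>t\<close> it does the work of the Cauchy-Schwarz inequality for the kernel.\<close>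

lemma psd_on_pair:
  assumes "psd_on S K" "x \<in> S" "y \<in> S"
  shows "0 \<le> K x x + 2 * t * K x y + t\<^sup>2 * K y y"
proof (cases "x = y")
  \<comment> \<open>Equal points make \<open>{x, y}\<close> a singleton, so here the two weights are
    merged by hand.\<close>
  case True
  have "0 \<le> K x x" using psd_on_sum[OF assms(1), of "{x}" "\<lambda>_. 1"] assms by simp
  moreover have "K x x + 2 * t * K x x + t\<^sup>2 * K x x = (1 + t)\<^sup>2 * K x x"
    by (simp add: power2_eq_square algebra_simps)
  ultimately show ?thesis using True by simp
next
  case False
  have "K y x = K x y" using assms by (simp add: psd_on_def)
  with psd_on_sum[OF assms(1), of "{x, y}" "\<lambda>z. if z = x then 1 else t"] assms False show ?thesis
    by (simp add: power2_eq_square algebra_simps)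
qed

lemma psd_on_diag: "psd_on S K \<Longrightarrow> x \<in> S \<Longrightarrow> 0 \<le> K x x"
  using psd_on_pair[of S K x x 0] by simp

text \<open>Schur complement: this is the Gram kernel of the vectors after projection onto the
  orthogonal complement of the vector of \<open>z\<close>. The subtracted term stays a product of
  two normalised factors because each factor becomes one coordinate of the embedding. If
  \<open>K z z = 0\<close>, division by zero makes that term vanish.\<close>

lemma psd_on_Schur:
  assumes psd: "psd_on S K" and z: "z \<in> S"
  shows "psd_on S (\<lambda>x y. K x y - K x z / sqrt (K z z) * (K y z / sqrt (K z z)))"
  unfolding psd_on_def
proof (intro conjI ballI allI impI)
  fix x y assume "x \<in> S" "y \<in> S"
  then show "K x y - K x z / sqrt (K z z) * (K y z / sqrt (K z z)) =
      K y x - K y z / sqrt (K z z) * (K x z / sqrt (K z z))"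
    using psd by (simp add: psd_on_def mult.commute)
next
  fix F and a :: "'a \<Rightarrow> real" assume F: "finite F" "F \<subseteq> S"
  define k where "k = K z z"
  define L where "L = (\<Sum>x\<in>F. a x * K x z)"
  define Q where "Q = (\<Sum>x\<in>F. \<Sum>y\<in>F. a x * a y * K x y)"
  have k0: "0 \<le> k" using psd_on_diag[OF psd z] by (simp add: k_def)
  have eq: "(\<Sum>x\<in>F. \<Sum>y\<in>F. a x * a y * (K x y - K x z / sqrt (K z z) * (K y z / sqrt (K z z)))) = Q - L\<^sup>2 / k"
  proof -
    have "a x * a y * (K x y - K x z / sqrt (K z z) * (K y z / sqrt (K z z))) =
        a x * a y * K x y - (a x * K x z) * (a y * K y z) / k" for x y
      using k0 by (simp add: k_def[symmetric] algebra_simps flip: power2_eq_square)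
    then show ?thesis
      by (simp add: sum_subtractf Q_def L_def power2_eq_square sum_product sum_divide_distrib)
  qed
  have "0 \<le> Q + 2 * t * L + t\<^sup>2 * k" for t
  proof -
    \<comment> \<open>Extending the weights by 0 lets \<open>t\<close> be added at \<open>z\<close>
      whether or not \<open>z\<close> lies in \<open>F\<close>.\<close>
    define b where "b x = (if x \<in> F then a x else 0)" for x
    let ?G = "insert z F"
    have ext: "(\<Sum>x\<in>?G. b x * f x) = (\<Sum>x\<in>F. a x * f x)" for f
    proof -
      have "(\<Sum>x\<in>?G. b x * f x) = (\<Sum>x\<in>F. b x * f x)"
        using F by (intro sum.mono_neutral_right) (auto simp: b_def)
      then show ?thesis by (simp add: b_def)
    qed
    have one: "(\<Sum>x\<in>?G. (if x = z then t else 0) * f x) = t * f z" for f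
      using F by (subst sum.remove[of _ z]) (auto intro: sum.neutral)
    have "0 \<le> (\<Sum>x\<in>?G. \<Sum>y\<in>?G. (b x + (if x = z then t else 0)) * (b y + (if y = z then t else 0)) * K x y)"
      by (rule psd_on_sum[OF psd]) (use F z in auto)
    also have "\<dots> = (\<Sum>x\<in>?G. (b x + (if x = z then t else 0)) *
        ((\<Sum>y\<in>?G. b y * K x y) + (\<Sum>y\<in>?G. (if y = z then t else 0) * K x y)))"
      by (simp add: sum_distrib_left sum.distrib[symmetric] algebra_simps)
    also have "\<dots> = (\<Sum>x\<in>?G. (b x + (if x = z then t else 0)) * ((\<Sum>y\<in>F. a y * K x y) + t * K x z))"
      by (simp only: ext one)
    also have "\<dots> = (\<Sum>x\<in>?G. b x * ((\<Sum>y\<in>F. a y * K x y) + t * K x z)) +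
        (\<Sum>x\<in>?G. (if x = z then t else 0) * ((\<Sum>y\<in>F. a y * K x y) + t * K x z))"
      by (simp only: sum.distrib distrib_right)
    also have "\<dots> = (\<Sum>x\<in>F. a x * ((\<Sum>y\<in>F. a y * K x y) + t * K x z)) + t * ((\<Sum>y\<in>F. a y * K z y) + t * K z z)"
      by (simp only: ext one)
    also have "(\<Sum>y\<in>F. a y * K z y) = L"
      unfolding L_def using psd F z by (intro sum.cong) (auto simp: psd_on_def)
    also have "(\<Sum>x\<in>F. a x * ((\<Sum>y\<in>F. a y * K x y) + t * K x z)) = Q + t * L"
      by (simp add: Q_def L_def sum.distrib sum_distrib_left algebra_simps)
    finally show ?thesis by (simp add: k_def power2_eq_square algebra_simps)
  qed
  \<comment> \<open>The minimiser in \<open>t\<close> is \<open>- L / k\<close>. If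
    \<open>k = 0\<close>, the subtracted quotient is 0 and the instance \<open>t = 0\<close>
    suffices.\<close>
  from this[of "- L / k"] this[of 0] have "0 \<le> Q - L\<^sup>2 / k"
    by (cases "k = 0") (auto simp: power2_eq_square field_simps)
  then show "0 \<le> (\<Sum>x\<in>F. \<Sum>y\<in>F. a x * a y * (K x y - K x z / sqrt (K z z) * (K y z / sqrt (K z z))))"
    by (simp only: eq)
qed

text \<open>Gram--Schmidt in the reproducing kernel Hilbert space, carried out on the kernel.\<close>
fun schur_kernel :: "('a \<Rightarrow> 'a \<Rightarrow> real) \<Rightarrow> (nat \<Rightarrow> 'a) \<Rightarrow> nat \<Rightarrow> 'a \<Rightarrow> 'a \<Rightarrow> real" where
  "schur_kernel K d 0 x y = K x y"
| "schur_kernel K d (Suc i) x y = schur_kernel K d i x y -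
     schur_kernel K d i x (d i) / sqrt (schur_kernel K d i (d i) (d i)) *
     (schur_kernel K d i y (d i) / sqrt (schur_kernel K d i (d i) (d i)))"

definition schur_coord :: "('a \<Rightarrow> 'a \<Rightarrow> real) \<Rightarrow> (nat \<Rightarrow> 'a) \<Rightarrow> nat \<Rightarrow> 'a \<Rightarrow> real" where
  "schur_coord K d i x = schur_kernel K d i x (d i) / sqrt (schur_kernel K d i (d i) (d i))"

lemma schur_kernel_Suc:
  "schur_kernel K d (Suc i) x y = schur_kernel K d i x y - schur_coord K d i x * schur_coord K d i y"
  by (simp add: schur_coord_def)

lemma schur_kernel_eq:
  "(\<Sum>i<N. schur_coord K d i x * schur_coord K d i y) = K x y - schur_kernel K d N x y"
  by (induction N) (auto simp: schur_kernel_Suc simp del: schur_kernel.simps(2))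

lemma psd_on_schur_kernel:
  assumes "psd_on S K" "range d \<subseteq> S"
  shows "psd_on S (schur_kernel K d N)"
proof (induction N)
  case 0
  have "schur_kernel K d 0 = K" by (intro ext) simp
  then show ?case using assms by simp
next
  case (Suc N)
  have "schur_kernel K d (Suc N) = (\<lambda>x y. schur_kernel K d N x y -
     schur_kernel K d N x (d N) / sqrt (schur_kernel K d N (d N) (d N)) *
     (schur_kernel K d N y (d N) / sqrt (schur_kernel K d N (d N) (d N))))"
    by (intro ext) simp
  then show ?case using psd_on_Schur[OF Suc, of "d N"] assms(2) by auto
qed

text \<open>Each step removes the square of a coordinate difference, so squared distances in the
  residual kernel can only drop.\<close>

lemma schur_kernel_dist_antimono:
  assumes "N \<le> M"
  shows "schur_kernel K d M x x - 2 * schur_kernel K d M x y + schur_kernel K d M y y \<le>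
     schur_kernel K d N x x - 2 * schur_kernel K d N x y + schur_kernel K d N y y"
  using assms
proof (induction M rule: dec_induct)
  case (step M)
  have "schur_kernel K d (Suc M) x x - 2 * schur_kernel K d (Suc M) x y + schur_kernel K d (Suc M) y y =
      schur_kernel K d M x x - 2 * schur_kernel K d M x y + schur_kernel K d M y y
      - (schur_coord K d M x - schur_coord K d M y)\<^sup>2"
    unfolding schur_kernel_Suc by (simp add: power2_eq_square algebra_simps)
  then show ?case using step.IH by (smt (verit) zero_le_power2)
qed simp

lemma schur_kernel_diag_antimono:
  assumes "N \<le> M"
  shows "schur_kernel K d M x x \<le> schur_kernel K d N x x"
  using assms
proof (induction M rule: dec_induct)
  case (step M)
  then show ?case by (smt (verit) schur_kernel_Suc zero_le_square)
qed simp

text \<open>Step \<open>k\<close> uses up the vector of \<open>d k\<close>: its residual norm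
  becomes 0 and stays 0 by monotonicity, and then its residual products with all other vectors
  vanish.\<close>

lemma schur_kernel_zero:
  assumes psd: "psd_on S K" and d: "range d \<subseteq> S" and "k < N" and x: "x \<in> S"
  shows "schur_kernel K d N (d k) (d k) = 0" and "schur_kernel K d N x (d k) = 0"
proof -
  let ?L = "schur_kernel K d N"
  note psdN = psd_on_schur_kernel[OF psd d]
  have dk: "d k \<in> S" using d by auto
  have "0 \<le> schur_kernel K d k (d k) (d k)"
    by (rule psd_on_diag[OF psdN dk])
  then have "schur_kernel K d (Suc k) (d k) (d k) = 0"
    by (simp flip: power2_eq_square add: power_divide) (simp add: power2_eq_square)
  then show z: "?L (d k) (d k) = 0"
    using schur_kernel_diag_antimono[of "Suc k" N K d "d k"] psd_on_diag[OF psdN dk, of N] assms(3) by simp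
  show "?L x (d k) = 0"
  proof (rule ccontr)
    assume nz: "?L x (d k) \<noteq> 0"
    \<comment> \<open>With vanishing norm at \<open>d k\<close> the polynomial of
      \<open>psd_on_pair\<close> is affine in \<open>t\<close>, and this \<open>t\<close> gives it
      the value -1.\<close>
    show False
      using psd_on_pair[OF psdN x dk, of N "- (?L x x + 1) / (2 * ?L x (d k))"] nz z
      by (simp add: field_simps)
  qed
qed

text \<open>The coordinates of \<open>j x\<close> are its \<open>schur_coord\<close>s along a dense
  sequence \<open>d\<close> in \<open>S\<close>. By \<open>schur_kernel_eq\<close> the partial sums
  of the inner product miss \<open>K x y\<close> by the residual kernel, and continuity of the
  kernel distance together with density drives the residual to 0.\<close>

lemma kernel_embedding:
  fixes K :: "'a::euclidean_space \<Rightarrow> 'a \<Rightarrow> real"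
  assumes psd: "psd_on S K"
    and cont: "\<And>x e. x \<in> S \<Longrightarrow> 0 < e \<Longrightarrow> \<exists>r>0. \<forall>y\<in>S. dist y x < r \<longrightarrow> K x x - 2 * K x y + K y y < e"
  obtains j :: "'a \<Rightarrow> ell2" where "\<And>x y. x \<in> S \<Longrightarrow> y \<in> S \<Longrightarrow> inner (j x) (j y) = K x y"
proof (cases "S = {}")
  case True
  then show ?thesis using that by simp
next
  case False
  obtain T where T: "countable T" "T \<subseteq> S" "S \<subseteq> closure T" using separable by metis
  have "T \<noteq> {}" using T(3) False by auto
  define d where "d = from_nat_into T"
  have rd: "range d = T" unfolding d_def using range_from_nat_into[OF \<open>T \<noteq> {}\<close> T(1)] .
  then have d: "range d \<subseteq> S" using T by simp
  let ?L = "schur_kernel K d" and ?e = "schur_coord K d"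
  note psdN = psd_on_schur_kernel[OF psd d]
  have diag: "(\<lambda>N. ?L N x x) \<longlonglongrightarrow> 0" if x: "x \<in> S" for x
  proof (rule LIMSEQ_I)
    fix e :: real assume "0 < e"
    obtain r where r: "r > 0" "\<And>y. y \<in> S \<Longrightarrow> dist y x < r \<Longrightarrow> K x x - 2 * K x y + K y y < e"
      using cont[OF x \<open>0 < e\<close>] by auto
    obtain y where "y \<in> T" "dist y x < r"
      using T(3) x r(1) by (meson closure_approachable subsetD)
    then obtain k where k: "dist (d k) x < r" using rd by blast
    have "norm (?L N x x - 0) < e" if N: "N \<ge> Suc k" for N
    proof -
      \<comment> \<open>Once \<open>d k\<close> is used up, the residual norm of \<open>x\<close>
        equals its residual distance to \<open>d k\<close>, which is at most the original kernel
        distance.\<close>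
      have "k < N" using N by simp
      note z = schur_kernel_zero[OF psd d this x]
      have "?L N x x \<le> K x x - 2 * K x (d k) + K (d k) (d k)"
        using schur_kernel_dist_antimono[of 0 N K d x "d k"] z by simp
      also have "\<dots> < e" using r(2)[of "d k"] k d by auto
      finally show ?thesis using psd_on_diag[OF psdN x, of N] by simp
    qed
    then show "\<exists>no. \<forall>N\<ge>no. norm (?L N x x - 0) < e" by blast
  qed
  have off: "(\<lambda>N. ?L N x y) \<longlonglongrightarrow> 0" if x: "x \<in> S" and y: "y \<in> S" for x y
  proof (rule Lim_null_comparison)
    show "(\<lambda>N. ?L N x x + ?L N y y) \<longlonglongrightarrow> 0" using tendsto_add[OF diag[OF x] diag[OF y]] by simp
    show "\<forall>\<^sub>F N in sequentially. norm (?L N x y) \<le> ?L N x x + ?L N y y"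
    proof (rule always_eventually, rule allI)
      \<comment> \<open>The instances \<open>t = 1\<close> and \<open>t = -1\<close> bound the
        residual off the diagonal by the diagonal.\<close>
      fix N show "norm (?L N x y) \<le> ?L N x x + ?L N y y"
        using psd_on_pair[OF psdN x y, of N 1] psd_on_pair[OF psdN x y, of N "-1"]
          psd_on_diag[OF psdN x, of N] psd_on_diag[OF psdN y, of N] by (simp add: abs_le_iff)
    qed
  qed
  have sums: "(\<lambda>i. ?e i x * ?e i y) sums K x y" if "x \<in> S" "y \<in> S" for x y
    unfolding sums_def schur_kernel_eq using tendsto_diff[OF tendsto_const off[OF that]] by simp
  define j where "j x = Abs_ell2 (\<lambda>i. ?e i x)" for x
  have nth: "ell2_nth (j x) = (\<lambda>i. ?e i x)" if "x \<in> S" for x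
    unfolding j_def using sums[OF that that]
    by (intro Abs_ell2_inverse) (simp add: power2_eq_square sums_iff)
  show ?thesis
  proof
    fix x y assume "x \<in> S" "y \<in> S"
    then show "inner (j x) (j y) = K x y"
      using sums[of x y] by (simp add: inner_ell2.rep_eq nth sums_iff)
  qed
qed

text \<open>The homogeneous form, in place of a normalisation to total weight 1, also covers weights
  of sum 0, whose energy it makes nonpositive.\<close>

definition energy_bound :: "real \<Rightarrow> 'a::metric_space set \<Rightarrow> real \<Rightarrow> bool" where
  "energy_bound p S C \<longleftrightarrow> (\<forall>F a. finite F \<longrightarrow> F \<subseteq> S \<longrightarrow>
     (\<Sum>x\<in>F. \<Sum>y\<in>F. a x * a y * dist x y powr p) \<le> C * (\<Sum>x\<in>F. a x)\<^sup>2)"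

text \<open>The Gram kernel \<open>K\<close> is forced: norms \<open>sqrt (C / 2)\<close> and
  squared distances \<open>dist x y powr p\<close> determine all inner products.\<close>

lemma snowflake_embedding:
  fixes S :: "'a::euclidean_space set"
  assumes p: "0 < p" and bd: "energy_bound p S C"
  obtains j :: "'a \<Rightarrow> ell2" where "\<And>x. x \<in> S \<Longrightarrow> norm (j x) = sqrt (C / 2)"
    and "\<And>x y. x \<in> S \<Longrightarrow> y \<in> S \<Longrightarrow> dist (j x) (j y) = dist x y powr (p / 2)"
proof -
  define K where "K x y = C / 2 - dist x y powr p / 2" for x y :: 'a
  have Kdist: "K x x - 2 * K x y + K y y = dist x y powr p" for x y
    using p by (simp add: K_def)
  have "psd_on S K"
    unfolding psd_on_def
  proof (intro conjI ballI allI impI)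
    fix F and a :: "'a \<Rightarrow> real" assume F: "finite F" "F \<subseteq> S"
    have "(\<Sum>x\<in>F. \<Sum>y\<in>F. a x * a y * K x y) =
        (\<Sum>x\<in>F. \<Sum>y\<in>F. C / 2 * (a x * a y) - 1 / 2 * (a x * a y * dist x y powr p))"
      by (simp add: K_def algebra_simps)
    also have "\<dots> = C / 2 * (\<Sum>x\<in>F. a x)\<^sup>2 - 1 / 2 * (\<Sum>x\<in>F. \<Sum>y\<in>F. a x * a y * dist x y powr p)"
      unfolding power2_eq_square sum_product by (simp add: sum_subtractf sum_distrib_left)
    finally show "0 \<le> (\<Sum>x\<in>F. \<Sum>y\<in>F. a x * a y * K x y)"
      using bd F unfolding energy_bound_def by simp
  qed (simp add: K_def dist_commute)
  moreover have "\<exists>r>0. \<forall>y\<in>S. dist y x < r \<longrightarrow> K x x - 2 * K x y + K y y < e" if "0 < e" for x e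
  proof (intro exI[of _ "e powr (1 / p)"] conjI ballI impI)
    fix y assume "dist y x < e powr (1 / p)"
    then have "dist x y powr p < (e powr (1 / p)) powr p"
      using p by (intro powr_less_mono2) (auto simp: dist_commute)
    then show "K x x - 2 * K x y + K y y < e" using p that by (simp add: Kdist powr_powr)
  qed (use that in simp)
  ultimately obtain j :: "'a \<Rightarrow> ell2" where j: "\<And>x y. x \<in> S \<Longrightarrow> y \<in> S \<Longrightarrow> inner (j x) (j y) = K x y"
    using kernel_embedding[of S K] by metis
  show ?thesis
  proof
    fix x assume x: "x \<in> S"
    then show "norm (j x) = sqrt (C / 2)" using j[OF x x] p by (simp add: norm_eq_sqrt_inner K_def)
  next
    fix x y assume xy: "x \<in> S" "y \<in> S"
    have "(dist (j x) (j y))\<^sup>2 = K x x - 2 * K x y + K y y"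
      using xy by (simp add: dist_norm power2_norm_eq_inner inner_diff j inner_commute algebra_simps)
    also have "\<dots> = (dist x y powr (p / 2))\<^sup>2"
      by (simp add: Kdist power2_eq_square flip: powr_add)
    finally show "dist (j x) (j y) = dist x y powr (p / 2)" by simp
  qed
qed

section \<open>Energy of measures on a sphere\<close>

lemma integrable_bounded:
  fixes f :: "'a \<Rightarrow> real"
  assumes "finite_measure P" "f \<in> borel_measurable P" "\<And>x. x \<in> space P \<Longrightarrow> \<bar>f x\<bar> \<le> B"
  shows "integrable P f"
  using assms by (intro finite_measure.integrable_const_bound[where B = B]) auto

text \<open>A signed measure given as a finite combination of finite measures. This covers the
  Jordan decomposition, with coefficients 1 and -1, as well as the signed radial densities on the
  ball, whose Jordan decomposition is never computed.\<close>

locale measure_family =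
  fixes M :: "'a measure" and I :: "'i set" and a :: "'i \<Rightarrow> real" and \<mu> :: "'i \<Rightarrow> 'a measure"
  assumes finite_measure: "\<And>i. i \<in> I \<Longrightarrow> finite_measure (\<mu> i)"
    and sets_eq: "\<And>i. i \<in> I \<Longrightarrow> sets (\<mu> i) = sets M"
begin

definition comb_integral :: "('a \<Rightarrow> real) \<Rightarrow> real" where
  "comb_integral f = (\<Sum>i\<in>I. a i * (\<integral>x. f x \<partial>\<mu> i))"

lemma space_eq: "i \<in> I \<Longrightarrow> space (\<mu> i) = space M"
  using sets_eq by (rule sets_eq_imp_space_eq)

lemma measurable_eq: "i \<in> I \<Longrightarrow> f \<in> borel_measurable (\<mu> i) \<longleftrightarrow> f \<in> borel_measurable M"
  using measurable_cong_sets[OF sets_eq refl] by auto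

lemma integrable:
  fixes f :: "'a \<Rightarrow> real"
  assumes "i \<in> I" "f \<in> borel_measurable M" "\<And>x. x \<in> space M \<Longrightarrow> \<bar>f x\<bar> \<le> B"
  shows "integrable (\<mu> i) f"
  using assms by (intro integrable_bounded[where B = B] finite_measure) (auto simp: measurable_eq space_eq)

lemma comb_integral_cong:
  assumes "\<And>x. x \<in> space M \<Longrightarrow> f x = g x"
  shows "comb_integral f = comb_integral g"
proof -
  have "(\<integral>x. f x \<partial>\<mu> i) = (\<integral>x. g x \<partial>\<mu> i)" if "i \<in> I" for i
    using assms space_eq[OF that] by (intro Bochner_Integration.integral_cong) auto
  then show ?thesis by (simp add: comb_integral_def)
qed

lemma comb_integral_dominated:
  fixes s :: "nat \<Rightarrow> 'a \<Rightarrow> real"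
  assumes meas: "\<And>n. s n \<in> borel_measurable M"
    and lim: "\<And>x. x \<in> space M \<Longrightarrow> (\<lambda>n. s n x) \<longlonglongrightarrow> f x"
    and bound: "\<And>n x. x \<in> space M \<Longrightarrow> \<bar>s n x\<bar> \<le> B"
  shows "f \<in> borel_measurable M" and "(\<lambda>n. comb_integral (s n)) \<longlonglongrightarrow> comb_integral f"
proof -
  show f: "f \<in> borel_measurable M" using lim meas by (rule borel_measurable_LIMSEQ_real)
  have "(\<lambda>n. integral\<^sup>L (\<mu> i) (s n)) \<longlonglongrightarrow> integral\<^sup>L (\<mu> i) f" if i: "i \<in> I" for i
  proof (rule integral_dominated_convergence)
    show "f \<in> borel_measurable (\<mu> i)" "\<And>n. s n \<in> borel_measurable (\<mu> i)"
      using f meas i by (auto simp: measurable_eq)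
    show "integrable (\<mu> i) (\<lambda>_. B)" using finite_measure[OF i] by (simp add: finite_measure.integrable_const)
    show "AE x in \<mu> i. (\<lambda>n. s n x) \<longlonglongrightarrow> f x" by (rule AE_I2) (simp add: lim space_eq[OF i])
    show "\<And>n. AE x in \<mu> i. norm (s n x) \<le> B" by (rule AE_I2) (simp add: bound space_eq[OF i])
  qed
  then show "(\<lambda>n. comb_integral (s n)) \<longlonglongrightarrow> comb_integral f"
    unfolding comb_integral_def by (intro tendsto_sum tendsto_mult tendsto_const)
qed

lemma comb_integral_linear:
  assumes "\<And>i. i \<in> I \<Longrightarrow> integrable (\<mu> i) f" "\<And>i. i \<in> I \<Longrightarrow> integrable (\<mu> i) g"
  shows "comb_integral (\<lambda>x. b * f x + c * g x) = b * comb_integral f + c * comb_integral g"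
proof -
  have "comb_integral (\<lambda>x. b * f x + c * g x) =
      (\<Sum>i\<in>I. b * (a i * (\<integral>x. f x \<partial>\<mu> i)) + c * (a i * (\<integral>x. g x \<partial>\<mu> i)))"
    unfolding comb_integral_def using assms by (intro sum.cong refl) (simp add: algebra_simps)
  then show ?thesis by (simp add: comb_integral_def sum.distrib sum_distrib_left)
qed

lemma comb_integral_sum:
  assumes "\<And>k i. k \<in> K \<Longrightarrow> i \<in> I \<Longrightarrow> integrable (\<mu> i) (f k)"
  shows "comb_integral (\<lambda>x. \<Sum>k\<in>K. c k * f k x) = (\<Sum>k\<in>K. c k * comb_integral (f k))"
proof -
  have "comb_integral (\<lambda>x. \<Sum>k\<in>K. c k * f k x) = (\<Sum>i\<in>I. \<Sum>k\<in>K. c k * (a i * (\<integral>x. f k x \<partial>\<mu> i)))"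
    unfolding comb_integral_def using assms by (intro sum.cong refl) (simp add: sum_distrib_left mult.left_commute)
  also have "\<dots> = (\<Sum>k\<in>K. \<Sum>i\<in>I. c k * (a i * (\<integral>x. f k x \<partial>\<mu> i)))" by (rule sum.swap)
  finally show ?thesis by (simp add: comb_integral_def sum_distrib_left)
qed

lemma comb_integral_abs_le:
  assumes meas: "f \<in> borel_measurable M" and bound: "\<And>x. x \<in> space M \<Longrightarrow> \<bar>f x\<bar> \<le> B"
  shows "\<bar>comb_integral f\<bar> \<le> (\<Sum>i\<in>I. \<bar>a i\<bar> * (B * measure (\<mu> i) (space M)))"
proof -
  have "\<bar>integral\<^sup>L (\<mu> i) f\<bar> \<le> B * measure (\<mu> i) (space M)" if i: "i \<in> I" for i
  proof -
    have "\<bar>integral\<^sup>L (\<mu> i) f\<bar> \<le> (\<integral>x. \<bar>f x\<bar> \<partial>\<mu> i)" by (rule integral_abs_bound)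
    also have "\<dots> \<le> (\<integral>x. B \<partial>\<mu> i)"
      using finite_measure[OF i] integrable[OF i meas bound] bound space_eq[OF i]
      by (intro integral_mono integrable_abs finite_measure.integrable_const) auto
    also have "\<dots> = B * measure (\<mu> i) (space M)" by (simp add: space_eq[OF i] mult.commute)
    finally show ?thesis .
  qed
  then have "(\<Sum>i\<in>I. \<bar>a i * integral\<^sup>L (\<mu> i) f\<bar>) \<le> (\<Sum>i\<in>I. \<bar>a i\<bar> * (B * measure (\<mu> i) (space M)))"
    unfolding abs_mult by (intro sum_mono mult_left_mono) auto
  moreover have "\<bar>comb_integral f\<bar> \<le> (\<Sum>i\<in>I. \<bar>a i * integral\<^sup>L (\<mu> i) f\<bar>)"
    unfolding comb_integral_def by (rule sum_abs)
  ultimately show ?thesis by simp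
qed

text \<open>The energy is the sum of the squares of the numbers \<open>comb_integral (f i)\<close>,
  the coordinates of the integrated feature vector. The series is interchanged with the integrals
  one variable at a time by dominated convergence; the bound on the diagonal also dominates the
  partial sums off the diagonal.\<close>

lemma kernel_energy_nonneg:
  fixes f :: "nat \<Rightarrow> 'a \<Rightarrow> real"
  assumes f: "\<And>i. f i \<in> borel_measurable M"
    and sums: "\<And>x y. x \<in> space M \<Longrightarrow> y \<in> space M \<Longrightarrow> (\<lambda>i. f i x * f i y) sums K x y"
    and diag: "\<And>x. x \<in> space M \<Longrightarrow> K x x \<le> B"
  shows "0 \<le> comb_integral (\<lambda>y. comb_integral (\<lambda>x. K x y))"
    and "(\<lambda>y. comb_integral (\<lambda>x. K x y)) \<in> borel_measurable M"
    and "\<And>y. y \<in> space M \<Longrightarrow> (\<lambda>x. K x y) \<in> borel_measurable M"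
    and "\<And>x y. x \<in> space M \<Longrightarrow> y \<in> space M \<Longrightarrow> \<bar>K x y\<bar> \<le> B"
proof -
  define S where "S n x y = (\<Sum>i<n. f i x * f i y)" for n x y
  have lim: "(\<lambda>n. S n x y) \<longlonglongrightarrow> K x y" if "x \<in> space M" "y \<in> space M" for x y
    using sums[OF that] by (simp add: sums_def S_def)
  have Sdiag: "S n x x \<le> B" if x: "x \<in> space M" for n x
  proof -
    have "S n x x \<le> K x x"
      unfolding S_def using sums[OF x x] sum_le_suminf[of "\<lambda>i. f i x * f i x" "{..<n}"] by (simp add: sums_iff)
    then show ?thesis using diag[OF x] by simp
  qed
  have Sb: "\<bar>S n x y\<bar> \<le> B" if x: "x \<in> space M" and y: "y \<in> space M" for n x y
  proof -
    have "\<bar>S n x y\<bar> \<le> (\<Sum>i<n. \<bar>f i x * f i y\<bar>)" unfolding S_def by (rule sum_abs)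
    also have "\<dots> \<le> (\<Sum>i<n. (f i x * f i x + f i y * f i y) / 2)"
    proof (rule sum_mono)
      fix i show "\<bar>f i x * f i y\<bar> \<le> (f i x * f i x + f i y * f i y) / 2"
        using sum_squares_bound[of "\<bar>f i x\<bar>" "\<bar>f i y\<bar>"] by (simp add: abs_mult power2_eq_square)
    qed
    also have "\<dots> = (S n x x + S n y y) / 2" by (simp add: S_def sum.distrib sum_divide_distrib add_divide_distrib)
    also have "\<dots> \<le> B" using Sdiag[OF x, of n] Sdiag[OF y, of n] by simp
    finally show ?thesis .
  qed
  show Kb: "\<bar>K x y\<bar> \<le> B" if "x \<in> space M" "y \<in> space M" for x y
    using tendsto_rabs[OF lim[OF that]] Sb[OF that] by (intro LIMSEQ_le_const2) auto
  have Sm: "(\<lambda>x. S n x y) \<in> borel_measurable M" for n y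
    unfolding S_def using f by measurable
  note dom1 = comb_integral_dominated[OF Sm lim Sb]
  show "(\<lambda>x. K x y) \<in> borel_measurable M" if "y \<in> space M" for y
    using that by (intro dom1(1))
  have fb: "\<bar>f i x\<bar> \<le> sqrt B" if x: "x \<in> space M" for i x
  proof -
    have "f i x * f i x \<le> S (Suc i) x x" by (simp add: S_def sum_nonneg)
    then have "(f i x)\<^sup>2 \<le> B" using Sdiag[OF x, of "Suc i"] by (simp add: power2_eq_square)
    then show ?thesis by (metis real_sqrt_abs real_sqrt_le_iff)
  qed
  have fi: "integrable (\<mu> k) (f i)" if "k \<in> I" for i k
    using that f fb by (intro integrable[where B = "sqrt B"]) auto
  have DS: "comb_integral (\<lambda>x. S n x y) = (\<Sum>i<n. f i y * comb_integral (f i))" for n y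
    unfolding S_def using fi comb_integral_sum[of "{..<n}" f "\<lambda>i. f i y"] by (simp add: mult.commute)
  let ?D = "\<lambda>n y. comb_integral (\<lambda>x. S n x y)"
  have m2: "?D n \<in> borel_measurable M" for n
    unfolding DS using f by measurable
  have l2: "(\<lambda>n. ?D n y) \<longlonglongrightarrow> comb_integral (\<lambda>x. K x y)" if "y \<in> space M" for y
    using that by (intro dom1(2))
  have b2: "\<bar>?D n y\<bar> \<le> (\<Sum>i\<in>I. \<bar>a i\<bar> * (B * measure (\<mu> i) (space M)))" if "y \<in> space M" for n y
    using that by (intro comb_integral_abs_le[OF Sm] Sb)
  note dom2 = comb_integral_dominated[OF m2 l2 b2]
  show "(\<lambda>y. comb_integral (\<lambda>x. K x y)) \<in> borel_measurable M" by (rule dom2(1))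
  have "comb_integral (?D n) = (\<Sum>i<n. (comb_integral (f i))\<^sup>2)" for n
  proof -
    have "comb_integral (?D n) = (\<Sum>i<n. comb_integral (f i) * comb_integral (f i))"
      unfolding DS using fi comb_integral_sum[of "{..<n}" f "\<lambda>i. comb_integral (f i)"] by (simp add: mult.commute)
    then show ?thesis by (simp add: power2_eq_square)
  qed
  then have "0 \<le> comb_integral (?D n)" for n by (simp add: sum_nonneg)
  then show "0 \<le> comb_integral (\<lambda>y. comb_integral (\<lambda>x. K x y))"
    using dom2(2) by (intro LIMSEQ_le_const) auto
qed

text \<open>On the sphere the squared distance is \<open>2 * R^2\<close> minus twice the inner
  product, and the latter is a kernel of nonnegative energy.\<close>

lemma sphere_energy_le:
  fixes j :: "'a \<Rightarrow> ell2"
  assumes meas: "\<And>i. (\<lambda>x. ell2_nth (j x) i) \<in> borel_measurable M"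
    and norm: "\<And>x. x \<in> space M \<Longrightarrow> norm (j x) = R"
    and E: "\<And>x y. x \<in> space M \<Longrightarrow> y \<in> space M \<Longrightarrow> E x y = (dist (j x) (j y))\<^sup>2"
  shows "comb_integral (\<lambda>y. comb_integral (\<lambda>x. E x y)) \<le>
    2 * R\<^sup>2 * (\<Sum>i\<in>I. a i * measure (\<mu> i) (space M))\<^sup>2"
proof -
  define m where "m = (\<Sum>i\<in>I. a i * measure (\<mu> i) (space M))"
  define K where "K x y = inner (j x) (j y)" for x y
  have sums: "(\<lambda>i. ell2_nth (j x) i * ell2_nth (j y) i) sums K x y" for x y
    unfolding K_def inner_ell2.rep_eq using summable_ell2_mult by (rule summable_sums)
  have diag: "K x x \<le> R\<^sup>2" if "x \<in> space M" for x
    using norm[OF that] by (simp add: K_def power2_norm_eq_inner[symmetric])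
  note K = kernel_energy_nonneg[OF meas sums diag]
  have EK: "E x y = 2 * R\<^sup>2 * 1 + (- 2) * K x y" if "x \<in> space M" "y \<in> space M" for x y
  proof -
    have "(dist (j x) (j y))\<^sup>2 = (norm (j x))\<^sup>2 + (norm (j y))\<^sup>2 - 2 * K x y"
      unfolding dist_norm power2_norm_eq_inner K_def by (simp add: inner_diff_left inner_diff_right inner_commute)
    then show ?thesis using E[OF that] norm[OF that(1)] norm[OF that(2)] by simp
  qed
  have int: "integrable (\<mu> i) g"
    if "g \<in> borel_measurable M" "\<And>x. x \<in> space M \<Longrightarrow> \<bar>g x\<bar> \<le> b" "i \<in> I" for g :: "'a \<Rightarrow> real" and b i
    using that by (intro integrable[where B = b])
  have one: "comb_integral (\<lambda>_. 1) = m"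
    by (simp add: comb_integral_def m_def space_eq)
  let ?D = "\<lambda>y. comb_integral (\<lambda>x. K x y)"
  have "comb_integral (\<lambda>x. E x y) = 2 * R\<^sup>2 * m * 1 + (- 2) * ?D y" if y: "y \<in> space M" for y
  proof -
    have "comb_integral (\<lambda>x. E x y) = comb_integral (\<lambda>x. 2 * R\<^sup>2 * 1 + (- 2) * K x y)"
      using EK y by (intro comb_integral_cong) auto
    also have "\<dots> = 2 * R\<^sup>2 * comb_integral (\<lambda>_. 1) + (- 2) * ?D y"
      by (intro comb_integral_linear int[where b = 1] int[where b = "R\<^sup>2"] K(3,4) y) auto
    finally show ?thesis by (simp add: one)
  qed
  then have "comb_integral (\<lambda>y. comb_integral (\<lambda>x. E x y)) =
      comb_integral (\<lambda>y. 2 * R\<^sup>2 * m * 1 + (- 2) * ?D y)"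
    by (intro comb_integral_cong) auto
  also have "\<dots> = 2 * R\<^sup>2 * m * comb_integral (\<lambda>_. 1) + (- 2) * comb_integral ?D"
    by (intro comb_integral_linear int[where b = 1] int[where b = "\<Sum>i\<in>I. \<bar>a i\<bar> * (R\<^sup>2 * measure (\<mu> i) (space M))"]
        K(2) comb_integral_abs_le K(3,4)) auto
  also have "\<dots> \<le> 2 * R\<^sup>2 * m\<^sup>2"
    using K(1) by (simp add: one power2_eq_square)
  finally show ?thesis by (simp add: m_def)
qed

end

text \<open>A coordinate is the inner product with a unit vector, hence continuous.\<close>

lemma borel_measurable_ell2_nth:
  fixes j :: "'a::euclidean_space \<Rightarrow> ell2"
  assumes "continuous_on S j"
  shows "(\<lambda>x. ell2_nth (j x) i) \<in> borel_measurable (restrict_space borel S)"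
proof (rule borel_measurable_continuous_on_restrict)
  define e where "e = Abs_ell2 (\<lambda>k. if k = i then 1 else 0)"
  have e: "ell2_nth e = (\<lambda>k. if k = i then 1 else 0)"
    unfolding e_def
  proof (rule Abs_ell2_inverse)
    have "(\<lambda>k. (if k = i then 1 else 0 :: real)\<^sup>2) = (\<lambda>k. if k = i then 1 else 0)" by auto
    then show "(\<lambda>k. if k = i then 1 else 0 :: real) \<in> {x. summable (\<lambda>k. (x k)\<^sup>2)}"
      using summable_single[of i "\<lambda>_. 1 :: real"] by simp
  qed
  have "ell2_nth x i = inner x e" for x
    using sums_single[of i "\<lambda>k. ell2_nth x k"]
    by (simp add: inner_ell2.rep_eq e sums_iff if_distrib cong: if_cong)
  then show "continuous_on S (\<lambda>x. ell2_nth (j x) i)"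
    using assms by (simp add: continuous_on_inner)
qed

lemma continuous_on_snowflake:
  fixes j :: "'a::metric_space \<Rightarrow> 'b::metric_space"
  assumes "0 < p" and "\<And>x y. x \<in> S \<Longrightarrow> y \<in> S \<Longrightarrow> dist (j x) (j y) = dist x y powr p"
  shows "continuous_on S j"
  unfolding continuous_on_iff
proof (intro ballI allI impI)
  fix x e assume x: "x \<in> S" and e: "0 < (e :: real)"
  have "dist (j y) (j x) < e" if "y \<in> S" "dist y x < e powr (1 / p)" for y
  proof -
    have "dist y x powr p < (e powr (1 / p)) powr p"
      using assms(1) that by (intro powr_less_mono2) auto
    then show ?thesis using assms x that e by (simp add: powr_powr)
  qed
  then show "\<exists>d>0. \<forall>x'\<in>S. dist x' x < d \<longrightarrow> dist (j x') (j x) < e"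
    using e by (intro exI[of _ "e powr (1 / p)"]) auto
qed

section \<open>Signed measures\<close>

lemma signed_measure_sums:
  "signed_measure M \<mu> \<Longrightarrow> range A \<subseteq> sets M \<Longrightarrow> disjoint_family A \<Longrightarrow> (\<lambda>i. \<mu> (A i)) sums \<mu> (\<Union>i. A i)"
  unfolding signed_measure_def by blast

lemma signed_measure_uminus:
  assumes "signed_measure M \<mu>"
  shows "signed_measure M (\<lambda>A. - \<mu> A)"
  unfolding signed_measure_def
proof (intro conjI allI impI)
  show "- \<mu> {} = 0" using assms by (simp add: signed_measure_def)
next
  fix A :: "nat \<Rightarrow> 'a set" assume "range A \<subseteq> sets M" "disjoint_family A"
  then show "(\<lambda>i. - \<mu> (A i)) sums - \<mu> (\<Union>i. A i)"
    by (intro sums_minus signed_measure_sums[OF assms])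
qed

lemma signed_measure_Un:
  assumes "signed_measure M \<mu>" "A \<in> sets M" "B \<in> sets M" "A \<inter> B = {}"
  shows "\<mu> (A \<union> B) = \<mu> A + \<mu> B"
proof -
  have "disjoint_family (binaryset A B)"
    using assms(4) by (auto simp: disjoint_family_on_def binaryset_def)
  then have "(\<lambda>i. \<mu> (binaryset A B i)) sums \<mu> (\<Union>i. binaryset A B i)"
    using assms(2,3) by (intro signed_measure_sums[OF assms(1)]) (auto simp: range_binaryset_eq)
  moreover have "(\<lambda>i. \<mu> (binaryset A B i)) sums (\<mu> A + \<mu> B)"
    using assms(1) by (intro binaryset_sums) (simp add: signed_measure_def)
  ultimately show ?thesis by (simp add: sums_iff UN_binaryset_eq)
qed

lemma signed_measure_Diff:
  assumes "signed_measure M \<mu>" "A \<in> sets M" "B \<in> sets M" "A \<subseteq> B"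
  shows "\<mu> (B - A) = \<mu> B - \<mu> A"
  using signed_measure_Un[OF assms(1,2), of "B - A"] assms by (simp add: Un_absorb1)

text \<open>Truncation of negative numbers to 0 is subadditive, and this survives the limit. The
  terms of \<open>f\<close> may have both signs.\<close>

lemma ennreal_sums_le_suminf:
  assumes "f sums s"
  shows "ennreal s \<le> (\<Sum>i. ennreal (f i))"
proof (rule LIMSEQ_le_const2)
  show "(\<lambda>n. ennreal (\<Sum>i<n. f i)) \<longlonglongrightarrow> ennreal s"
    using assms by (intro tendsto_ennrealI) (simp add: sums_def)
  have le: "ennreal (\<Sum>i<n. f i) \<le> (\<Sum>i<n. ennreal (f i))" for n
  proof (induction n)
    case (Suc n)
    have "ennreal ((\<Sum>i<n. f i) + f n) \<le> ennreal (\<Sum>i<n. f i) + ennreal (f n)"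
    proof -
      have pos: "ennreal x = ennreal (max 0 x)" for x by (simp add: max_def ennreal_neg)
      have "ennreal ((\<Sum>i<n. f i) + f n) \<le> ennreal (max 0 (\<Sum>i<n. f i) + max 0 (f n))"
        by (rule ennreal_leI) simp
      then show ?thesis by (simp add: pos[of "\<Sum>i<n. f i"] pos[of "f n"] flip: ennreal_plus)
    qed
    also have "\<dots> \<le> (\<Sum>i<n. ennreal (f i)) + ennreal (f n)" using Suc by (rule add_right_mono)
    finally show ?case by simp
  qed simp
  show "\<exists>N. \<forall>n\<ge>N. ennreal (\<Sum>i<n. f i) \<le> (\<Sum>i. ennreal (f i))"
    using le sum_le_suminf[of "\<lambda>i. ennreal (f i)" "{..<_}"] by (intro exI[of _ 0]) (auto intro: order.trans)
qed

section \<open>The Jordan decomposition of a signed measure\<close>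

definition pos_sup :: "'a measure \<Rightarrow> ('a set \<Rightarrow> real) \<Rightarrow> 'a set \<Rightarrow> ennreal" where
  "pos_sup M \<mu> A = (SUP B\<in>{B \<in> sets M. B \<subseteq> A}. ennreal (\<mu> B))"

lemma pos_sup_upper: "B \<in> sets M \<Longrightarrow> B \<subseteq> A \<Longrightarrow> ennreal (\<mu> B) \<le> pos_sup M \<mu> A"
  unfolding pos_sup_def by (rule SUP_upper) simp

lemma pos_sup_superadditive:
  assumes \<mu>: "signed_measure M \<mu>" and "A \<inter> B = {}"
  shows "pos_sup M \<mu> A + pos_sup M \<mu> B \<le> pos_sup M \<mu> (A \<union> B)"
proof -
  \<comment> \<open>Truncation is additive only on nonnegative values, so a test set of negative
    measure is exchanged for the empty set.\<close>
  have nonneg: "\<exists>C'\<in>sets M. C' \<subseteq> A \<and> ennreal (\<mu> C) = ennreal (\<mu> C') \<and> 0 \<le> \<mu> C'" if "C \<in> sets M" "C \<subseteq> A" for C A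
  proof (cases "0 \<le> \<mu> C")
    case True
    then show ?thesis using that by blast
  next
    case False
    then show ?thesis using \<mu> by (intro bexI[of _ "{}"]) (simp_all add: signed_measure_def ennreal_neg)
  qed
  have *: "ennreal (\<mu> C) + ennreal (\<mu> D) \<le> pos_sup M \<mu> (A \<union> B)"
    if CD: "C \<in> sets M" "C \<subseteq> A" "D \<in> sets M" "D \<subseteq> B" for C D
  proof -
    obtain C' D' where C': "C' \<in> sets M" "C' \<subseteq> A" "ennreal (\<mu> C) = ennreal (\<mu> C')" "0 \<le> \<mu> C'"
      and D': "D' \<in> sets M" "D' \<subseteq> B" "ennreal (\<mu> D) = ennreal (\<mu> D')" "0 \<le> \<mu> D'"
      using nonneg[OF CD(1,2)] nonneg[OF CD(3,4)] by blast
    have "ennreal (\<mu> C) + ennreal (\<mu> D) = ennreal (\<mu> (C' \<union> D'))"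
      using C' D' assms by (subst signed_measure_Un[OF \<mu>]) auto
    also have "\<dots> \<le> pos_sup M \<mu> (A \<union> B)" using C' D' by (intro pos_sup_upper) auto
    finally show ?thesis .
  qed
  show ?thesis
    unfolding pos_sup_def[of M \<mu> A] pos_sup_def[of M \<mu> B]
  proof (subst ennreal_SUP_add_left[symmetric])
    show "{C \<in> sets M. C \<subseteq> A} \<noteq> {}" by auto
    have "{D \<in> sets M. D \<subseteq> B} \<noteq> {}" by auto
    then show "(SUP C\<in>{C \<in> sets M. C \<subseteq> A}. ennreal (\<mu> C) + (SUP D\<in>{D \<in> sets M. D \<subseteq> B}. ennreal (\<mu> D)))
        \<le> pos_sup M \<mu> (A \<union> B)"
      by (intro SUP_least) (simp add: ennreal_SUP_add_right SUP_le_iff *)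
  qed
qed

lemma pos_sup_mono: "A \<subseteq> B \<Longrightarrow> pos_sup M \<mu> A \<le> pos_sup M \<mu> B"
  unfolding pos_sup_def by (rule SUP_subset_mono) auto

lemma pos_sup_empty: "signed_measure M \<mu> \<Longrightarrow> pos_sup M \<mu> {} = 0"
  unfolding pos_sup_def by (subst SUP_cong[of _ "{{}}" _ "\<lambda>_. 0"]) (auto simp: signed_measure_def)

lemma space_positive_part [simp]: "space (positive_part M \<mu>) = space M"
  and sets_positive_part [simp]: "sets (positive_part M \<mu>) = sets M"
  unfolding positive_part_def
  by (simp_all add: space_measure_of_conv sets_measure_of_conv sets.space_closed sets.sigma_sets_eq)

text \<open>\<open>measure_of\<close> returns the given set function only if that is countably
  additive. Superadditivity bounds the partial sums from above; cutting a test set along the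
  \<open>A i\<close> gives the converse.\<close>

lemma emeasure_positive_part:
  assumes \<mu>: "signed_measure M \<mu>" and A: "A \<in> sets M"
  shows "emeasure (positive_part M \<mu>) A = pos_sup M \<mu> A"
proof (rule emeasure_measure_of[OF positive_part_def[folded pos_sup_def]])
  show "sets M \<subseteq> Pow (space M)" by (rule sets.space_closed)
  show "A \<in> sets (positive_part M \<mu>)" using A by simp
  show "positive (sets (positive_part M \<mu>)) (pos_sup M \<mu>)"
    using \<mu> by (simp add: positive_def pos_sup_empty)
  show "countably_additive (sets (positive_part M \<mu>)) (pos_sup M \<mu>)"
  proof (rule countably_additiveI)
    fix A :: "nat \<Rightarrow> 'a set"
    assume "range A \<subseteq> sets (positive_part M \<mu>)" and dis: "disjoint_family A"
    then have rA: "range A \<subseteq> sets M" by simp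
    show "(\<Sum>i. pos_sup M \<mu> (A i)) = pos_sup M \<mu> (\<Union>i. A i)"
    proof (rule antisym)
      have "(\<Sum>i<n. pos_sup M \<mu> (A i)) \<le> pos_sup M \<mu> (\<Union>i<n. A i)" for n
      proof (induction n)
        case (Suc n)
        have "(\<Sum>i<Suc n. pos_sup M \<mu> (A i)) \<le> pos_sup M \<mu> (\<Union>i<n. A i) + pos_sup M \<mu> (A n)"
          using Suc by (simp add: add_right_mono)
        also have "\<dots> \<le> pos_sup M \<mu> ((\<Union>i<n. A i) \<union> A n)"
        proof (rule pos_sup_superadditive[OF \<mu>])
          have "A i \<inter> A n = {}" if "i < n" for i
            using disjoint_family_onD[OF dis, of i n] that by simp
          then show "(\<Union>i<n. A i) \<inter> A n = {}" by blast
        qed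
        finally show ?case by (simp add: lessThan_Suc Un_commute)
      qed simp
      also have "pos_sup M \<mu> (\<Union>i<n. A i) \<le> pos_sup M \<mu> (\<Union>i. A i)" for n
        by (rule pos_sup_mono) auto
      finally show "(\<Sum>i. pos_sup M \<mu> (A i)) \<le> pos_sup M \<mu> (\<Union>i. A i)"
        by (intro suminf_le_const summableI)
    next
      show "pos_sup M \<mu> (\<Union>i. A i) \<le> (\<Sum>i. pos_sup M \<mu> (A i))"
        unfolding pos_sup_def[of M \<mu> "\<Union>i. A i"]
      proof (rule SUP_least)
        fix B assume "B \<in> {B \<in> sets M. B \<subseteq> (\<Union>i. A i)}"
        then have B: "B \<in> sets M" "B \<subseteq> (\<Union>i. A i)" by auto
        have "(\<lambda>i. \<mu> (B \<inter> A i)) sums \<mu> (\<Union>i. B \<inter> A i)"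
          using B rA disjoint_family_subset[OF dis] by (intro signed_measure_sums[OF \<mu>]) auto
        also have "(\<Union>i. B \<inter> A i) = B" using B by auto
        finally have "ennreal (\<mu> B) \<le> (\<Sum>i. ennreal (\<mu> (B \<inter> A i)))" by (rule ennreal_sums_le_suminf)
        also have "\<dots> \<le> (\<Sum>i. pos_sup M \<mu> (A i))"
          using B rA by (intro suminf_le pos_sup_upper summableI) auto
        finally show "ennreal (\<mu> B) \<le> (\<Sum>i. pos_sup M \<mu> (A i))" .
      qed
    qed
  qed
qed

text \<open>If the supremum were infinite, pieces of measure above 1 in absolute value could be
  split off forever, each time leaving a set with infinite supremum. The pieces are disjoint, so
  their measures would have to be summable.\<close>

lemma pos_sup_finite:
  assumes \<mu>: "signed_measure M \<mu>"
  shows "pos_sup M \<mu> (space M) \<noteq> \<infinity>"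
proof
  assume inf: "pos_sup M \<mu> (space M) = \<infinity>"
  have step: "\<exists>E'\<in>sets M. E' \<subseteq> E \<and> pos_sup M \<mu> E' = \<infinity> \<and> 1 < \<bar>\<mu> (E - E')\<bar>"
    if E: "E \<in> sets M" "pos_sup M \<mu> E = \<infinity>" for E
  proof -
    \<comment> \<open>A set \<open>A\<close> with \<open>\<mu> A > 1 + |\<mu> E|\<close> makes both
      \<open>A\<close> and \<open>E - A\<close> have measure above 1 in absolute value. So whichever
      of the two still has infinite supremum can be kept and the other one split off.\<close>
    have "ennreal (1 + \<bar>\<mu> E\<bar>) < pos_sup M \<mu> E" unfolding E(2) infinity_ennreal_def by (rule ennreal_less_top)
    then obtain A where A: "A \<in> sets M" "A \<subseteq> E" "ennreal (1 + \<bar>\<mu> E\<bar>) < ennreal (\<mu> A)"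
      unfolding pos_sup_def less_SUP_iff by auto
    have gt: "1 + \<bar>\<mu> E\<bar> < \<mu> A"
      using A(3) by (subst (asm) ennreal_less_iff) auto
    have EA: "\<mu> (E - A) = \<mu> E - \<mu> A" using \<mu> A E by (intro signed_measure_Diff) auto
    have "pos_sup M \<mu> E = pos_sup M \<mu> A + pos_sup M \<mu> (E - A)"
    proof -
      have "A \<union> (E - A) = E" using A by auto
      then show ?thesis
        using A(1) E(1) plus_emeasure[of A "positive_part M \<mu>" "E - A"]
        by (simp add: emeasure_positive_part[OF \<mu>] del: Un_Diff_cancel)
    qed
    then consider "pos_sup M \<mu> A = \<infinity>" | "pos_sup M \<mu> (E - A) = \<infinity>"
      unfolding E(2) infinity_ennreal_def using ennreal_add_eq_top by metis
    then show ?thesis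
    proof cases
      case 1
      then show ?thesis using A gt EA by (intro bexI[of _ A]) auto
    next
      case 2
      moreover have "E - (E - A) = A" using A by auto
      ultimately show ?thesis using A E gt by (intro bexI[of _ "E - A"]) auto
    qed
  qed
  have "\<exists>E. \<forall>n. (E n \<in> sets M \<and> pos_sup M \<mu> (E n) = \<infinity>) \<and>
      (E (Suc n) \<subseteq> E n \<and> 1 < \<bar>\<mu> (E n - E (Suc n))\<bar>)"
  proof (rule dependent_nat_choice)
    show "\<exists>E. E \<in> sets M \<and> pos_sup M \<mu> E = \<infinity>" using inf by blast
    show "\<exists>E'. (E' \<in> sets M \<and> pos_sup M \<mu> E' = \<infinity>) \<and> E' \<subseteq> E \<and> 1 < \<bar>\<mu> (E - E')\<bar>"
      if "E \<in> sets M \<and> pos_sup M \<mu> E = \<infinity>" for E n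
      using step[of E] that by blast
  qed
  then obtain E where E: "\<And>n. E n \<in> sets M" "\<And>n. E (Suc n) \<subseteq> E n" "\<And>n. 1 < \<bar>\<mu> (E n - E (Suc n))\<bar>"
    by blast
  have anti: "E n \<subseteq> E m" if "m \<le> n" for m n
    using E(2) that by (rule lift_Suc_antimono_le)
  have "disjoint_family (\<lambda>n. E n - E (Suc n))"
    unfolding disjoint_family_on_def
  proof (intro ballI impI)
    fix m n :: nat assume "m \<noteq> n"
    then have "E n \<subseteq> E (Suc m) \<or> E m \<subseteq> E (Suc n)"
      using anti[of "Suc m" n] anti[of "Suc n" m] by linarith
    then show "(E m - E (Suc m)) \<inter> (E n - E (Suc n)) = {}" by blast
  qed
  then have "summable (\<lambda>n. \<mu> (E n - E (Suc n)))"
    using E(1) by (intro sums_summable[OF signed_measure_sums[OF \<mu>]]) auto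
  then have "(\<lambda>n. \<bar>\<mu> (E n - E (Suc n))\<bar>) \<longlonglongrightarrow> 0" by (intro tendsto_rabs_zero summable_LIMSEQ_zero)
  moreover have "\<exists>N. \<forall>n\<ge>N. 1 \<le> \<bar>\<mu> (E n - E (Suc n))\<bar>"
    using E(3) by (intro exI[of _ 0]) (auto intro: less_imp_le)
  ultimately have "1 \<le> (0 :: real)" by (rule LIMSEQ_le_const)
  then show False by simp
qed

lemma finite_positive_part:
  assumes \<mu>: "signed_measure M \<mu>"
  shows "finite_measure (positive_part M \<mu>)"
  by (rule finite_measureI) (use pos_sup_finite[OF \<mu>] in \<open>simp add: emeasure_positive_part[OF \<mu>]\<close>)

text \<open>One half of the Jordan identity for the total mass; the other half is the same
  inequality for the negated measure. A test set \<open>B\<close> has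
  \<open>\<mu> B = \<mu> (space M) - \<mu> (space M - B)\<close>, and the negative part controls the
  last term.\<close>

lemma measure_positive_part_le:
  assumes \<mu>: "signed_measure M \<mu>"
  shows "measure (positive_part M \<mu>) (space M) \<le>
    \<mu> (space M) + measure (positive_part M (\<lambda>A. - \<mu> A)) (space M)"
proof -
  note \<mu>' = signed_measure_uminus[OF \<mu>]
  define n where "n = measure (positive_part M (\<lambda>A. - \<mu> A)) (space M)"
  have n: "pos_sup M (\<lambda>A. - \<mu> A) (space M) = ennreal n"
    using finite_measure.emeasure_eq_measure[OF finite_positive_part[OF \<mu>']]
    by (simp add: n_def flip: emeasure_positive_part[OF \<mu>' sets.top])
  have le: "- \<mu> A \<le> n" if "A \<in> sets M" for A
  proof -
    have "ennreal (- \<mu> A) \<le> ennreal n"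
      using pos_sup_upper[of A M "space M" "\<lambda>A. - \<mu> A"] that sets.sets_into_space[OF that] n by simp
    moreover have "0 \<le> n" by (simp add: n_def)
    ultimately show ?thesis by (simp add: ennreal_le_iff)
  qed
  have "0 \<le> \<mu> (space M) + n" using le[of "space M"] by simp
  moreover have "pos_sup M \<mu> (space M) \<le> ennreal (\<mu> (space M) + n)"
    unfolding pos_sup_def
  proof (rule SUP_least)
    fix B assume "B \<in> {B \<in> sets M. B \<subseteq> space M}"
    then show "ennreal (\<mu> B) \<le> ennreal (\<mu> (space M) + n)"
      using le[of "space M - B"] signed_measure_Diff[OF \<mu>, of B "space M"] by (intro ennreal_leI) auto
  qed
  moreover have "pos_sup M \<mu> (space M) = ennreal (measure (positive_part M \<mu>) (space M))"
    using finite_measure.emeasure_eq_measure[OF finite_positive_part[OF \<mu>], of "space M"]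
      emeasure_positive_part[OF \<mu> sets.top] by simp
  ultimately have "ennreal (measure (positive_part M \<mu>) (space M)) \<le> ennreal (\<mu> (space M) + n)"
    by simp
  then show ?thesis using \<open>0 \<le> \<mu> (space M) + n\<close> by (simp only: ennreal_le_iff n_def)
qed

lemma measure_positive_part_diff:
  assumes \<mu>: "signed_measure M \<mu>"
  shows "measure (positive_part M \<mu>) (space M) - measure (positive_part M (\<lambda>A. - \<mu> A)) (space M) = \<mu> (space M)"
  using measure_positive_part_le[OF \<mu>] measure_positive_part_le[OF signed_measure_uminus[OF \<mu>]] by simp

lemma signed_energy_le:
  fixes j :: "real \<Rightarrow> ell2"
  assumes p: "0 < p" and \<mu>: "signed_measure borel_interval \<mu>"
    and norm: "\<And>x. x \<in> {-1..1} \<Longrightarrow> norm (j x) = R"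
    and dist: "\<And>x y. x \<in> {-1..1} \<Longrightarrow> y \<in> {-1..1} \<Longrightarrow> dist (j x) (j y) = dist x y powr (p / 2)"
  shows "signed_integral borel_interval \<mu> (\<lambda>v. signed_integral borel_interval \<mu> (\<lambda>u. \<bar>u - v\<bar> powr p)) \<le>
    2 * R\<^sup>2 * (\<mu> {-1..1})\<^sup>2"
proof -
  have sp: "space borel_interval = {-1..1::real}" by (simp add: space_restrict_space)
  have cont: "continuous_on {-1..1} j"
    using p dist by (intro continuous_on_snowflake[of "p / 2"]) auto
  have E: "\<bar>x - y\<bar> powr p = (dist (j x) (j y))\<^sup>2" if "x \<in> {-1..1}" "y \<in> {-1..1}" for x y
    using dist[OF that] by (simp add: power2_eq_square dist_real_def flip: powr_add)
  \<comment> \<open>The index \<open>True\<close> carries the positive part with coefficient 1, the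
    index \<open>False\<close> the negative part with coefficient -1, so
    \<open>comb_integral\<close> is the signed integral.\<close>
  interpret measure_family borel_interval UNIV "\<lambda>b. if b then 1 else - 1"
    "\<lambda>b. positive_part borel_interval (if b then \<mu> else (\<lambda>A. - \<mu> A))"
  proof (rule measure_family.intro, goal_cases)
    case (1 b)
    then show ?case
      by (simp add: finite_positive_part[OF \<mu>] finite_positive_part[OF signed_measure_uminus[OF \<mu>]])
  qed simp
  have comb: "comb_integral f = signed_integral borel_interval \<mu> f" for f
    unfolding comb_integral_def signed_integral_def by (simp add: UNIV_bool)
  show ?thesis
    using sphere_energy_le[OF borel_measurable_ell2_nth[OF cont], unfolded sp comb, OF norm E]
      measure_positive_part_diff[OF \<mu>]
    by (simp add: UNIV_bool sp)
qed

section \<open>Signed measures with finite support\<close>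

lemma signed_measure_sum_points:
  "signed_measure M (\<lambda>A. \<Sum>x\<in>F. a x * indicator A x)"
  unfolding signed_measure_def
proof (intro conjI allI impI)
  fix A :: "nat \<Rightarrow> 'a set" assume "disjoint_family A"
  then show "(\<lambda>i. \<Sum>x\<in>F. a x * indicator (A i) x) sums (\<Sum>x\<in>F. a x * indicator (\<Union>i. A i) x)"
    by (intro sums_sum sums_mult indicator_sums) (auto simp: disjoint_family_on_def)
qed simp

lemma integral_positive_part_points:
  fixes f :: "'a \<Rightarrow> real"
  assumes F: "finite F" "F \<subseteq> space M" and single: "\<And>x. x \<in> F \<Longrightarrow> {x} \<in> sets M"
    and f: "f \<in> borel_measurable M"
  shows "(\<integral>x. f x \<partial>positive_part M (\<lambda>A. \<Sum>x\<in>F. a x * indicator A x)) = (\<Sum>x\<in>F. max 0 (a x) * f x)"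
proof -
  let ?\<mu> = "\<lambda>A. \<Sum>x\<in>F. a x * indicator A x"
  let ?Q = "point_measure F (\<lambda>x. ennreal (max 0 (a x)))"
  have mid: "(\<lambda>x. x) \<in> measurable ?Q M" using F by (auto simp: measurable_point_measure_eq1)
  have "positive_part M ?\<mu> = distr ?Q M (\<lambda>x. x)"
  proof (rule measure_eqI)
    fix A assume "A \<in> sets (positive_part M ?\<mu>)"
    then have A: "A \<in> sets M" by simp
    \<comment> \<open>The supremum over subsets of \<open>A\<close> is attained at \<open>G\<close>,
      which keeps exactly the atoms of nonnegative weight.\<close>
    define G where "G = {x \<in> F. 0 \<le> a x} \<inter> A"
    have G: "G \<in> sets M"
    proof -
      have "(\<Union>x\<in>G. {x}) \<in> sets M" using F single by (intro sets.finite_UN) (auto simp: G_def)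
      then show ?thesis by simp
    qed
    have mG: "?\<mu> G = (\<Sum>x\<in>F \<inter> A. max 0 (a x))"
    proof -
      have "?\<mu> G = (\<Sum>x\<in>F. if x \<in> A then max 0 (a x) else 0)"
        by (intro sum.cong refl) (auto simp: G_def indicator_def)
      then show ?thesis by (simp only: sum.inter_restrict[OF F(1)])
    qed
    have "pos_sup M ?\<mu> A = ennreal (?\<mu> G)"
    proof (rule antisym)
      show "ennreal (?\<mu> G) \<le> pos_sup M ?\<mu> A" using G by (intro pos_sup_upper) (auto simp: G_def)
      show "pos_sup M ?\<mu> A \<le> ennreal (?\<mu> G)"
        unfolding pos_sup_def
      proof (rule SUP_least)
        fix B assume "B \<in> {B \<in> sets M. B \<subseteq> A}"
        then show "ennreal (?\<mu> B) \<le> ennreal (?\<mu> G)"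
          by (intro ennreal_leI sum_mono) (auto simp: G_def indicator_def)
      qed
    qed
    also have "\<dots> = (\<Sum>x\<in>F \<inter> A. ennreal (max 0 (a x)))"
      unfolding mG by (rule sum_ennreal[symmetric]) simp
    also have "\<dots> = emeasure (distr ?Q M (\<lambda>x. x)) A"
      using F A mid by (simp add: emeasure_distr emeasure_point_measure_finite space_point_measure Int_commute
          del: sum_ennreal)
    finally show "emeasure (positive_part M ?\<mu>) A = emeasure (distr ?Q M (\<lambda>x. x)) A"
      by (simp add: emeasure_positive_part[OF signed_measure_sum_points A])
  qed simp
  then show ?thesis
    using F f mid by (simp add: integral_distr lebesgue_integral_point_measure_finite)
qed

lemma signed_integral_points:
  fixes f :: "'a \<Rightarrow> real"
  assumes "finite F" "F \<subseteq> space M" "\<And>x. x \<in> F \<Longrightarrow> {x} \<in> sets M" "f \<in> borel_measurable M"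
  shows "signed_integral M (\<lambda>A. \<Sum>x\<in>F. a x * indicator A x) f = (\<Sum>x\<in>F. a x * f x)"
proof -
  have eq: "(\<lambda>A. - (\<Sum>x\<in>F. a x * indicator A x)) = (\<lambda>A. \<Sum>x\<in>F. - a x * indicator A x)"
    by (simp add: sum_negf)
  have "max 0 r - max 0 (- r) = r" for r :: real by simp
  then show ?thesis
    using integral_positive_part_points[OF assms, of a] integral_positive_part_points[OF assms, of "\<lambda>x. - a x"]
    unfolding signed_integral_def eq
    by (simp only: sum_subtractf[symmetric] left_diff_distrib[symmetric])
qed

section \<open>Boundedness of the energy on the interval\<close>

definition hat :: "real \<Rightarrow> real" where "hat x = max 0 (1 - \<bar>x\<bar>)"

text \<open>The cubic cardinal B-spline, which is \<open>hat\<close> convolved with itself; this is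
  the source of its positive definiteness.\<close>

definition bspline :: "real \<Rightarrow> real" where
  "bspline d = (if \<bar>d\<bar> \<le> 1 then 2/3 - \<bar>d\<bar>^2 + \<bar>d\<bar>^3 / 2 else if \<bar>d\<bar> \<le> 2 then (2 - \<bar>d\<bar>)^3 / 6 else 0)"

lemma has_integral_antideriv:
  fixes f F :: "real \<Rightarrow> real"
  assumes "a \<le> b" and "\<And>x. x \<in> {a..b} \<Longrightarrow> (F has_real_derivative f x) (at x within {a..b})" and "F b - F a = i"
  shows "(f has_integral i) {a..b}"
  using fundamental_theorem_of_calculus[OF assms(1), of F f] assms(2,3)
  by (simp add: has_real_derivative_iff_has_vector_derivative)

lemma hat_convolution_ordered:
  assumes "s \<le> t"
  shows "((\<lambda>x. hat (x - s) * hat (x - t)) has_integral bspline (t - s)) UNIV"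
proof -
  define d where "d = t - s"
  have d0: "0 \<le> d" using assms by (simp add: d_def)
  let ?f = "\<lambda>x. hat (x - s) * hat (x - t)"
  \<comment> \<open>The supports overlap in one of three ways: for \<open>d \<le> 1\<close> the
    product of the hats has three pieces, for \<open>1 < d \<le> 2\<close> only a piece between the
    two centres, and beyond that it vanishes.\<close>
  consider "d \<le> 1" | "1 < d" "d \<le> 2" | "2 < d" by linarith
  then show ?thesis
  proof cases
    case 1
    have t: "t = s + d" by (simp add: d_def)
    have "(?f has_integral ((1-d)^3/3 + d*(1-d)^2/2)) {t - 1..s}"
    proof (rule has_integral_eq)
      \<comment> \<open>In terms of \<open>w = x - s + (1 - d)\<close> the two hats are
        \<open>w + d\<close> and \<open>w\<close> here.\<close>
      show "((\<lambda>x. (x - s + (1 - d)) ^ 2 + d * (x - s + (1 - d))) has_integral ((1-d)^3/3 + d*(1-d)^2/2)) {t - 1..s}"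
        by (rule has_integral_antideriv[where F = "\<lambda>x. (x - s + (1 - d))^3/3 + d*(x - s + (1 - d))^2/2"])
          (use 1 in \<open>auto simp: t intro!: derivative_eq_intros\<close>)
      show "(x - s + (1 - d)) ^ 2 + d * (x - s + (1 - d)) = ?f x" if "x \<in> {t - 1..s}" for x
        using that 1 d0 by (simp add: hat_def d_def power2_eq_square algebra_simps)
    qed
    moreover have "(?f has_integral ((1-d)*d + d^3/2 - d^3/3)) {s..t}"
    proof (rule has_integral_eq)
      show "((\<lambda>x. (1-d) + d*(x-s) - (x-s)^2) has_integral ((1-d)*d + d^3/2 - d^3/3)) {s..t}"
      proof (rule has_integral_antideriv[where F = "\<lambda>x. (1-d)*(x-s) + d*(x-s)^2/2 - (x-s)^3/3"])
        show "((\<lambda>x. (1-d)*(x-s) + d*(x-s)^2/2 - (x-s)^3/3) has_real_derivative (1-d) + d*(x-s) - (x-s)^2)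
            (at x within {s..t})" for x
          by (rule derivative_eq_intros refl | simp add: power2_eq_square)+
      qed (use 1 d0 in \<open>auto simp: d_def power2_eq_square power3_eq_cube\<close>)
      show "(1-d) + d*(x-s) - (x-s)^2 = ?f x" if "x \<in> {s..t}" for x
        using that 1 d0 by (simp add: hat_def d_def power2_eq_square algebra_simps)
    qed
    moreover have "(?f has_integral ((1-d)^3/3 + d*(1-d)^2/2)) {t..s + 1}"
    proof (rule has_integral_eq)
      show "((\<lambda>x. (s + 1 - x) ^ 2 + d * (s + 1 - x)) has_integral ((1-d)^3/3 + d*(1-d)^2/2)) {t..s + 1}"
      proof (rule has_integral_antideriv[where F = "\<lambda>x. - ((s + 1 - x)^3/3 + d*(s + 1 - x)^2/2)"])
        show "((\<lambda>x. - ((s + 1 - x)^3/3 + d*(s + 1 - x)^2/2)) has_real_derivative (s + 1 - x) ^ 2 + d * (s + 1 - x))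
            (at x within {t..s + 1})" for x
          by (rule derivative_eq_intros refl | simp add: power2_eq_square)+ (simp add: field_simps)
      qed (use 1 in \<open>auto simp: d_def algebra_simps\<close>)
      show "(s + 1 - x) ^ 2 + d * (s + 1 - x) = ?f x" if "x \<in> {t..s + 1}" for x
        using that 1 d0 by (simp add: hat_def d_def power2_eq_square algebra_simps)
    qed
    ultimately have "(?f has_integral (((1-d)^3/3 + d*(1-d)^2/2) + (((1-d)*d + d^3/2 - d^3/3) +
        ((1-d)^3/3 + d*(1-d)^2/2)))) {t - 1..s + 1}"
      using 1 d0 by (intro has_integral_combine[of "t - 1" s "s + 1"] has_integral_combine[of s t "s + 1"]) (auto simp: d_def)
    also have "(((1-d)^3/3 + d*(1-d)^2/2) + (((1-d)*d + d^3/2 - d^3/3) + ((1-d)^3/3 + d*(1-d)^2/2))) = bspline d"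
      using 1 d0 by (simp add: bspline_def power2_eq_square power3_eq_cube field_simps)
    finally have "(?f has_integral bspline d) {t - 1..s + 1}" .
    then show ?thesis
      unfolding d_def by (rule has_integral_on_superset) (auto simp: hat_def)
  next
    case 2
    have "(?f has_integral (2 - d)^3 / 6) {t - 1..s + 1}"
    proof (rule has_integral_eq)
      show "((\<lambda>x. (1-d) + d*(x-s) - (x-s)^2) has_integral ((2-d)^3/6)) {t - 1..s + 1}"
      proof (rule has_integral_antideriv[where F = "\<lambda>x. (1-d)*(x-s) + d*(x-s)^2/2 - (x-s)^3/3"])
        have "t = s + d" by (simp add: d_def)
        then show "(1-d)*(s + 1-s) + d*(s + 1-s)^2/2 - (s + 1-s)^3/3 -
            ((1-d)*(t - 1-s) + d*(t - 1-s)^2/2 - (t - 1-s)^3/3) = (2 - d)^3 / 6"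
          by (simp add: power2_eq_square power3_eq_cube field_simps)
      qed (use 2 in \<open>auto simp: d_def intro!: derivative_eq_intros\<close>)
      show "(1-d) + d*(x-s) - (x-s)^2 = ?f x" if "x \<in> {t - 1..s + 1}" for x
        using that 2 by (simp add: hat_def d_def power2_eq_square algebra_simps)
    qed
    moreover have "bspline d = (2 - d)^3/6" using 2 by (simp add: bspline_def)
    ultimately have "(?f has_integral bspline d) {t - 1..s + 1}" by metis
    then show ?thesis
      unfolding d_def by (rule has_integral_on_superset) (auto simp: hat_def)
  next
    case 3
    have "?f = (\<lambda>x. 0)" using 3 by (auto simp: hat_def d_def max_def fun_eq_iff abs_if)
    then show ?thesis using 3 by (simp add: bspline_def d_def)
  qed
qed

lemma hat_convolution: "((\<lambda>x. hat (x - s) * hat (x - t)) has_integral bspline (s - t)) UNIV"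
proof -
  have "bspline (t - s) = bspline (s - t)" by (simp add: bspline_def abs_minus_commute)
  then show ?thesis
    using hat_convolution_ordered[of s t] hat_convolution_ordered[of t s]
    by (cases "s \<le> t") (auto simp: mult.commute)
qed

text \<open>The double sum is the integral of the square of a combination of shifted hats.\<close>

lemma bspline_psd:
  assumes "finite F"
  shows "0 \<le> (\<Sum>x\<in>F. \<Sum>y\<in>F. a x * a y * bspline (u x - u y))"
proof (rule has_integral_nonneg)
  show "((\<lambda>z. \<Sum>x\<in>F. \<Sum>y\<in>F. a x * a y * (hat (z - u x) * hat (z - u y))) has_integral
      (\<Sum>x\<in>F. \<Sum>y\<in>F. a x * a y * bspline (u x - u y))) UNIV"
    using assms by (intro has_integral_sum has_integral_mult_right hat_convolution)
  fix z
  have "(\<Sum>x\<in>F. \<Sum>y\<in>F. a x * a y * (hat (z - u x) * hat (z - u y))) = (\<Sum>x\<in>F. a x * hat (z - u x))\<^sup>2"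
    by (simp add: power2_eq_square sum_product mult_ac)
  then show "0 \<le> (\<Sum>x\<in>F. \<Sum>y\<in>F. a x * a y * (hat (z - u x) * hat (z - u y)))" by simp
qed

text \<open>For \<open>t / 2 \<le> r \<le> t\<close> the ratio \<open>t / r\<close> lies in the
  outer branch of the spline. The substitution \<open>r = t * x\<close> shows that this range
  contributes a multiple of \<open>t powr p\<close>; the estimate of the factor \<open>k\<close>
  serves to make \<open>C\<close> positive in \<open>energy_bound_interval\<close>.\<close>

lemma bspline_scaled_core:
  fixes p :: real assumes p: "0 < p"
  obtains k where "k \<le> 1 / (6 * p)"
    and "\<And>t. 0 < t \<Longrightarrow> ((\<lambda>r. bspline (t / r) * r powr (p - 1)) has_integral (t powr p * k)) {t / 2..t}"
proof
  let ?g = "\<lambda>x. bspline (1 / x) * x powr (p - 1)"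
  define k where "k = integral {1 / 2..1} ?g"
  have g: "?g x = (2 - 1 / x) ^ 3 / 6 * x powr (p - 1)" if "x \<in> {1 / 2..1}" for x
    using that by (auto simp: bspline_def field_simps)
  have "continuous_on {1 / 2..1} (\<lambda>x. (2 - 1 / x) ^ 3 / 6 * x powr (p - 1))"
    by (intro continuous_intros) auto
  then have "?g integrable_on {1 / 2..1}"
    using integrable_continuous_real integrable_cong[of "{1 / 2..1}" ?g, OF g] by blast
  then have k: "(?g has_integral k) {1 / 2..1}" by (simp add: k_def integrable_integral)
  have pw: "((\<lambda>x. x powr (p - 1)) has_integral (1 powr p / p - (1/2) powr p / p)) {1 / 2..1}"
    using p by (intro has_integral_antideriv[where F = "\<lambda>x. x powr p / p"])
      (auto intro!: derivative_eq_intros)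
  have "k \<le> 1 / 6 * (1 powr p / p - (1/2) powr p / p)"
  proof (rule has_integral_le[OF k has_integral_mult_right[OF pw]])
    fix x :: real assume x: "x \<in> {1 / 2..1}"
    have "(2 - 1 / x) ^ 3 \<le> 1 ^ 3" using x by (intro power_mono) (auto simp: field_simps)
    then show "?g x \<le> 1 / 6 * x powr (p - 1)" unfolding g[OF x] by (intro mult_right_mono) auto
  qed
  also have "\<dots> \<le> 1 / (6 * p)" using p by (simp add: field_simps)
  finally show "k \<le> 1 / (6 * p)" .
  fix t :: real assume t: "0 < t"
  have "((\<lambda>r. ?g (1 / t * r)) has_integral (1 / \<bar>1 / t\<bar>) *\<^sub>R k) ((\<lambda>x. x / (1 / t)) ` {1 / 2..1})"
    using t by (intro has_integral_stretch_real k) auto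
  moreover have "(\<lambda>x. x / (1 / t)) ` {1 / 2..1} = {t / 2..t}"
    using t image_mult_atLeastAtMost[of t "1/2" 1] by (simp add: mult.commute)
  ultimately have "((\<lambda>r. ?g (r / t)) has_integral (t * k)) {t / 2..t}" using t by simp
  then have "((\<lambda>r. t powr (p - 1) * ?g (r / t)) has_integral (t powr (p - 1) * (t * k))) {t / 2..t}"
    by (rule has_integral_mult_right)
  then have "((\<lambda>r. bspline (t / r) * r powr (p - 1)) has_integral (t powr (p - 1) * (t * k))) {t / 2..t}"
    by (rule has_integral_eq[rotated]) (use t in \<open>auto simp: powr_divide\<close>)
  also have "t powr (p - 1) * (t * k) = t powr p * k" using t by (simp add: powr_diff)
  finally show "((\<lambda>r. bspline (t / r) * r powr (p - 1)) has_integral (t powr p * k)) {t / 2..t}" .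
qed

text \<open>The mixture of the dilates \<open>r \<le> 2\<close> of the cubic spline reproduces \<open>- \<bar>t\<bar> powr p\<close> up to a quadratic
  and a cubic term, and these are cancelled by one further dilate.\<close>
lemma energy_bound_interval:
  assumes p: "0 < p" "p < 2"
  shows "\<exists>C. energy_bound p {-1..1 :: real} C"
proof -
  obtain k where k: "k \<le> 1 / (6 * p)"
    and core: "\<And>t. 0 < t \<Longrightarrow> ((\<lambda>r. bspline (t / r) * r powr (p - 1)) has_integral (t powr p * k)) {t / 2..t}"
    using bspline_scaled_core[OF p(1)] by metis
  \<comment> \<open>The lower endpoint of the integral over \<open>t \<le> r \<le> 2\<close>
    contributes \<open>C + k\<close> times \<open>- t powr p\<close>; adding the share
    \<open>k\<close> of the outer branch leaves the coefficient \<open>- C\<close> in the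
    mixture.\<close>
  define C where "C = 2 / (3 * p) + 1 / (2 - p) - 1 / (2 * (3 - p)) - k"
  have C: "0 < C"
  proof -
    have "1 / (6 * p) < 2 / (3 * p)" using p by (simp add: field_simps)
    moreover have "1 / (2 * (3 - p)) \<le> 1 / (2 - p)" using p by (simp add: field_simps)
    ultimately show ?thesis using k by (simp add: C_def)
  qed
  \<comment> \<open>The value of the mixture. Its constant, quadratic and cubic terms come from the
    endpoint \<open>r = 2\<close>.\<close>
  define G where "G t = 2 / 3 * 2 powr p / p + t\<^sup>2 * 2 powr (p - 2) / (2 - p) - t ^ 3 * 2 powr (p - 3) / (2 * (3 - p))
      - C * t powr p" for t :: real
  have mix: "((\<lambda>r. bspline (t / r) * r powr (p - 1)) has_integral G \<bar>t\<bar>) {0..2}" if "\<bar>t\<bar> \<le> 2" for t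
  proof (cases "t = 0")
    case True
    have "((\<lambda>r. 2 / 3 * r powr (p - 1)) has_integral (2 / 3 * (2 powr (p - 1 + 1) / (p - 1 + 1)))) {0..2}"
      using p by (intro has_integral_mult_right has_integral_powr_from_0) auto
    moreover have "(\<lambda>r. bspline (t / r) * r powr (p - 1)) = (\<lambda>r. 2 / 3 * r powr (p - 1))"
      using True by (simp add: bspline_def)
    moreover have "2 / 3 * (2 powr (p - 1 + 1) / (p - 1 + 1)) = G \<bar>t\<bar>" using True p by (simp add: G_def)
    ultimately show ?thesis by metis
  next
    case False
    define s where "s = \<bar>t\<bar>"
    have s: "0 < s" "s \<le> 2" using False that by (auto simp: s_def)
    let ?h = "\<lambda>r. bspline (s / r) * r powr (p - 1)"
    have "(?h has_integral 0) {0..s / 2}"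
    proof (rule has_integral_is_0)
      fix r assume r: "r \<in> {0..s / 2}"
      \<comment> \<open>At \<open>r = 0\<close> the weight \<open>0 powr (p - 1)\<close> is 0 by
        convention.\<close>
      show "?h r = 0"
      proof (cases "r = 0")
        case False
        then have "2 \<le> s / r" using r by (simp add: field_simps)
        then show ?thesis using r s by (simp add: bspline_def)
      qed simp
    qed
    moreover have "(?h has_integral (s powr p * k)) {s / 2..s}" by (rule core[OF s(1)])
    moreover have "(?h has_integral (G s - s powr p * k)) {s..2}"
    proof (rule has_integral_eq)
      let ?F = "\<lambda>r. 2 / 3 * (r powr p / p) - s\<^sup>2 * (r powr (p - 2) / (p - 2)) + s ^ 3 / 2 * (r powr (p - 3) / (p - 3))"
      show "((\<lambda>r. 2 / 3 * r powr (p - 1) - s\<^sup>2 * r powr (p - 3) + s ^ 3 / 2 * r powr (p - 4))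
          has_integral (G s - s powr p * k)) {s..2}"
      proof (rule has_integral_antideriv[where F = ?F])
        show "s \<le> 2" by (rule s)
        fix r assume r: "r \<in> {s..2}"
        show "(?F has_real_derivative 2 / 3 * r powr (p - 1) - s\<^sup>2 * r powr (p - 3) + s ^ 3 / 2 * r powr (p - 4))
            (at r within {s..2})"
          using r s p by (auto intro!: derivative_eq_intros simp: diff_diff_eq)
            (simp add: divide_eq_eq)
      next
        have e: "s\<^sup>2 * s powr (p - 2) = s powr p" "s ^ 3 * s powr (p - 3) = s powr p"
          using s by (simp_all add: powr_diff)
        have "?F s = 2 / 3 * s powr p / p - (s\<^sup>2 * s powr (p - 2)) / (p - 2) + (s ^ 3 * s powr (p - 3)) / (2 * (p - 3))"
          using p by (simp add: field_simps)
        also have "\<dots> = s powr p * (2 / (3 * p) - 1 / (p - 2) + 1 / (2 * (p - 3)))"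
          unfolding e by (simp add: algebra_simps)
        also have "1 / (p - 2) = - (1 / (2 - p))" by (metis minus_diff_eq minus_divide_right)
        also have "1 / (2 * (p - 3)) = - (1 / (2 * (3 - p)))"
          using p by (simp add: field_simps)
        finally have Fs: "?F s = s powr p * (C + k)" by (simp add: C_def)
        have "?F 2 = 2 / 3 * 2 powr p / p + s\<^sup>2 * 2 powr (p - 2) / (2 - p) - s ^ 3 * 2 powr (p - 3) / (2 * (3 - p))"
          using p by (simp add: divide_simps) (simp add: algebra_simps)
        then show "?F 2 - ?F s = G s - s powr p * k"
          unfolding Fs G_def by (simp add: algebra_simps)
      qed
      fix r assume r: "r \<in> {s..2}"
      then have b: "bspline (s / r) = 2 / 3 - (s / r)\<^sup>2 + (s / r) ^ 3 / 2"
        using s by (simp add: bspline_def)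
      have w: "r powr (p - 3) = r powr (p - 1) / r\<^sup>2" "r powr (p - 4) = r powr (p - 1) / r ^ 3"
        using r s powr_diff[of r "p - 1" 2] powr_diff[of r "p - 1" 3] by simp_all
      show "2 / 3 * r powr (p - 1) - s\<^sup>2 * r powr (p - 3) + s ^ 3 / 2 * r powr (p - 4) = ?h r"
        unfolding b w power_divide by (simp add: algebra_simps)
    qed
    ultimately have "(?h has_integral (0 + (s powr p * k + (G s - s powr p * k)))) {0..2}"
      using s by (intro has_integral_combine[of 0 "s / 2" 2] has_integral_combine[of "s / 2" s 2]) auto
    then have "(?h has_integral G s) {0..2}" by simp
    then show ?thesis
      unfolding s_def[symmetric]
      by (rule has_integral_eq[rotated]) (auto simp: s_def bspline_def abs_divide)
  qed
  \<comment> \<open>\<open>L\<close> and \<open>M\<close> solve the two equations that match the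
    quadratic and cubic terms of \<open>M * bspline (t / L)\<close> against those of
    \<open>G\<close>. Since \<open>L \<ge> 2\<close>, the argument \<open>t / L\<close> stays in the
    inner branch whenever \<open>|t| \<le> 2\<close>.\<close>
  define L where "L = 2 * (3 - p) / (2 - p)"
  define M where "M = L\<^sup>2 * 2 powr (p - 2) / (2 - p)"
  have L: "2 \<le> L" using p by (simp add: L_def field_simps)
  have M: "0 \<le> M" using p by (simp add: M_def)
  define K0 where "K0 = 2 / 3 * 2 powr p / p + M * (2 / 3)"
  have key: "G \<bar>t\<bar> + M * bspline (t / L) = K0 - C * \<bar>t\<bar> powr p" if "\<bar>t\<bar> \<le> 2" for t
  proof -
    have "bspline (t / L) = 2 / 3 - t\<^sup>2 / L\<^sup>2 + \<bar>t\<bar> ^ 3 / (2 * L ^ 3)"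
      using L that by (simp add: bspline_def abs_divide power_divide)
    moreover have "M * (t\<^sup>2 / L\<^sup>2) = t\<^sup>2 * 2 powr (p - 2) / (2 - p)"
      using L by (simp add: M_def)
    moreover have "M * (\<bar>t\<bar> ^ 3 / (2 * L ^ 3)) = \<bar>t\<bar> ^ 3 * 2 powr (p - 3) / (2 * (3 - p))"
    proof -
      have "M * (\<bar>t\<bar> ^ 3 / (2 * L ^ 3)) = \<bar>t\<bar> ^ 3 * (2 powr (p - 2) / (2 - p)) / (2 * L)"
        using L by (simp add: M_def power2_eq_square power3_eq_cube)
      also have "\<dots> = \<bar>t\<bar> ^ 3 * 2 powr (p - 2) / (4 * (3 - p))"
      proof -
        have "(2 - p) * (2 * L) = 4 * (3 - p)" using p by (simp add: L_def)
        then show ?thesis by (metis times_divide_eq_right divide_divide_eq_left)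
      qed
      also have "2 powr (p - 2) = 2 * 2 powr (p - 3)" using powr_add[of 2 1 "p - 3"] by simp
      also have "\<bar>t\<bar> ^ 3 * (2 * 2 powr (p - 3)) / (4 * (3 - p)) = \<bar>t\<bar> ^ 3 * 2 powr (p - 3) / (2 * (3 - p))"
        using p by (simp add: frac_eq_eq)
      finally show ?thesis .
    qed
    ultimately have "M * bspline (t / L) = M * (2 / 3) - t\<^sup>2 * 2 powr (p - 2) / (2 - p) + \<bar>t\<bar> ^ 3 * 2 powr (p - 3) / (2 * (3 - p))"
      by (simp only: distrib_left right_diff_distrib)
    then show ?thesis by (simp add: G_def K0_def)
  qed
  have "energy_bound p {-1..1 :: real} (K0 / C)"
    unfolding energy_bound_def
  proof (intro allI impI)
    fix F :: "real set" and a :: "real \<Rightarrow> real" assume F: "finite F" "F \<subseteq> {-1..1 :: real}"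
    have le2: "\<bar>x - y\<bar> \<le> 2" if "x \<in> F" "y \<in> F" for x y :: real
    proof -
      have "x \<in> {-1..1}" "y \<in> {-1..1}" using that F by auto
      then show ?thesis by (simp add: abs_le_iff)
    qed
    have "0 \<le> (\<Sum>x\<in>F. \<Sum>y\<in>F. a x * a y * G \<bar>x - y\<bar>)"
    proof (rule has_integral_nonneg)
      show "((\<lambda>r. \<Sum>x\<in>F. \<Sum>y\<in>F. a x * a y * (bspline ((x - y) / r) * r powr (p - 1))) has_integral
          (\<Sum>x\<in>F. \<Sum>y\<in>F. a x * a y * G \<bar>x - y\<bar>)) {0..2}"
        using F le2 by (intro has_integral_sum has_integral_mult_right mix) auto
      fix r :: real
      have "(\<Sum>x\<in>F. \<Sum>y\<in>F. a x * a y * (bspline ((x - y) / r) * r powr (p - 1))) =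
          r powr (p - 1) * (\<Sum>x\<in>F. \<Sum>y\<in>F. a x * a y * bspline (x / r - y / r))"
        by (simp add: sum_distrib_left diff_divide_distrib mult_ac)
      then show "0 \<le> (\<Sum>x\<in>F. \<Sum>y\<in>F. a x * a y * (bspline ((x - y) / r) * r powr (p - 1)))"
        using bspline_psd[OF F(1), of a "\<lambda>x. x / r"] by simp
    qed
    moreover have "0 \<le> M * (\<Sum>x\<in>F. \<Sum>y\<in>F. a x * a y * bspline (x / L - y / L))"
      using bspline_psd[OF F(1), of a "\<lambda>x. x / L"] M by simp
    ultimately have "0 \<le> (\<Sum>x\<in>F. \<Sum>y\<in>F. a x * a y * G \<bar>x - y\<bar>) + M * (\<Sum>x\<in>F. \<Sum>y\<in>F. a x * a y * bspline (x / L - y / L))"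
      by simp
    also have "\<dots> = (\<Sum>x\<in>F. \<Sum>y\<in>F. a x * a y * (G \<bar>x - y\<bar> + M * bspline ((x - y) / L)))"
      by (simp add: sum_distrib_left sum.distrib[symmetric] diff_divide_distrib algebra_simps)
    also have "\<dots> = (\<Sum>x\<in>F. \<Sum>y\<in>F. a x * a y * (K0 - C * \<bar>x - y\<bar> powr p))"
      using key le2 by (intro sum.cong refl) auto
    also have "\<dots> = (\<Sum>x\<in>F. \<Sum>y\<in>F. K0 * (a x * a y) - C * (a x * a y * dist x y powr p))"
      by (simp add: dist_real_def algebra_simps)
    also have "\<dots> = K0 * (\<Sum>x\<in>F. a x)\<^sup>2 - C * (\<Sum>x\<in>F. \<Sum>y\<in>F. a x * a y * dist x y powr p)"
      unfolding power2_eq_square sum_product by (simp add: sum_subtractf sum_distrib_left)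
    finally show "(\<Sum>x\<in>F. \<Sum>y\<in>F. a x * a y * dist x y powr p) \<le> K0 / C * (\<Sum>x\<in>F. a x)\<^sup>2"
      using C by (simp add: field_simps)
  qed
  then show ?thesis by blast
qed

section \<open>The supremum \<open>max_energy\<close> as the best constant on the interval\<close>

lemma energy_bound_nonneg:
  assumes "0 < p" "energy_bound p S C" "x \<in> S"
  shows "0 \<le> C"
proof -
  have "(\<Sum>u\<in>{x}. \<Sum>v\<in>{x}. (1::real) * 1 * dist u v powr p) \<le> C * (\<Sum>u\<in>{x}. 1)\<^sup>2"
    using assms(2)[unfolded energy_bound_def, rule_format, of "{x}" "\<lambda>_. 1"] assms(3) by simp
  then show ?thesis using assms(1) by simp
qed

text \<open>The bound for finite weights yields an embedding of the interval into a sphere, and that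
  embedding controls arbitrary signed measures.\<close>

lemma energies_le:
  assumes p: "0 < p" and bd: "energy_bound p {-1..1 :: real} C" and e: "e \<in> energies p"
  shows "e \<le> C"
proof -
  obtain j :: "real \<Rightarrow> ell2" where j: "\<And>x. x \<in> {-1..1} \<Longrightarrow> norm (j x) = sqrt (C / 2)"
    "\<And>x y. x \<in> {-1..1} \<Longrightarrow> y \<in> {-1..1} \<Longrightarrow> dist (j x) (j y) = dist x y powr (p / 2)"
    using snowflake_embedding[OF p bd] by metis
  obtain \<mu> where \<mu>: "signed_measure borel_interval \<mu>" "\<mu> {-1..1} = 1"
    and e: "e = signed_integral borel_interval \<mu> (\<lambda>v. signed_integral borel_interval \<mu> (\<lambda>u. \<bar>u - v\<bar> powr p))"
    using e unfolding energies_def by blast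
  have "0 \<le> C" using energy_bound_nonneg[OF p bd, of 0] by simp
  then show ?thesis using signed_energy_le[OF p \<mu>(1) j] \<mu>(2) e by simp
qed

lemma bdd_above_energies:
  assumes "0 < p" "p < 2"
  shows "bdd_above (energies p)"
  using energy_bound_interval[OF assms] energies_le[OF assms(1)] by (metis bdd_aboveI)

lemma discrete_energy_in_energies:
  assumes F: "finite F" "F \<subseteq> {-1..1 :: real}" and one: "(\<Sum>x\<in>F. a x) = 1"
  shows "(\<Sum>x\<in>F. \<Sum>y\<in>F. a x * a y * \<bar>x - y\<bar> powr p) \<in> energies p"
proof -
  let ?\<mu> = "\<lambda>A. \<Sum>x\<in>F. a x * indicator A x"
  have sp: "F \<subseteq> space borel_interval" using F by (simp add: space_restrict_space)
  have single: "{x} \<in> sets borel_interval" if "x \<in> F" for x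
    using that F by (auto simp: sets_restrict_space image_iff intro!: exI[of _ "{x}"])
  have si: "signed_integral borel_interval ?\<mu> f = (\<Sum>x\<in>F. a x * f x)" if "f \<in> borel_measurable borel" for f
    using F(1) sp single measurable_restrict_space1[OF that] by (rule signed_integral_points)
  have "signed_integral borel_interval ?\<mu> (\<lambda>v. signed_integral borel_interval ?\<mu> (\<lambda>u. \<bar>u - v\<bar> powr p)) =
      signed_integral borel_interval ?\<mu> (\<lambda>v. \<Sum>x\<in>F. a x * \<bar>x - v\<bar> powr p)"
    by (subst si) auto
  also have "\<dots> = (\<Sum>y\<in>F. a y * (\<Sum>x\<in>F. a x * \<bar>x - y\<bar> powr p))"
    by (rule si) measurable
  also have "\<dots> = (\<Sum>x\<in>F. \<Sum>y\<in>F. a x * a y * \<bar>x - y\<bar> powr p)"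
    by (subst sum.swap) (simp add: sum_distrib_left mult_ac)
  finally have "(\<Sum>x\<in>F. \<Sum>y\<in>F. a x * a y * \<bar>x - y\<bar> powr p) =
      signed_integral borel_interval ?\<mu> (\<lambda>v. signed_integral borel_interval ?\<mu> (\<lambda>u. \<bar>u - v\<bar> powr p))" ..
  moreover have "signed_measure borel_interval ?\<mu>" by (rule signed_measure_sum_points)
  moreover have "?\<mu> {-1..1} = 1"
    using F one by (subst one[symmetric], intro sum.cong) (auto simp: indicator_def)
  ultimately show ?thesis unfolding energies_def by blast
qed

lemma energies_nonempty: "energies p \<noteq> {}"
  using discrete_energy_in_energies[of "{0}" "\<lambda>_. 1" p] by auto

lemma max_energy_le: "0 < p \<Longrightarrow> energy_bound p {-1..1 :: real} C \<Longrightarrow> max_energy p \<le> C"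
  unfolding max_energy_def by (intro cSup_least energies_nonempty energies_le)

text \<open>Weights of nonzero sum are scaled to sum 1. Weights of sum 0 cannot be; for them an
  \<open>energy_bound\<close> with any constant already makes the energy nonpositive.\<close>

lemma energy_bound_max_energy:
  assumes p: "0 < p" "p < 2"
  shows "energy_bound p {-1..1 :: real} (max_energy p)"
  unfolding energy_bound_def
proof (intro allI impI)
  fix F :: "real set" and a :: "real \<Rightarrow> real" assume F: "finite F" "F \<subseteq> {-1..1}"
  define s where "s = (\<Sum>x\<in>F. a x)"
  let ?E = "\<lambda>a. \<Sum>x\<in>F. \<Sum>y\<in>F. a x * a y * \<bar>x - y\<bar> powr p"
  have "?E a \<le> max_energy p * s\<^sup>2"
  proof (cases "s = 0")
    case True
    obtain C where "energy_bound p {-1..1 :: real} C" using energy_bound_interval[OF p] by blast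
    then have "?E a \<le> C * (\<Sum>x\<in>F. a x)\<^sup>2" using F by (simp add: energy_bound_def dist_real_def)
    then show ?thesis using True by (simp add: s_def)
  next
    case False
    have "?E (\<lambda>x. a x / s) \<le> max_energy p"
      unfolding max_energy_def
    proof (rule cSup_upper[OF discrete_energy_in_energies[OF F] bdd_above_energies[OF p]])
      show "(\<Sum>x\<in>F. a x / s) = 1" using False by (simp add: s_def flip: sum_divide_distrib)
    qed
    moreover have "?E (\<lambda>x. a x / s) = ?E a / s\<^sup>2"
      by (simp add: sum_divide_distrib power2_eq_square)
    ultimately show ?thesis using False by (simp add: divide_le_eq)
  qed
  then show "(\<Sum>x\<in>F. \<Sum>y\<in>F. a x * a y * dist x y powr p) \<le> max_energy p * (\<Sum>x\<in>F. a x)\<^sup>2"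
    by (simp add: s_def dist_real_def)
qed

section \<open>Projections of radial measures on the ball\<close>

lemma nn_integral_lborel_shift:
  fixes h :: "'a::euclidean_space \<Rightarrow> ennreal"
  assumes [measurable]: "h \<in> borel_measurable borel"
  shows "(\<integral>\<^sup>+x. h (c + x) \<partial>lborel) = (\<integral>\<^sup>+x. h x \<partial>lborel)"
proof -
  have "(\<integral>\<^sup>+x. h x \<partial>lborel) = (\<integral>\<^sup>+x. h x \<partial>distr lborel borel ((+) c))" by (simp add: lborel_distr_plus)
  also have "\<dots> = (\<integral>\<^sup>+x. h (c + x) \<partial>lborel)" by (subst nn_integral_distr) auto
  finally show ?thesis ..
qed

text \<open>Uniqueness of Haar measure: both sides are translation invariant and agree on the unit ball, so
  Fubini's theorem for \<open>1\<^sub>A (f x) 1\<^sub>B (y - f x)\<close> identifies them.\<close>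
lemma distr_lborel_orthogonal:
  fixes f :: "'a::euclidean_space \<Rightarrow> 'a"
  assumes f: "orthogonal_transformation f"
  shows "distr lborel borel f = lborel"
proof (rule measure_eqI)
  have lin: "linear f" using f by (rule orthogonal_transformation_linear)
  have [measurable]: "f \<in> borel_measurable borel"
    using lin by (intro borel_measurable_continuous_onI linear_continuous_on) (simp add: linear_conv_bounded_linear)
  fix A assume "A \<in> sets (distr lborel borel f)"
  then have A [measurable]: "A \<in> sets borel" by simp
  define B where "B = (cball 0 1 :: 'a set)"
  have B [measurable]: "B \<in> sets borel" by (simp add: B_def)
  have eB: "emeasure lborel B = ennreal (unit_ball_vol (DIM('a)))"
    by (simp add: B_def emeasure_cball)
  have pair: "pair_sigma_finite (lborel :: 'a measure) (lborel :: 'a measure)" by standard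
  have "emeasure (distr lborel borel f) A * emeasure lborel B =
      (\<integral>\<^sup>+x. indicator A (f x) * emeasure lborel B \<partial>lborel)"
  proof -
    have "(\<integral>\<^sup>+x. indicator A (f x) * emeasure lborel B \<partial>lborel) = (\<integral>\<^sup>+x. indicator A (f x) \<partial>lborel) * emeasure lborel B"
      by (rule nn_integral_multc) measurable
    also have "(\<integral>\<^sup>+x. indicator A (f x) \<partial>lborel) = (\<integral>\<^sup>+x. indicator A x \<partial>distr lborel borel f)"
      by (rule nn_integral_distr[symmetric]) measurable
    also have "\<dots> = emeasure (distr lborel borel f) A" by (rule nn_integral_indicator) (simp add: A)
    finally show ?thesis ..
  qed
  also have "\<dots> = (\<integral>\<^sup>+x. \<integral>\<^sup>+y. indicator A (f x) * indicator B (- f x + y) \<partial>lborel \<partial>lborel)"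
  proof (rule nn_integral_cong)
    fix x
    have "(\<integral>\<^sup>+y. indicator A (f x) * indicator B (- f x + y) \<partial>lborel) =
        indicator A (f x) * (\<integral>\<^sup>+y. indicator B (- f x + y) \<partial>lborel)"
      by (rule nn_integral_cmult) measurable
    also have "(\<integral>\<^sup>+y. indicator B (- f x + y) \<partial>lborel) = emeasure lborel B"
      using B nn_integral_lborel_shift[of "indicator B" "- f x"] by simp
    finally show "indicator A (f x) * emeasure lborel B =
        (\<integral>\<^sup>+y. indicator A (f x) * indicator B (- f x + y) \<partial>lborel)" ..
  qed
  also have "\<dots> = (\<integral>\<^sup>+y. \<integral>\<^sup>+x. indicator A (f x) * indicator B (- f x + y) \<partial>lborel \<partial>lborel)"
    by (rule pair_sigma_finite.Fubini'[OF pair]) measurable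
  also have "\<dots> = (\<integral>\<^sup>+y. \<integral>\<^sup>+x. indicator A (f x + y) * indicator B (- f x) \<partial>lborel \<partial>lborel)"
  proof (rule nn_integral_cong)
    fix y
    \<comment> \<open>Translating \<open>x\<close> by a preimage \<open>z\<close> of
      \<open>y\<close> moves \<open>y\<close> from the factor of \<open>B\<close> to the factor of
      \<open>A\<close>.\<close>
    obtain z where z: "y = f z" using orthogonal_transformation_surj[OF f] by (metis surjD)
    have "(\<integral>\<^sup>+x. indicator A (f x) * indicator B (- f x + y) \<partial>lborel) =
        (\<integral>\<^sup>+x. indicator A (f (z + x)) * indicator B (- f (z + x) + y) \<partial>lborel)"
      by (rule nn_integral_lborel_shift[symmetric]) measurable
    also have "\<dots> = (\<integral>\<^sup>+x. indicator A (f x + y) * indicator B (- f x) \<partial>lborel)"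
      using lin by (simp add: z linear_add add.commute)
    finally show "(\<integral>\<^sup>+x. indicator A (f x) * indicator B (- f x + y) \<partial>lborel) =
        (\<integral>\<^sup>+x. indicator A (f x + y) * indicator B (- f x) \<partial>(lborel :: 'a measure) :: ennreal)" .
  qed
  also have "\<dots> = (\<integral>\<^sup>+x. \<integral>\<^sup>+y. indicator A (f x + y) * indicator B (- f x) \<partial>lborel \<partial>lborel)"
    by (rule pair_sigma_finite.Fubini'[OF pair]) measurable
  also have "\<dots> = (\<integral>\<^sup>+x. emeasure lborel A * indicator B x \<partial>lborel)"
  proof (rule nn_integral_cong)
    fix x
    have "(\<integral>\<^sup>+y. indicator A (f x + y) * indicator B (- f x) \<partial>lborel) =
        (\<integral>\<^sup>+y. indicator A (f x + y) \<partial>lborel) * (indicator B (- f x) :: ennreal)"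
      by (rule nn_integral_multc) measurable
    moreover have "(\<integral>\<^sup>+y. indicator A (f x + y) \<partial>lborel) = emeasure lborel A"
      using A nn_integral_lborel_shift[of "indicator A" "f x"] by simp
    \<comment> \<open>The ball is symmetric and \<open>f\<close> preserves norms, so this factor is
      freed from \<open>f\<close>.\<close>
    moreover have "indicator B (- f x) = (indicator B x :: ennreal)"
      using f by (simp add: B_def indicator_def orthogonal_transformation_norm)
    ultimately show "(\<integral>\<^sup>+y. indicator A (f x + y) * indicator B (- f x) \<partial>lborel) = emeasure lborel A * indicator B x"
      by simp
  qed
  also have "\<dots> = emeasure lborel A * emeasure lborel B"
    by (subst nn_integral_cmult) auto
  finally show "emeasure (distr lborel borel f) A = emeasure lborel A"
    using ennreal_mult_cancel_left[of "emeasure lborel B" "emeasure (distr lborel borel f) A" "emeasure lborel A"]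
      unit_ball_vol_pos[of "real DIM('a)"]
    by (simp add: mult.commute eB del: unit_ball_vol_pos)
qed simp

lemma nn_integral_rotate:
  fixes h g :: "real \<Rightarrow> ennreal" and \<theta> e :: "real ^ 'n"
  assumes [measurable]: "h \<in> borel_measurable borel" "g \<in> borel_measurable borel" and "norm \<theta> = norm e"
  shows "(\<integral>\<^sup>+y. h (norm y) * g (y \<bullet> \<theta>) \<partial>lborel) = (\<integral>\<^sup>+y. h (norm y) * g (y \<bullet> e) \<partial>lborel)"
proof -
  obtain f where f: "orthogonal_transformation f" "f e = \<theta>"
    using orthogonal_transformation_exists[of e \<theta>] assms(3) by auto
  have lin: "linear f" using f(1) by (rule orthogonal_transformation_linear)
  have [measurable]: "f \<in> borel_measurable borel"
    using lin by (intro borel_measurable_continuous_onI linear_continuous_on) (simp add: linear_conv_bounded_linear)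
  have "(\<integral>\<^sup>+y. h (norm y) * g (y \<bullet> \<theta>) \<partial>lborel) = (\<integral>\<^sup>+y. h (norm y) * g (y \<bullet> \<theta>) \<partial>distr lborel borel f)"
    by (simp add: distr_lborel_orthogonal[OF f(1)])
  also have "\<dots> = (\<integral>\<^sup>+y. h (norm (f y)) * g (f y \<bullet> \<theta>) \<partial>lborel)"
    by (subst nn_integral_distr) auto
  also have "\<dots> = (\<integral>\<^sup>+y. h (norm y) * g (y \<bullet> e) \<partial>lborel)"
    using f by (intro nn_integral_cong) (auto simp: orthogonal_transformation_norm orthogonal_transformation_def)
  finally show ?thesis .
qed

section \<open>Marginals of the densities \<open>(1 - |y|^2)^m\<close> on the ball\<close>

definition cut_power :: "nat \<Rightarrow> real \<Rightarrow> real" where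
  "cut_power m r = (if 0 \<le> r then r ^ m else 0)"

lemma borel_measurable_cut_power [measurable]: "cut_power m \<in> borel_measurable borel"
  unfolding cut_power_def by measurable

lemma cut_power_nonneg [simp]: "0 \<le> cut_power m r"
  by (simp add: cut_power_def)

lemma nn_integral_cut_power:
  "(\<integral>\<^sup>+\<sigma>. ennreal (cut_power m (\<sigma> - s)) * indicator {..\<rho>} \<sigma> \<partial>lborel) = ennreal (cut_power (Suc m) (\<rho> - s) / (m + 1))"
proof (cases "s \<le> \<rho>")
  case True
  have "(\<integral>\<^sup>+\<sigma>. ennreal (cut_power m (\<sigma> - s)) * indicator {..\<rho>} \<sigma> \<partial>lborel) =
      (\<integral>\<^sup>+\<sigma>. ennreal ((\<sigma> - s) ^ m) * indicator {s..\<rho>} \<sigma> \<partial>lborel)"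
    by (intro nn_integral_cong) (auto simp: cut_power_def indicator_def)
  also have "\<dots> = ennreal ((\<rho> - s) ^ Suc m / (m + 1) - (s - s) ^ Suc m / (m + 1))"
    using True by (intro nn_integral_FTC_Icc[where F = "\<lambda>\<sigma>. (\<sigma> - s) ^ Suc m / (m + 1)"])
      (auto intro!: derivative_eq_intros simp del: power_Suc)
  finally show ?thesis using True by (simp add: cut_power_def)
next
  case False
  then have z: "ennreal (cut_power m (\<sigma> - s)) * indicator {..\<rho>} \<sigma> = 0" for \<sigma>
    by (cases "\<sigma> \<le> \<rho>") (simp_all add: cut_power_def)
  show ?thesis unfolding z using False by (simp add: cut_power_def)
qed

lemma cut_power_integral_neg:
  assumes "\<sigma> < 0"
  shows "(\<integral>\<^sup>+x. ennreal (cut_power m (\<sigma> - (\<Sum>i\<in>A. (x i)\<^sup>2))) \<partial>M) = 0"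
proof -
  have "cut_power m (\<sigma> - (\<Sum>i\<in>A. (x i)\<^sup>2)) = 0" for x :: "'a \<Rightarrow> real"
  proof -
    have "0 \<le> (\<Sum>i\<in>A. (x i)\<^sup>2)" by (rule sum_nonneg) simp
    then show ?thesis using assms by (simp add: cut_power_def)
  qed
  then show ?thesis by simp
qed

text \<open>Induction on \<open>m\<close>: the truncated power of exponent \<open>m + 1\<close> is
  \<open>m + 1\<close> times the integral over the level \<open>\<sigma>\<close> of the one of
  exponent \<open>m\<close>, and Fubini applies the previous case at each level. The power of
  \<open>\<rho>\<close> is dictated by scaling. The set \<open>A\<close> may be empty, which is the
  case of the one-dimensional ball.\<close>

lemma ball_cut_power_integral:
  assumes A: "finite A"
  shows "\<exists>\<beta>>0. \<forall>\<rho>>0. (\<integral>\<^sup>+x. ennreal (cut_power m (\<rho> - (\<Sum>i\<in>A. (x i)\<^sup>2))) \<partial>Pi\<^sub>M A (\<lambda>_. lborel)) =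
    ennreal (\<beta> * \<rho> powr (real m + real (card A) / 2))"
proof (induction m)
  \<comment> \<open>\<open>cut_power 0\<close> is the indicator of the nonnegative reals, so the
    base case is the volume of the closed ball of radius \<open>sqrt \<rho>\<close>.\<close>
  case 0
  show ?case
  proof (intro exI[of _ "unit_ball_vol (real (card A))"] conjI allI impI)
    show "0 < unit_ball_vol (real (card A))" by simp
    fix \<rho> :: real assume \<rho>: "0 < \<rho>"
    have "(\<integral>\<^sup>+x. ennreal (cut_power 0 (\<rho> - (\<Sum>i\<in>A. (x i)\<^sup>2))) \<partial>Pi\<^sub>M A (\<lambda>_. lborel)) =
        (\<integral>\<^sup>+x. indicator ({f. sqrt (\<Sum>i\<in>A. (f i)\<^sup>2) \<le> sqrt \<rho>} \<inter> space (Pi\<^sub>M A (\<lambda>_. lborel))) x \<partial>Pi\<^sub>M A (\<lambda>_. lborel))"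
      by (intro nn_integral_cong) (auto simp: cut_power_def indicator_def)
    also have "\<dots> = emeasure (Pi\<^sub>M A (\<lambda>_. lborel)) ({f. sqrt (\<Sum>i\<in>A. (f i)\<^sup>2) \<le> sqrt \<rho>} \<inter> space (Pi\<^sub>M A (\<lambda>_. lborel)))"
      using A by (intro nn_integral_indicator) measurable
    also have "\<dots> = ennreal (unit_ball_vol (real (card A)) * sqrt \<rho> ^ card A)"
      using A \<rho> by (intro emeasure_cball_aux) auto
    also have "sqrt \<rho> ^ card A = \<rho> powr (real 0 + real (card A) / 2)"
      using \<rho> by (simp add: powr_powr flip: powr_half_sqrt powr_realpow)
    finally show "(\<integral>\<^sup>+x. ennreal (cut_power 0 (\<rho> - (\<Sum>i\<in>A. (x i)\<^sup>2))) \<partial>Pi\<^sub>M A (\<lambda>_. lborel)) =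
        ennreal (unit_ball_vol (real (card A)) * \<rho> powr (real 0 + real (card A) / 2))" .
  qed
next
  case (Suc m)
  then obtain \<beta> where \<beta>: "\<beta> > 0" "\<And>\<rho>. 0 < \<rho> \<Longrightarrow>
      (\<integral>\<^sup>+x. ennreal (cut_power m (\<rho> - (\<Sum>i\<in>A. (x i)\<^sup>2))) \<partial>Pi\<^sub>M A (\<lambda>_. lborel)) =
      ennreal (\<beta> * \<rho> powr (real m + real (card A) / 2))" by blast
  define k where "k = real m + real (card A) / 2"
  have k: "0 \<le> k" by (simp add: k_def)
  interpret PF: product_sigma_finite "\<lambda>_. lborel :: real measure" by standard
  interpret PA: sigma_finite_measure "Pi\<^sub>M A (\<lambda>_. lborel :: real measure)" using A by (rule PF.sigma_finite)
  interpret pair_sigma_finite "lborel :: real measure" "Pi\<^sub>M A (\<lambda>_. lborel :: real measure)" by standard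
  have [measurable]: "(\<lambda>x. \<Sum>i\<in>A. (x i)\<^sup>2) \<in> borel_measurable (Pi\<^sub>M A (\<lambda>_. lborel :: real measure))"
    by measurable
  show ?case
  proof (intro exI[of _ "real (m + 1) * (\<beta> / (k + 1))"] conjI allI impI)
    show "0 < real (m + 1) * (\<beta> / (k + 1))" using \<beta>(1) k by simp
    fix \<rho> :: real assume \<rho>: "0 < \<rho>"
    have "(\<integral>\<^sup>+x. ennreal (cut_power (Suc m) (\<rho> - (\<Sum>i\<in>A. (x i)\<^sup>2))) \<partial>Pi\<^sub>M A (\<lambda>_. lborel)) =
        (\<integral>\<^sup>+x. ennreal (m + 1) * (\<integral>\<^sup>+\<sigma>. ennreal (cut_power m (\<sigma> - (\<Sum>i\<in>A. (x i)\<^sup>2))) * indicator {..\<rho>} \<sigma> \<partial>lborel) \<partial>Pi\<^sub>M A (\<lambda>_. lborel))"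
      unfolding nn_integral_cut_power by (intro nn_integral_cong) (subst ennreal_mult[symmetric], auto)
    also have "\<dots> = ennreal (m + 1) * (\<integral>\<^sup>+x. (\<integral>\<^sup>+\<sigma>. ennreal (cut_power m (\<sigma> - (\<Sum>i\<in>A. (x i)\<^sup>2))) * indicator {..\<rho>} \<sigma> \<partial>lborel) \<partial>Pi\<^sub>M A (\<lambda>_. lborel))"
      by (intro nn_integral_cmult) measurable
    also have "(\<integral>\<^sup>+x. (\<integral>\<^sup>+\<sigma>. ennreal (cut_power m (\<sigma> - (\<Sum>i\<in>A. (x i)\<^sup>2))) * indicator {..\<rho>} \<sigma> \<partial>lborel) \<partial>Pi\<^sub>M A (\<lambda>_. lborel)) =
        (\<integral>\<^sup>+\<sigma>. (\<integral>\<^sup>+x. ennreal (cut_power m (\<sigma> - (\<Sum>i\<in>A. (x i)\<^sup>2))) * indicator {..\<rho>} \<sigma> \<partial>Pi\<^sub>M A (\<lambda>_. lborel)) \<partial>lborel)"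
      by (rule Fubini') measurable
    also have "\<dots> = (\<integral>\<^sup>+\<sigma>. (\<integral>\<^sup>+x. ennreal (cut_power m (\<sigma> - (\<Sum>i\<in>A. (x i)\<^sup>2))) \<partial>Pi\<^sub>M A (\<lambda>_. lborel)) * indicator {..\<rho>} \<sigma> \<partial>lborel)"
      by (intro nn_integral_cong nn_integral_multc) measurable
    also have "\<dots> = (\<integral>\<^sup>+\<sigma>. ennreal (\<beta> * \<sigma> powr k) * indicator {0..\<rho>} \<sigma> \<partial>lborel)"
    proof (rule nn_integral_cong_AE)
      \<comment> \<open>The induction hypothesis speaks of positive levels only; the level 0 is a
        null set.\<close>
      have "AE \<sigma> in lborel. \<sigma> \<noteq> (0 :: real)" by (rule AE_lborel_singleton)
      then show "AE \<sigma> in lborel. (\<integral>\<^sup>+x. ennreal (cut_power m (\<sigma> - (\<Sum>i\<in>A. (x i)\<^sup>2))) \<partial>Pi\<^sub>M A (\<lambda>_. lborel)) * indicator {..\<rho>} \<sigma>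
          = ennreal (\<beta> * \<sigma> powr k) * indicator {0..\<rho>} \<sigma>"
      proof eventually_elim
        case (elim \<sigma>)
        then consider "\<sigma> < 0" | "0 < \<sigma>" by linarith
        then show ?case
        proof cases
          case 1
          then show ?thesis using 1 by (simp add: cut_power_integral_neg)
        next
          case 2
          then show ?thesis using \<beta>(2)[OF 2] by (simp add: indicator_def k_def)
        qed
      qed
    qed
    also have "\<dots> = ennreal (\<beta> / (k + 1) * \<rho> powr (k + 1))"
    proof -
      have "((\<lambda>x. \<beta> * x powr k) has_integral (\<beta> * (\<rho> powr (k + 1) / (k + 1)))) {0..\<rho>}"
        using k \<rho> by (intro has_integral_mult_right has_integral_powr_from_0) auto
      from nn_integral_has_integral_lebesgue[OF _ this] \<beta>(1)
      show ?thesis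
        by (simp add: ennreal_indicator ennreal_mult' mult_ac flip: ennreal_indicator)
    qed
    also have "ennreal (m + 1) * ennreal (\<beta> / (k + 1) * \<rho> powr (k + 1)) = ennreal ((m + 1) * (\<beta> / (k + 1) * \<rho> powr (k + 1)))"
      using \<beta>(1) k by (intro ennreal_mult[symmetric]) auto
    finally show "(\<integral>\<^sup>+x. ennreal (cut_power (Suc m) (\<rho> - (\<Sum>i\<in>A. (x i)\<^sup>2))) \<partial>Pi\<^sub>M A (\<lambda>_. lborel)) =
        ennreal (real (m + 1) * (\<beta> / (k + 1)) * \<rho> powr (real (Suc m) + real (card A) / 2))"
      by (simp add: k_def add_ac mult_ac)
  qed
qed

text \<open>Up to a constant factor, the projection of Lebesgue measure on the unit ball of
  \<open>R^n\<close> to a line.\<close>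

definition slice_measure :: "nat \<Rightarrow> real measure" where
  "slice_measure n = density lborel (\<lambda>t. ennreal (indicator {-1..1} t * (1 - t\<^sup>2) powr ((real n - 1) / 2)))"

lemma sets_slice_measure [simp, measurable_cong]: "sets (slice_measure n) = sets borel"
  and space_slice_measure [simp]: "space (slice_measure n) = UNIV"
  by (simp_all add: slice_measure_def)

lemma nn_integral_slice_measure:
  assumes [measurable]: "f \<in> borel_measurable borel"
  shows "(\<integral>\<^sup>+t. f t \<partial>slice_measure n) =
    (\<integral>\<^sup>+t. ennreal (indicator {-1..1} t * (1 - t\<^sup>2) powr ((real n - 1) / 2)) * f t \<partial>lborel)"
  unfolding slice_measure_def by (rule nn_integral_density) measurable

text \<open>Fubini in the coordinate along \<open>e\<close>. The remaining coordinates integrate to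
  a multiple of \<open>(1 - t^2) powr (m + (n - 1) / 2)\<close>, where \<open>n\<close> is the
  dimension, and this splits into the density of \<open>slice_measure\<close> and the factor
  \<open>(1 - t^2)^m\<close>.\<close>

lemma marginal_Basis:
  fixes e :: "'a::euclidean_space"
  assumes e: "e \<in> Basis"
  shows "\<exists>\<beta>>0. \<forall>g\<in>borel_measurable borel.
    (\<integral>\<^sup>+y. ennreal (cut_power m (1 - (norm y)\<^sup>2)) * g (y \<bullet> e) \<partial>lborel) =
    ennreal \<beta> * (\<integral>\<^sup>+t. ennreal ((1 - t\<^sup>2) ^ m) * g t \<partial>slice_measure (DIM('a)))"
proof -
  define A where "A = Basis - {e}"
  have A: "finite A" "e \<notin> A" "insert e A = Basis" "real (card A) = real DIM('a) - 1"
    using e by (auto simp: A_def insert_absorb card_Diff_singleton of_nat_diff)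
  define k where "k = (real DIM('a) - 1) / 2"
  obtain \<beta> where \<beta>: "\<beta> > 0" "\<And>\<rho>. 0 < \<rho> \<Longrightarrow>
      (\<integral>\<^sup>+x. ennreal (cut_power m (\<rho> - (\<Sum>i\<in>A. (x i)\<^sup>2))) \<partial>Pi\<^sub>M A (\<lambda>_. lborel)) = ennreal (\<beta> * \<rho> powr (real m + k))"
    using ball_cut_power_integral[OF A(1), of m] A(4) by (auto simp: k_def)
  interpret PF: product_sigma_finite "\<lambda>_. lborel :: real measure" by standard
  show ?thesis
  proof (intro exI[of _ \<beta>] conjI ballI \<beta>(1))
    fix g :: "real \<Rightarrow> ennreal" assume [measurable]: "g \<in> borel_measurable borel"
    have [measurable]: "(\<lambda>x. \<Sum>b\<in>Basis. x b *\<^sub>R b :: 'a) \<in> borel_measurable (Pi\<^sub>M Basis (\<lambda>_. lborel))"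
      by measurable
    let ?F = "\<lambda>x. ennreal (cut_power m (1 - (\<Sum>b\<in>insert e A. (x b)\<^sup>2))) * g (x e)"
    have sm [measurable]: "(\<lambda>x. \<Sum>b\<in>I. (x b)\<^sup>2) \<in> borel_measurable (Pi\<^sub>M I (\<lambda>_. lborel :: real measure))" for I :: "'a set"
      by measurable
    have ev [measurable]: "(\<lambda>x. x e) \<in> borel_measurable (Pi\<^sub>M (insert e A) (\<lambda>_. lborel :: real measure))"
      using measurable_component_singleton[of e "insert e A" "\<lambda>_. lborel :: real measure"] by simp
    have "(\<integral>\<^sup>+y. ennreal (cut_power m (1 - (norm y)\<^sup>2)) * g (y \<bullet> e) \<partial>(lborel :: 'a measure)) =
        (\<integral>\<^sup>+x. ennreal (cut_power m (1 - (norm (\<Sum>b\<in>Basis. x b *\<^sub>R b :: 'a))\<^sup>2)) * g ((\<Sum>b\<in>Basis. x b *\<^sub>R b) \<bullet> e)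
          \<partial>Pi\<^sub>M Basis (\<lambda>_. lborel))"
      by (subst lborel_eq, subst nn_integral_distr) auto
    also have "\<dots> = (\<integral>\<^sup>+x. ?F x \<partial>Pi\<^sub>M (insert e A) (\<lambda>_. lborel))"
    proof -
      have "(norm (\<Sum>b\<in>Basis. x b *\<^sub>R b :: 'a))\<^sup>2 = (\<Sum>b\<in>Basis. (x b)\<^sup>2)" for x :: "'a \<Rightarrow> real"
        unfolding power2_norm_eq_inner by (subst euclidean_inner) (simp add: power2_eq_square)
      moreover have "(\<Sum>b\<in>Basis. x b *\<^sub>R b :: 'a) \<bullet> e = x e" for x :: "'a \<Rightarrow> real"
        using e by simp
      ultimately show ?thesis by (simp add: A(3))
    qed
    also have "\<dots> = (\<integral>\<^sup>+t. (\<integral>\<^sup>+x. ?F (x(e := t)) \<partial>Pi\<^sub>M A (\<lambda>_. lborel)) \<partial>lborel)"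
      by (rule PF.product_nn_integral_insert_rev[OF A(1,2)]) measurable
    also have "\<dots> = (\<integral>\<^sup>+t. (\<integral>\<^sup>+x. ennreal (cut_power m ((1 - t\<^sup>2) - (\<Sum>b\<in>A. (x b)\<^sup>2))) * g t \<partial>Pi\<^sub>M A (\<lambda>_. lborel)) \<partial>lborel)"
    proof -
      have "(\<Sum>b\<in>insert e A. ((x(e := t)) b)\<^sup>2) = t\<^sup>2 + (\<Sum>b\<in>A. (x b)\<^sup>2)" for x :: "'a \<Rightarrow> real" and t
      proof -
        have "(\<Sum>b\<in>A. ((x(e := t)) b)\<^sup>2) = (\<Sum>b\<in>A. (x b)\<^sup>2)"
          using A(2) by (intro sum.cong) auto
        then show ?thesis using A(1,2) by simp
      qed
      then show ?thesis by (simp only: fun_upd_same diff_diff_eq)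
    qed
    also have "\<dots> = (\<integral>\<^sup>+t. (\<integral>\<^sup>+x. ennreal (cut_power m ((1 - t\<^sup>2) - (\<Sum>b\<in>A. (x b)\<^sup>2))) \<partial>Pi\<^sub>M A (\<lambda>_. lborel)) * g t \<partial>lborel)"
      by (intro nn_integral_cong nn_integral_multc) measurable
    also have "\<dots> = (\<integral>\<^sup>+t. ennreal \<beta> * (ennreal (indicator {-1..1} t * (1 - t\<^sup>2) powr k) * (ennreal ((1 - t\<^sup>2) ^ m) * g t)) \<partial>lborel)"
    proof (rule nn_integral_cong_AE)
      \<comment> \<open>At \<open>t = 1\<close> and \<open>t = -1\<close> the section has radius 0,
        which the formula for \<open>\<rho> > 0\<close> does not reach.\<close>
      have "AE t in lborel. t \<noteq> (1 :: real)" "AE t in lborel. t \<noteq> (- 1 :: real)" by (rule AE_lborel_singleton)+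
      then show "AE t in lborel. (\<integral>\<^sup>+x. ennreal (cut_power m ((1 - t\<^sup>2) - (\<Sum>b\<in>A. (x b)\<^sup>2))) \<partial>Pi\<^sub>M A (\<lambda>_. lborel)) * g t =
          ennreal \<beta> * (ennreal (indicator {-1..1} t * (1 - t\<^sup>2) powr k) * (ennreal ((1 - t\<^sup>2) ^ m) * g t))"
      proof eventually_elim
        case (elim t)
        then consider "\<bar>t\<bar> < 1" | "1 < \<bar>t\<bar>" by linarith
        then show ?case
        proof cases
          case 1
          then have pos: "0 < 1 - t\<^sup>2" by (simp add: abs_square_less_1)
          have "t \<in> {-1..1}" using 1 by auto
          moreover have "ennreal (\<beta> * (1 - t\<^sup>2) powr (real m + k)) =
              ennreal \<beta> * (ennreal ((1 - t\<^sup>2) powr k) * ennreal ((1 - t\<^sup>2) ^ m))"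
            using \<beta>(1) pos by (simp add: powr_add powr_realpow mult_ac flip: ennreal_mult)
          ultimately show ?thesis unfolding \<beta>(2)[OF pos] by (simp add: mult.assoc)
        next
          case 2
          then have "1 - t\<^sup>2 < 0" using abs_square_le_1[of t] by linarith
          moreover have "t \<notin> {-1..1}" using 2 by auto
          ultimately show ?thesis by (simp add: cut_power_integral_neg)
        qed
      qed
    qed
    also have "\<dots> = ennreal \<beta> * (\<integral>\<^sup>+t. ennreal ((1 - t\<^sup>2) ^ m) * g t \<partial>slice_measure (DIM('a)))"
      by (subst nn_integral_cmult) (auto simp: nn_integral_slice_measure k_def)
    finally show "(\<integral>\<^sup>+y. ennreal (cut_power m (1 - (norm y)\<^sup>2)) * g (y \<bullet> e) \<partial>lborel) =
        ennreal \<beta> * (\<integral>\<^sup>+t. ennreal ((1 - t\<^sup>2) ^ m) * g t \<partial>slice_measure (DIM('a)))" .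
  qed
qed

text \<open>Rotation invariance lets one constant serve all directions.\<close>

lemma marginal_unit:
  shows "\<exists>\<beta>>0. \<forall>g\<in>borel_measurable borel. \<forall>\<theta> :: real ^ 'n. norm \<theta> = 1 \<longrightarrow>
    (\<integral>\<^sup>+y. ennreal (cut_power m (1 - (norm y)\<^sup>2)) * g (y \<bullet> \<theta>) \<partial>lborel) =
    ennreal \<beta> * (\<integral>\<^sup>+t. ennreal ((1 - t\<^sup>2) ^ m) * g t \<partial>slice_measure CARD('n))"
proof -
  obtain e :: "real ^ 'n" where e: "e \<in> Basis" using nonempty_Basis by blast
  obtain \<beta> where \<beta>: "\<beta> > 0" "\<And>g. g \<in> borel_measurable borel \<Longrightarrow>
      (\<integral>\<^sup>+y. ennreal (cut_power m (1 - (norm y)\<^sup>2)) * g (y \<bullet> e) \<partial>lborel) =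
      ennreal \<beta> * (\<integral>\<^sup>+t. ennreal ((1 - t\<^sup>2) ^ m) * g t \<partial>slice_measure CARD('n))"
    using marginal_Basis[OF e, of m] by auto
  show ?thesis
  proof (intro exI[of _ \<beta>] conjI ballI allI impI \<beta>(1))
    fix g :: "real \<Rightarrow> ennreal" and \<theta> :: "real ^ 'n"
    assume [measurable]: "g \<in> borel_measurable borel" and "norm \<theta> = 1"
    then show "(\<integral>\<^sup>+y. ennreal (cut_power m (1 - (norm y)\<^sup>2)) * g (y \<bullet> \<theta>) \<partial>lborel) =
        ennreal \<beta> * (\<integral>\<^sup>+t. ennreal ((1 - t\<^sup>2) ^ m) * g t \<partial>slice_measure CARD('n))"
      using nn_integral_rotate[of "\<lambda>r. ennreal (cut_power m (1 - r\<^sup>2))" g \<theta> e] \<beta>(2)[of g] e by simp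
  qed
qed

section \<open>Moments of the slice measure and the projection constant\<close>

lemma nn_integral_slice_moment:
  assumes p: "0 \<le> p" and n: "1 \<le> n"
  shows "(\<integral>\<^sup>+t. ennreal (\<bar>t\<bar> powr p) \<partial>slice_measure n) = ennreal (Beta ((p + 1) / 2) ((real n + 1) / 2))"
proof -
  define k where "k = (real n - 1) / 2"
  let ?f = "\<lambda>x. x powr p * (1 - x\<^sup>2) powr k"
  have "((\<lambda>t. t powr ((p + 1) / 2 - 1) * (1 - t) powr ((real n + 1) / 2 - 1)) has_integral
      Beta ((p + 1) / 2) ((real n + 1) / 2)) {0..1}"
    using p n by (intro has_integral_Beta_real) auto
  moreover have "(p + 1) / 2 - 1 = (p - 1) / 2" "(real n + 1) / 2 - 1 = k"
    by (simp_all add: k_def field_simps)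
  ultimately have "((\<lambda>t. t powr ((p - 1) / 2) * (1 - t) powr k) has_integral
      Beta ((p + 1) / 2) ((real n + 1) / 2)) {0..1}" by simp
  from nn_integral_has_integral_lebesgue[OF _ this]
  have "ennreal (Beta ((p + 1) / 2) ((real n + 1) / 2)) =
      nn_integral lborel (\<lambda>t. ennreal (t powr ((p - 1) / 2) * (1 - t) powr k * indicator {0^2..1^2} t))"
    by (simp add: mult_ac ennreal_mult' ennreal_indicator)
  \<comment> \<open>The substitution \<open>t = x^2\<close> turns the Beta integral into twice the
    moment over \<open>[0, 1]\<close>.\<close>
  also have "\<dots> = (\<integral>\<^sup>+ x. ennreal (x\<^sup>2 powr ((p - 1) / 2) * (1 - x\<^sup>2) powr k * (2 * x) * indicator {0..1} x) \<partial>lborel)"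
    by (subst nn_integral_substitution[where g = "\<lambda>x. x ^ 2" and g' = "\<lambda>x. 2 * x"])
       (auto intro!: derivative_eq_intros continuous_intros simp: set_borel_measurable_def)
  also have "\<dots> = (\<integral>\<^sup>+ x. 2 * ennreal (?f x * indicator {0..1} x) \<partial>lborel)"
  proof (rule nn_integral_cong_AE)
    have "AE x in lborel. x \<noteq> (0 :: real)" by (rule AE_lborel_singleton)
    then show "AE x in lborel. ennreal (x\<^sup>2 powr ((p - 1) / 2) * (1 - x\<^sup>2) powr k * (2 * x) * indicator {0..1} x) =
        2 * ennreal (?f x * indicator {0..1} x)"
    proof eventually_elim
      case (elim x)
      show ?case
      proof (cases "x \<in> {0..1}")
        case True
        then have x: "0 < x" using elim by simp
        then have "x\<^sup>2 powr ((p - 1) / 2) * x = x powr p"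
        proof -
          have "x\<^sup>2 powr ((p - 1) / 2) = x powr (p - 1)"
          proof -
            have "x\<^sup>2 powr ((p - 1) / 2) = (x powr 2) powr ((p - 1) / 2)" using x by simp
            also have "\<dots> = x powr (2 * ((p - 1) / 2))" by (rule powr_powr)
            also have "2 * ((p - 1) / 2) = p - 1" by simp
            finally show ?thesis .
          qed
          then show ?thesis using x by (simp add: powr_diff)
        qed
        then have e: "x\<^sup>2 powr ((p - 1) / 2) * (1 - x\<^sup>2) powr k * (2 * x) = 2 * ?f x"
          by (metis mult.assoc mult.commute)
        show ?thesis unfolding e using True by (simp add: ennreal_mult')
      qed simp
    qed
  qed
  also have "\<dots> = (\<integral>\<^sup>+ x. ennreal (?f x * indicator {0..1} x) \<partial>lborel) + (\<integral>\<^sup>+ x. ennreal (?f x * indicator {0..1} x) \<partial>lborel)"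
    (is "_ = ?I + _") by (simp add: mult_2 nn_integral_add)
  \<comment> \<open>One of the two copies is reflected to \<open>[-1, 0]\<close>, so that together
    they fill \<open>[-1, 1]\<close>.\<close>
  also have "?I = (\<integral>\<^sup>+ x. ennreal (?f (- x) * indicator {-1..0} x) \<partial>lborel)"
    by (subst nn_integral_real_affine[of _ "-1" 0]) (auto simp: indicator_def intro!: nn_integral_cong)
  hence "?I + ?I = \<dots> + ?I" by simp
  also have "\<dots> = (\<integral>\<^sup>+ x. (ennreal (?f (- x) * indicator {-1..0} x) + ennreal (?f x * indicator {0..1} x)) \<partial>lborel)"
    by (intro nn_integral_add[symmetric]) auto
  also have "\<dots> = (\<integral>\<^sup>+ x. ennreal (indicator {-1..1} x * (1 - x\<^sup>2) powr k) * ennreal (\<bar>x\<bar> powr p) \<partial>lborel)"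
  proof (rule nn_integral_cong_AE)
    have "AE x in lborel. x \<noteq> (0 :: real)" by (rule AE_lborel_singleton)
    then show "AE x in lborel. ennreal (?f (- x) * indicator {-1..0} x) + ennreal (?f x * indicator {0..1} x) =
        ennreal (indicator {-1..1} x * (1 - x\<^sup>2) powr k) * ennreal (\<bar>x\<bar> powr p)"
    proof eventually_elim
      case (elim x)
      have r: "ennreal ((1 - x\<^sup>2) powr k) * ennreal (\<bar>x\<bar> powr p) = ennreal (\<bar>x\<bar> powr p * (1 - x\<^sup>2) powr k)"
        by (subst mult.commute, rule ennreal_mult[symmetric]) auto
      have "ennreal (?f (- x) * indicator {-1..0} x) + ennreal (?f x * indicator {0..1} x) =
          (if x \<in> {-1..1} then ennreal (\<bar>x\<bar> powr p * (1 - x\<^sup>2) powr k) else 0)"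
        using elim by (cases "x < 0"; cases "x \<in> {-1..1}"; simp)
      also have "\<dots> = ennreal (indicator {-1..1} x * (1 - x\<^sup>2) powr k) * ennreal (\<bar>x\<bar> powr p)"
      proof (cases "x \<in> {-1..1}")
        case True
        then show ?thesis by (simp only: r[symmetric] indicator_simps mult_1 if_True)
      qed auto
      finally show ?case .
    qed
  qed
  also have "\<dots> = (\<integral>\<^sup>+t. ennreal (\<bar>t\<bar> powr p) \<partial>slice_measure n)"
    by (simp add: nn_integral_slice_measure k_def)
  finally show ?thesis ..
qed

lemma nn_integral_slice_mass:
  assumes n: "1 \<le> n"
  shows "(\<integral>\<^sup>+t. 1 \<partial>slice_measure n) = ennreal (Beta (1 / 2) ((real n + 1) / 2))"
proof -
  \<comment> \<open>\<open>0 powr 0\<close> is 0, so the integrands \<open>1\<close> and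
    \<open>|t| powr 0\<close> differ at the origin, a null set.\<close>
  have "(\<integral>\<^sup>+t. 1 \<partial>slice_measure n) = (\<integral>\<^sup>+t. ennreal (\<bar>t\<bar> powr 0) \<partial>slice_measure n)"
    unfolding nn_integral_slice_measure[OF borel_measurable_const]
    by (subst nn_integral_slice_measure, measurable, intro nn_integral_cong_AE)
      (use AE_lborel_singleton[of "0 :: real"] in \<open>eventually_elim, simp\<close>)
  then show ?thesis using nn_integral_slice_moment[of 0 n] n by simp
qed

text \<open>Layer cake: \<open>norm y powr p\<close> is the integral of
  \<open>p * s powr (p - 1)\<close> over \<open>0 \<le> s \<le> norm y\<close>, and the shell
  \<open>s \<le> norm y \<le> 1\<close> has the volume of the ball times
  \<open>1 - s ^ n\<close>.\<close>

lemma nn_integral_norm_powr_cball: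
  assumes p: "0 < p"
  shows "(\<integral>\<^sup>+y. indicator (cball 0 1) y * ennreal (norm y powr p) \<partial>(lborel :: 'a::euclidean_space measure)) =
    ennreal (real DIM('a) / (real DIM('a) + p) * unit_ball_vol (real DIM('a)))"
proof -
  define n where "n = DIM('a)"
  define v where "v = unit_ball_vol (real n)"
  have v: "0 < v" by (simp add: v_def)
  have n: "0 < n" by (simp add: n_def)
  have pair: "pair_sigma_finite (lborel :: 'a measure) (lborel :: real measure)" by standard
  let ?B = "cball 0 1 :: 'a set"
  let ?w = "\<lambda>s. ennreal (p * s powr (p - 1))"
  have [measurable]: "?B \<in> sets borel" by simp
  have [measurable]: "(\<lambda>x :: 'a \<times> real. norm (fst x) - snd x) \<in> borel_measurable (lborel \<Otimes>\<^sub>M lborel)"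
    by measurable
  have [measurable]: "(\<lambda>x :: 'a \<times> real. indicator {0..} (norm (fst x) - snd x) :: ennreal) \<in> borel_measurable (lborel \<Otimes>\<^sub>M lborel)"
    by (rule measurable_compose[OF _ borel_measurable_indicator[of "{0..}"]]) measurable
  have layer: "indicator ?B y * ennreal (norm y powr p) =
      (\<integral>\<^sup>+s. ?w s * (indicator {0..1} s * (indicator ?B y * indicator {0..} (norm y - s))) \<partial>lborel)" for y :: 'a
  proof (cases "y \<in> ?B")
    case True
    define r where "r = norm y"
    have r: "0 \<le> r" "r \<le> 1" using True by (auto simp: r_def)
    have "((\<lambda>s. p * s powr (p - 1)) has_integral (p * (r powr (p - 1 + 1) / (p - 1 + 1)))) {0..r}"
      using p r by (intro has_integral_mult_right has_integral_powr_from_0) auto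
    from nn_integral_has_integral_lebesgue'[OF _ this]
    have "(\<integral>\<^sup>+s. ?w s * indicator {0..r} s \<partial>lborel) = ennreal (r powr p)"
      using p by simp
    moreover have "(\<integral>\<^sup>+s. ?w s * (indicator {0..1} s * (indicator ?B y * indicator {0..} (norm y - s))) \<partial>lborel) =
        (\<integral>\<^sup>+s. ?w s * indicator {0..r} s \<partial>lborel)"
      using True r by (intro nn_integral_cong) (auto simp: indicator_def r_def)
    ultimately show ?thesis using True by (simp add: r_def)
  qed simp
  have cyl: "emeasure lborel (?B - ball 0 s) = ennreal (v * (1 - s ^ n))" if s: "s \<in> {0..1}" for s
  proof -
     have "emeasure lborel (?B - ball 0 s) = emeasure lborel ?B - emeasure lborel (ball 0 s :: 'a set)"
      using s by (intro emeasure_Diff) (auto simp: emeasure_ball)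
    moreover have "emeasure lborel ?B = ennreal v" by (simp add: emeasure_cball v_def n_def)
    moreover have "emeasure lborel (ball 0 s :: 'a set) = ennreal (v * s ^ n)"
      using s by (simp add: emeasure_ball v_def n_def)
    moreover have "ennreal v - ennreal (v * s ^ n) = ennreal (v - v * s ^ n)"
      using v s by (intro ennreal_minus) auto
    ultimately show ?thesis by (simp add: algebra_simps)
  qed
  have "(\<integral>\<^sup>+y. indicator ?B y * ennreal (norm y powr p) \<partial>lborel) =
      (\<integral>\<^sup>+y. \<integral>\<^sup>+s. ?w s * (indicator {0..1} s * (indicator ?B y * indicator {0..} (norm y - s))) \<partial>lborel \<partial>lborel)"
    by (simp only: layer)
  also have "\<dots> = (\<integral>\<^sup>+s. \<integral>\<^sup>+y. ?w s * (indicator {0..1} s * (indicator ?B y * indicator {0..} (norm y - s))) \<partial>lborel \<partial>lborel)"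
    by (rule pair_sigma_finite.Fubini'[OF pair, symmetric]) measurable
  also have "\<dots> = (\<integral>\<^sup>+s. ennreal (v * p * (s powr (p - 1) - s powr (p - 1 + n))) * indicator {0..1} s \<partial>lborel)"
  proof (rule nn_integral_cong)
    fix s :: real
    have "(\<integral>\<^sup>+y. ?w s * (indicator {0..1} s * (indicator ?B y * indicator {0..} (norm y - s))) \<partial>lborel) =
        (\<integral>\<^sup>+y. (?w s * indicator {0..1} s) * (indicator ?B y * indicator {0..} (norm y - s)) \<partial>lborel)"
      by (simp only: mult.assoc)
    also have "\<dots> = (?w s * indicator {0..1} s) * (\<integral>\<^sup>+y. (indicator ?B y * indicator {0..} (norm y - s)) \<partial>lborel)"
      by (rule nn_integral_cmult) measurable
    also have "(\<integral>\<^sup>+y. (indicator ?B y * indicator {0..} (norm y - s)) \<partial>lborel) = emeasure lborel (?B - ball 0 s)"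
    proof -
      have "(\<integral>\<^sup>+y. (indicator ?B y * indicator {0..} (norm y - s)) \<partial>lborel) =
          (\<integral>\<^sup>+y. indicator (?B - ball 0 s) y \<partial>(lborel :: 'a measure))"
        by (intro nn_integral_cong) (auto simp: indicator_def)
      then show ?thesis by simp
    qed
    also have "(?w s * indicator {0..1} s) * \<dots> = ennreal (v * p * (s powr (p - 1) - s powr (p - 1 + n))) * indicator {0..1} s"
    proof (cases "s \<in> {0..1}")
      case True
      have "ennreal (p * s powr (p - 1)) * ennreal (v * (1 - s ^ n)) = ennreal (p * s powr (p - 1) * (v * (1 - s ^ n)))"
        using p v True by (intro ennreal_mult[symmetric]) (auto simp: power_le_one)
      moreover have "s powr (p - 1 + n) = s powr (p - 1) * s ^ n"
        using True n by (cases "s = 0") (auto simp: powr_add powr_realpow)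
      ultimately show ?thesis using True cyl[OF True] by (simp add: algebra_simps)
    qed simp
    finally show "(\<integral>\<^sup>+y. ?w s * (indicator {0..1} s * (indicator ?B y * indicator {0..} (norm y - s))) \<partial>lborel) =
        ennreal (v * p * (s powr (p - 1) - s powr (p - 1 + n))) * indicator {0..1} s" .
  qed
  also have "\<dots> = ennreal (v * p * (1 / p - 1 / (p + n)))"
  proof -
    have "((\<lambda>s. v * p * (s powr (p - 1) - s powr (p - 1 + n))) has_integral
        (v * p * (1 powr (p - 1 + 1) / (p - 1 + 1) - 1 powr (p - 1 + n + 1) / (p - 1 + n + 1)))) {0..1}"
      using p n by (intro has_integral_mult_right has_integral_diff has_integral_powr_from_0) auto
    then have "((\<lambda>s. v * p * (s powr (p - 1) - s powr (p - 1 + n))) has_integral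
        (v * p * (1 / p - 1 / (p + n)))) {0..1}" by (simp add: add_ac)
    moreover have "0 \<le> v * p * (s powr (p - 1) - s powr (p - 1 + n))" if "s \<in> {0..1}" for s
    proof -
      have "s powr (p - 1 + n) \<le> s powr (p - 1)" using that by (intro powr_mono') auto
      then show ?thesis using v p by simp
    qed
    ultimately show ?thesis by (intro nn_integral_has_integral_lebesgue')
  qed
  also have "v * p * (1 / p - 1 / (p + n)) = real n / (real n + p) * v"
  proof -
    have "p * (1 / p - 1 / (p + n)) = 1 - p / (p + n)" using p by (simp add: right_diff_distrib)
    also have "\<dots> = real n / (real n + p)" using p n by (simp add: field_simps)
    finally show ?thesis by (metis mult.assoc mult.commute)
  qed
  finally show ?thesis by (simp add: n_def v_def)
qed

text \<open>The reciprocal of the mean of \<open>\<bar>x \<bullet> \<theta>\<bar> powr p\<close> over the unit sphere, for a unit vector \<open>x\<close>.\<close>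
definition proj_const :: "real \<Rightarrow> nat \<Rightarrow> real" where
  "proj_const p n = pi powr (1 / 2) * Gamma (p / 2 + real n / 2) / (Gamma (p / 2 + 1 / 2) * Gamma (real n / 2))"

lemma proj_const_pos: "0 < p \<Longrightarrow> 1 \<le> n \<Longrightarrow> 0 < proj_const p n"
  unfolding proj_const_def by (intro divide_pos_pos mult_pos_pos Gamma_real_pos) auto

text \<open>Over the unit ball the mean of \<open>|y|^p\<close> is \<open>n / (n + p)\<close>, while
  the mean of \<open>|y . e|^p\<close> for a unit vector \<open>e\<close> is a quotient of two Beta
  values. The identity says that \<open>proj_const\<close> is the first mean divided by the
  second.\<close>

lemma proj_const_Beta:
  assumes p: "0 < p" and n: "1 \<le> n"
  shows "real n / (real n + p) * Beta (1 / 2) ((real n + 1) / 2) =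
    proj_const p n * Beta ((p + 1) / 2) ((real n + 1) / 2)"
proof -
  define N where "N = real n / 2"
  define q where "q = p / 2"
  have N: "0 < N" and q: "0 < q" using p n by (simp_all add: N_def q_def)
  have Gpos: "Gamma x \<noteq> 0" if "0 < x" for x :: real using Gamma_real_pos[OF that] by simp
  have pos: "Gamma N \<noteq> 0" "Gamma (q + N) \<noteq> 0" "Gamma (q + 1 / 2) \<noteq> 0" "Gamma (N + 1 / 2) \<noteq> 0"
    by (rule Gpos, use N q in simp)+
  have g: "Gamma (N + 1) = N * Gamma N" "Gamma (q + N + 1) = (q + N) * Gamma (q + N)"
  proof -
    have "Gamma (x + 1) = x * Gamma x" if "0 < x" for x :: real
      using that by (intro Gamma_plus1) (auto elim!: nonpos_Ints_cases)
    from this[of N] this[of "q + N"] show "Gamma (N + 1) = N * Gamma N" "Gamma (q + N + 1) = (q + N) * Gamma (q + N)"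
      using N q by simp_all
  qed
  have args: "(real n + 1) / 2 = N + 1 / 2" "(p + 1) / 2 = q + 1 / 2" "1 / 2 + (N + 1 / 2) = N + 1"
    "q + 1 / 2 + (N + 1 / 2) = q + N + 1" "real n / 2 = N" "p / 2 = q"
    by (simp_all add: N_def q_def field_simps)
  have quot: "real n / (real n + p) = N / (q + N)" using p n by (simp add: N_def q_def field_simps)
  have pi: "pi powr (1 / 2) = sqrt pi" by (simp add: powr_half_sqrt)
  have "N / (q + N) * (sqrt pi * Gamma (N + 1 / 2) / (N * Gamma N)) = sqrt pi * Gamma (N + 1 / 2) / ((q + N) * Gamma N)"
  proof -
    have "N / (q + N) * (sqrt pi * Gamma (N + 1 / 2) / (N * Gamma N)) =
        (N * (sqrt pi * Gamma (N + 1 / 2))) / (N * ((q + N) * Gamma N))"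
      unfolding times_divide_times_eq by (simp only: mult.left_commute)
    then show ?thesis using N by simp
  qed
  also have "\<dots> = sqrt pi * Gamma (q + N) / (Gamma (q + 1 / 2) * Gamma N) *
      (Gamma (q + 1 / 2) * Gamma (N + 1 / 2) / ((q + N) * Gamma (q + N)))"
    using N q pos by simp
  finally show ?thesis
    unfolding proj_const_def Beta_def quot pi args g Gamma_one_half_real .
qed

text \<open>Homogeneity pulls out \<open>norm x powr p\<close>, and the marginal for
  \<open>m = 0\<close> makes what remains independent of the direction of \<open>x\<close>.\<close>

lemma ball_projection:
  assumes p: "0 < p"
  obtains K where "0 < K"
    and "\<And>x :: real ^ 'n. (\<integral>\<^sup>+y. indicator (cball 0 1) y * ennreal (\<bar>y \<bullet> x\<bar> powr p) \<partial>lborel) = ennreal (K * norm x powr p)"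
    and "(\<integral>\<^sup>+y. indicator (cball 0 1) y * ennreal (norm (y :: real ^ 'n) powr p) \<partial>lborel) =
      ennreal (proj_const p CARD('n) * K)"
proof -
  define n where "n = CARD('n)"
  have n: "1 \<le> n" by (simp add: n_def Suc_leI)
  obtain \<beta> where \<beta>: "\<beta> > 0" "\<And>g \<theta>. g \<in> borel_measurable borel \<Longrightarrow> norm (\<theta> :: real ^ 'n) = 1 \<Longrightarrow>
    (\<integral>\<^sup>+y. ennreal (cut_power 0 (1 - (norm y)\<^sup>2)) * g (y \<bullet> \<theta>) \<partial>lborel) =
    ennreal \<beta> * (\<integral>\<^sup>+t. ennreal ((1 - t\<^sup>2) ^ 0) * g t \<partial>slice_measure n)"
    using marginal_unit[of 0, where ?'n = 'n] unfolding n_def by blast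
  have cut: "ennreal (cut_power 0 (1 - (norm y)\<^sup>2)) = indicator (cball 0 1) y" for y :: "real ^ 'n"
    using abs_square_le_1[of "norm y"] by (simp add: cut_power_def indicator_def)
  note marg = \<beta>(2)[unfolded cut]
  have [measurable]: "cball 0 1 \<in> sets (borel :: (real ^ 'n) measure)" by simp
  define b where "b = Beta ((p + 1) / 2) ((real n + 1) / 2)"
  have Bpos: "0 < Beta x y" if "0 < x" "0 < y" for x y :: real
    using that unfolding Beta_def by (intro divide_pos_pos mult_pos_pos Gamma_real_pos) auto
  have b: "0 < b" unfolding b_def using p n by (intro Bpos) auto
  show ?thesis
  proof
    show "0 < \<beta> * b" using \<beta>(1) b by simp
    fix x :: "real ^ 'n"
    show "(\<integral>\<^sup>+y. indicator (cball 0 1) y * ennreal (\<bar>y \<bullet> x\<bar> powr p) \<partial>lborel) = ennreal (\<beta> * b * norm x powr p)"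
    proof (cases "x = 0")
      case False
      define \<theta> where "\<theta> = x /\<^sub>R norm x"
      have \<theta>: "norm \<theta> = 1" using False by (simp add: \<theta>_def)
      have e: "\<bar>y \<bullet> x\<bar> powr p = norm x powr p * \<bar>y \<bullet> \<theta>\<bar> powr p" for y
      proof -
        have "x = norm x *\<^sub>R \<theta>" using False by (simp add: \<theta>_def)
        then have "y \<bullet> x = norm x * (y \<bullet> \<theta>)" by (metis inner_scaleR_right)
        then show ?thesis by (simp add: abs_mult powr_mult)
      qed
      have "(\<integral>\<^sup>+y. indicator (cball 0 1) y * ennreal (\<bar>y \<bullet> x\<bar> powr p) \<partial>lborel) =
          (\<integral>\<^sup>+y. ennreal (norm x powr p) * (indicator (cball 0 1) y * ennreal (\<bar>y \<bullet> \<theta>\<bar> powr p)) \<partial>lborel)"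
        unfolding e by (intro nn_integral_cong) (simp add: ennreal_mult mult.left_commute)
      also have "\<dots> = ennreal (norm x powr p) * (\<integral>\<^sup>+y. indicator (cball 0 1) y * ennreal (\<bar>y \<bullet> \<theta>\<bar> powr p) \<partial>lborel)"
        by (rule nn_integral_cmult) measurable
      also have "(\<integral>\<^sup>+y. indicator (cball 0 1) y * ennreal (\<bar>y \<bullet> \<theta>\<bar> powr p) \<partial>lborel) = ennreal \<beta> * ennreal b"
        using marg[OF _ \<theta>, of "\<lambda>t. ennreal (\<bar>t\<bar> powr p)"] nn_integral_slice_moment[of p n] p n by (simp add: b_def)
      also have "ennreal (norm x powr p) * (ennreal \<beta> * ennreal b) = ennreal (\<beta> * b * norm x powr p)"
        using \<beta>(1) b by (simp add: mult_ac flip: ennreal_mult)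
      finally show ?thesis .
    qed (use p in simp)
  next
    obtain e :: "real ^ 'n" where e: "norm e = 1" using vector_choose_size[of 1] by auto
    \<comment> \<open>The same marginal formula applied to the constant 1 ties
      \<open>\<beta>\<close> to the volume of the ball.\<close>
    have "ennreal (unit_ball_vol n) = emeasure lborel (cball 0 1 :: (real ^ 'n) set)"
      by (simp add: emeasure_cball n_def)
    also have "\<dots> = (\<integral>\<^sup>+y. indicator (cball 0 1) y * 1 \<partial>(lborel :: (real ^ 'n) measure))"
      by simp
    also have "\<dots> = ennreal \<beta> * ennreal (Beta (1 / 2) ((real n + 1) / 2))"
      using marg[OF borel_measurable_const e, of 1] nn_integral_slice_mass[OF n] by simp
    also have "\<dots> = ennreal (\<beta> * Beta (1 / 2) ((real n + 1) / 2))"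
      using \<beta>(1) Bpos[of "1 / 2" "(real n + 1) / 2"] by (simp flip: ennreal_mult)
    finally have v: "unit_ball_vol n = \<beta> * Beta (1 / 2) ((real n + 1) / 2)"
      using \<beta>(1) Bpos[of "1 / 2" "(real n + 1) / 2"] by (subst (asm) ennreal_inj) (auto simp: less_imp_le)
    have "real n / (real n + p) * unit_ball_vol n = \<beta> * (real n / (real n + p) * Beta (1 / 2) ((real n + 1) / 2))"
      by (simp add: v)
    also have "\<dots> = proj_const p n * (\<beta> * b)"
      unfolding proj_const_Beta[OF p n] by (simp add: b_def)
    finally show "(\<integral>\<^sup>+y. indicator (cball 0 1) y * ennreal (norm (y :: real ^ 'n) powr p) \<partial>lborel) =
        ennreal (proj_const p CARD('n) * (\<beta> * b))"
      using nn_integral_norm_powr_cball[OF p, where ?'a = "real ^ 'n"] by (simp add: n_def)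
  qed
qed

text \<open>Distinct indices may be sent to the same point, for instance by a projection; their
  weights are added up over each fibre of \<open>u\<close>.\<close>

lemma energy_bound_indexed:
  assumes bd: "energy_bound p S C" and I: "finite I" and u: "u ` I \<subseteq> S"
  shows "(\<Sum>i\<in>I. \<Sum>j\<in>I. a i * a j * dist (u i) (u j) powr p) \<le> C * (\<Sum>i\<in>I. a i)\<^sup>2"
proof -
  define b where "b x = (\<Sum>i | i \<in> I \<and> u i = x. a i)" for x
  have group: "(\<Sum>i\<in>I. a i * f (u i)) = (\<Sum>x\<in>u ` I. b x * f x)" for f :: "'a \<Rightarrow> real"
  proof -
    have "(\<Sum>i\<in>I. a i * f (u i)) = (\<Sum>x\<in>u ` I. \<Sum>i | i \<in> I \<and> u i = x. a i * f (u i))"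
      by (rule sum.image_gen[OF I])
    also have "\<dots> = (\<Sum>x\<in>u ` I. b x * f x)"
      by (intro sum.cong refl) (simp add: b_def sum_distrib_right)
    finally show ?thesis .
  qed
  have "(\<Sum>i\<in>I. \<Sum>j\<in>I. a i * a j * dist (u i) (u j) powr p) =
      (\<Sum>i\<in>I. a i * (\<Sum>j\<in>I. a j * dist (u i) (u j) powr p))"
    by (simp add: sum_distrib_left mult.assoc)
  also have "\<dots> = (\<Sum>i\<in>I. a i * (\<Sum>y\<in>u ` I. b y * dist (u i) y powr p))"
    using group[of "\<lambda>y. dist (u i) y powr p" for i] by simp
  also have "\<dots> = (\<Sum>x\<in>u ` I. b x * (\<Sum>y\<in>u ` I. b y * dist x y powr p))"
    by (rule group)
  also have "\<dots> = (\<Sum>x\<in>u ` I. \<Sum>y\<in>u ` I. b x * b y * dist x y powr p)"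
    by (simp add: sum_distrib_left mult.assoc)
  also have "\<dots> \<le> C * (\<Sum>x\<in>u ` I. b x)\<^sup>2"
    using bd I u unfolding energy_bound_def by simp
  also have "(\<Sum>x\<in>u ` I. b x) = (\<Sum>i\<in>I. a i)"
    using group[of "\<lambda>_. 1"] by simp
  finally show ?thesis .
qed

lemma energy_bound_cball:
  assumes p: "0 < p" "p < 2"
  shows "energy_bound p (cball 0 1 :: (real ^ 'n) set) (proj_const p CARD('n) * max_energy p)"
  unfolding energy_bound_def
proof (intro allI impI)
  fix F :: "(real ^ 'n) set" and a :: "real ^ 'n \<Rightarrow> real" assume F: "finite F" "F \<subseteq> cball 0 1"
  define m where "m = max_energy p"
  define s where "s = (\<Sum>x\<in>F. a x)"
  note bd = energy_bound_max_energy[OF p]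
  let ?B = "cball 0 1 :: (real ^ 'n) set"
  have [measurable]: "?B \<in> sets borel" by simp
  obtain K where K: "0 < K"
    "\<And>x :: real ^ 'n. (\<integral>\<^sup>+y. indicator ?B y * ennreal (\<bar>y \<bullet> x\<bar> powr p) \<partial>lborel) = ennreal (K * norm x powr p)"
    "(\<integral>\<^sup>+y. indicator ?B y * ennreal (norm y powr p) \<partial>lborel) = ennreal (proj_const p CARD('n) * K)"
  proof (rule ball_projection[OF p(1), where ?'n = 'n], goal_cases)
    case (1 K)
    show ?case by (rule 1(1)[OF 1(2-4)])
  qed
  have ind: "ennreal (indicator ?B y * r) = indicator ?B y * ennreal r" for y r
    by (cases "y \<in> ?B") auto
  have c: "0 < proj_const p CARD('n)" using p by (intro proj_const_pos) (auto simp: Suc_leI)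
  have h1: "has_bochner_integral lborel (\<lambda>y. indicator ?B y * \<bar>y \<bullet> x\<bar> powr p) (K * norm x powr p)" for x
    by (rule has_bochner_integral_nn_integral) (use K(1,2) in \<open>auto simp: ind\<close>)
  have h2: "has_bochner_integral lborel (\<lambda>y. indicator ?B y * norm y powr p) (proj_const p CARD('n) * K)"
    by (rule has_bochner_integral_nn_integral) (use K(1,3) c in \<open>auto simp: ind\<close>)
  let ?Q = "\<lambda>y. \<Sum>x\<in>F. \<Sum>x'\<in>F. a x * a x' * (indicator ?B y * \<bar>y \<bullet> (x - x')\<bar> powr p)"
  have h3: "has_bochner_integral lborel ?Q (\<Sum>x\<in>F. \<Sum>x'\<in>F. a x * a x' * (K * norm (x - x') powr p))"
    using h1 by (intro has_bochner_integral_sum has_bochner_integral_mult_right) auto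
  have h4: "has_bochner_integral lborel (\<lambda>y. (m * s\<^sup>2) * (indicator ?B y * norm y powr p)) ((m * s\<^sup>2) * (proj_const p CARD('n) * K))"
    by (intro has_bochner_integral_mult_right h2)
  have le: "?Q y \<le> (m * s\<^sup>2) * (indicator ?B y * norm y powr p)" for y
  proof (cases "y \<in> ?B \<and> y \<noteq> 0")
    case True
    \<comment> \<open>Division by \<open>norm y\<close> puts the projections into
      \<open>[-1, 1]\<close>. The factor \<open>norm y powr p\<close> taken out here integrates to
      \<open>proj_const p CARD('n) * K\<close>.\<close>
    define u where "u x = (y \<bullet> x) / norm y" for x
    have "u ` F \<subseteq> {-1..1}"
    proof
      fix t assume "t \<in> u ` F"
      then obtain x where x: "x \<in> F" "t = u x" by auto
      have "\<bar>y \<bullet> x\<bar> \<le> norm y * norm x" by (rule Cauchy_Schwarz_ineq2)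
      also have "\<dots> \<le> norm y * 1" using x F by (intro mult_left_mono) auto
      finally have "\<bar>t\<bar> \<le> 1" using True x by (simp add: u_def abs_divide divide_le_eq)
      then show "t \<in> {-1..1}" by (simp add: abs_le_iff)
    qed
    from energy_bound_indexed[OF bd F(1) this, of a]
    have "norm y powr p * (\<Sum>x\<in>F. \<Sum>x'\<in>F. a x * a x' * dist (u x) (u x') powr p) \<le> norm y powr p * (m * s\<^sup>2)"
      by (intro mult_left_mono) (simp_all add: m_def s_def)
    moreover have "norm y powr p * dist (u x) (u x') powr p = \<bar>y \<bullet> (x - x')\<bar> powr p" for x x'
    proof -
      have "u x - u x' = (y \<bullet> (x - x')) / norm y" by (simp add: u_def inner_diff_right diff_divide_distrib)
      then have "\<bar>y \<bullet> (x - x')\<bar> = norm y * dist (u x) (u x')" using True by (simp add: dist_real_def abs_divide)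
      then show ?thesis by (simp add: powr_mult)
    qed
    then have "norm y powr p * (\<Sum>x\<in>F. \<Sum>x'\<in>F. a x * a x' * dist (u x) (u x') powr p) =
        (\<Sum>x\<in>F. \<Sum>x'\<in>F. a x * a x' * \<bar>y \<bullet> (x - x')\<bar> powr p)"
      unfolding sum_distrib_left by (intro sum.cong refl) (simp add: mult.left_commute)
    ultimately show ?thesis using True by (simp add: mult.commute)
  next
    case False
    \<comment> \<open>Outside the ball both sides vanish by the indicator, at \<open>y = 0\<close>
      because \<open>p > 0\<close>.\<close>
    then show ?thesis using p by (cases "y = 0") auto
  qed
  have "(\<Sum>x\<in>F. \<Sum>x'\<in>F. a x * a x' * (K * norm (x - x') powr p)) \<le> (m * s\<^sup>2) * (proj_const p CARD('n) * K)"
  proof -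
    have "integral\<^sup>L lborel ?Q \<le> (\<integral>y. (m * s\<^sup>2) * (indicator ?B y * norm y powr p) \<partial>lborel)"
      using h3 h4 le by (intro integral_mono) (auto simp: has_bochner_integral_iff)
    then show ?thesis
      unfolding has_bochner_integral_integral_eq[OF h3] has_bochner_integral_integral_eq[OF h4] .
  qed
  also have "(\<Sum>x\<in>F. \<Sum>x'\<in>F. a x * a x' * (K * norm (x - x') powr p)) =
      K * (\<Sum>x\<in>F. \<Sum>x'\<in>F. a x * a x' * dist x x' powr p)"
    by (simp add: sum_distrib_left dist_norm mult.left_commute)
  finally have "K * (\<Sum>x\<in>F. \<Sum>x'\<in>F. a x * a x' * dist x x' powr p) \<le> K * (proj_const p CARD('n) * m * s\<^sup>2)"
    by (simp add: mult_ac)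
  then show "(\<Sum>x\<in>F. \<Sum>y\<in>F. a x * a y * dist x y powr p) \<le> proj_const p CARD('n) * max_energy p * (\<Sum>x\<in>F. a x)\<^sup>2"
    using K(1) by (simp add: m_def s_def)
qed

section \<open>Energy of radial measures on the ball\<close>

lemma AE_slice_measure: "AE t in slice_measure n. t \<in> {-1..1}"
  unfolding slice_measure_def by (subst AE_density) (auto simp: indicator_def)

lemma finite_slice_measure:
  assumes "1 \<le> n"
  shows "finite_measure (slice_measure n)"
proof (rule finite_measureI)
  have "emeasure (slice_measure n) (space (slice_measure n)) = (\<integral>\<^sup>+t. 1 \<partial>slice_measure n)" by simp
  then show "emeasure (slice_measure n) (space (slice_measure n)) \<noteq> \<infinity>"
    using nn_integral_slice_mass[OF assms] by simp
qed

lemma slice_power_bounds: "t \<in> {-1..1} \<Longrightarrow> 0 \<le> (1 - t\<^sup>2) ^ m" "t \<in> {-1..1} \<Longrightarrow> (1 - t\<^sup>2) ^ m \<le> (1 :: real)"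
  using abs_square_le_1[of t] by (auto simp: abs_le_iff power_le_one)

text \<open>The ball is made a space of its own because the condition on an embedding, and with it
  measurability, concerns only points of the ball.\<close>

definition ball_measure :: "nat \<Rightarrow> (real ^ 'n) measure" where
  "ball_measure m = restrict_space (density lborel (\<lambda>y. ennreal (cut_power m (1 - (norm y)\<^sup>2)))) (cball 0 1)"

lemma space_ball_measure [simp]: "space (ball_measure m) = cball 0 1"
  by (simp add: ball_measure_def space_restrict_space)

lemma sets_ball_measure [simp, measurable_cong]:
  "sets (ball_measure m) = sets (restrict_space borel (cball 0 1))"
  unfolding ball_measure_def by (rule sets_restrict_space_cong) simp

lemma nn_integral_ball_measure:
  fixes f :: "real ^ 'n \<Rightarrow> ennreal"
  assumes [measurable]: "f \<in> borel_measurable borel"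
  shows "(\<integral>\<^sup>+y. f y \<partial>ball_measure m) = (\<integral>\<^sup>+y. ennreal (cut_power m (1 - (norm y)\<^sup>2)) * f y \<partial>lborel)"
proof -
  have [measurable]: "cball 0 1 \<in> sets (borel :: (real ^ 'n) measure)" by simp
  have "(\<integral>\<^sup>+y. f y \<partial>ball_measure m) =
      (\<integral>\<^sup>+y. f y * indicator (cball 0 1) y \<partial>density lborel (\<lambda>y. ennreal (cut_power m (1 - (norm y)\<^sup>2))))"
    unfolding ball_measure_def by (rule nn_integral_restrict_space) simp
  also have "\<dots> = (\<integral>\<^sup>+y. ennreal (cut_power m (1 - (norm y)\<^sup>2)) * (f y * indicator (cball 0 1) y) \<partial>lborel)"
    by (rule nn_integral_density) measurable
  also have "\<dots> = (\<integral>\<^sup>+y. ennreal (cut_power m (1 - (norm y)\<^sup>2)) * f y \<partial>lborel)"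
  proof (rule nn_integral_cong)
    fix y :: "real ^ 'n"
    show "ennreal (cut_power m (1 - (norm y)\<^sup>2)) * (f y * indicator (cball 0 1) y) =
        ennreal (cut_power m (1 - (norm y)\<^sup>2)) * f y"
      using abs_square_le_1[of "norm y"] by (cases "norm y \<le> 1") (auto simp: cut_power_def)
  qed
  finally show ?thesis .
qed

text \<open>Choosing the constant makes it a function of the dimension and of \<open>m\<close>
  alone, so that it can be divided out of the coefficients in
  \<open>poly_slice_energy\<close>.\<close>

definition marginal_const :: "'n::finite itself \<Rightarrow> nat \<Rightarrow> real" where
  "marginal_const _ m = (SOME \<beta>. 0 < \<beta> \<and> (\<forall>g\<in>borel_measurable borel. \<forall>\<theta> :: real ^ 'n. norm \<theta> = 1 \<longrightarrow>
    (\<integral>\<^sup>+y. ennreal (cut_power m (1 - (norm y)\<^sup>2)) * g (y \<bullet> \<theta>) \<partial>lborel) =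
    ennreal \<beta> * (\<integral>\<^sup>+t. ennreal ((1 - t\<^sup>2) ^ m) * g t \<partial>slice_measure CARD('n))))"

lemma marginal_const_pos: "0 < marginal_const TYPE('n::finite) m"
  and marginal_const: "g \<in> borel_measurable borel \<Longrightarrow> norm (\<theta> :: real ^ 'n) = 1 \<Longrightarrow>
    (\<integral>\<^sup>+y. ennreal (cut_power m (1 - (norm y)\<^sup>2)) * g (y \<bullet> \<theta>) \<partial>lborel) =
    ennreal (marginal_const TYPE('n) m) * (\<integral>\<^sup>+t. ennreal ((1 - t\<^sup>2) ^ m) * g t \<partial>slice_measure CARD('n))"
proof -
  have "0 < marginal_const TYPE('n) m \<and> (\<forall>g\<in>borel_measurable borel. \<forall>\<theta> :: real ^ 'n. norm \<theta> = 1 \<longrightarrow>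
    (\<integral>\<^sup>+y. ennreal (cut_power m (1 - (norm y)\<^sup>2)) * g (y \<bullet> \<theta>) \<partial>lborel) =
    ennreal (marginal_const TYPE('n) m) * (\<integral>\<^sup>+t. ennreal ((1 - t\<^sup>2) ^ m) * g t \<partial>slice_measure CARD('n)))"
    unfolding marginal_const_def by (rule someI_ex) (use marginal_unit[where ?'n = 'n, of m] in simp)
  then show "0 < marginal_const TYPE('n) m" "g \<in> borel_measurable borel \<Longrightarrow> norm (\<theta> :: real ^ 'n) = 1 \<Longrightarrow>
    (\<integral>\<^sup>+y. ennreal (cut_power m (1 - (norm y)\<^sup>2)) * g (y \<bullet> \<theta>) \<partial>lborel) =
    ennreal (marginal_const TYPE('n) m) * (\<integral>\<^sup>+t. ennreal ((1 - t\<^sup>2) ^ m) * g t \<partial>slice_measure CARD('n))"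
    by blast+
qed

lemma emeasure_ball_measure:
  "emeasure (ball_measure m :: (real ^ 'n) measure) (cball 0 1) =
    ennreal (marginal_const TYPE('n) m) * (\<integral>\<^sup>+t. ennreal ((1 - t\<^sup>2) ^ m) \<partial>slice_measure CARD('n))"
proof -
  obtain \<theta> :: "real ^ 'n" where \<theta>: "norm \<theta> = 1" using vector_choose_size[of 1] by auto
  have "emeasure (ball_measure m :: (real ^ 'n) measure) (cball 0 1) = (\<integral>\<^sup>+y. 1 \<partial>(ball_measure m :: (real ^ 'n) measure))"
    by simp
  also have "\<dots> = (\<integral>\<^sup>+y. ennreal (cut_power m (1 - (norm (y :: real ^ 'n))\<^sup>2)) * 1 \<partial>lborel)"
    by (rule nn_integral_ball_measure) simp
  also have "\<dots> = ennreal (marginal_const TYPE('n) m) * (\<integral>\<^sup>+t. ennreal ((1 - t\<^sup>2) ^ m) * 1 \<partial>slice_measure CARD('n))"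
    using marginal_const[OF borel_measurable_const \<theta>] .
  finally show ?thesis by simp
qed

lemma integrable_slice:
  fixes f :: "real \<Rightarrow> real"
  assumes n: "1 \<le> n" and f: "f \<in> borel_measurable borel" and bd: "\<And>t. t \<in> {-1..1} \<Longrightarrow> \<bar>f t\<bar> \<le> B"
  shows "integrable (slice_measure n) f"
proof (rule finite_measure.integrable_const_bound[OF finite_slice_measure[OF n], where B = B])
  show "AE t in slice_measure n. norm (f t) \<le> B"
    using AE_slice_measure[of n] by eventually_elim (simp add: bd)
  show "f \<in> borel_measurable (slice_measure n)" using f by simp
qed

lemma nn_integral_slice_power:
  assumes n: "1 \<le> n"
  shows "(\<integral>\<^sup>+t. ennreal ((1 - t\<^sup>2) ^ m) \<partial>slice_measure n) = ennreal (\<integral>t. (1 - t\<^sup>2) ^ m \<partial>slice_measure n)"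
proof (rule nn_integral_eq_integral)
  show "integrable (slice_measure n) (\<lambda>t. (1 - t\<^sup>2) ^ m)"
    using slice_power_bounds by (intro integrable_slice[OF n, where B = 1]) (auto simp: abs_of_nonneg)
  show "AE t in slice_measure n. 0 \<le> (1 - t\<^sup>2) ^ m"
    using AE_slice_measure[of n] by eventually_elim (rule slice_power_bounds)
qed

lemma finite_ball_measure: "finite_measure (ball_measure m :: (real ^ 'n) measure)"
  by (rule finite_measureI)
    (simp add: emeasure_ball_measure nn_integral_slice_power Suc_leI ennreal_mult_eq_top_iff)

lemma measure_ball_measure:
  "measure (ball_measure m :: (real ^ 'n) measure) (cball 0 1) =
    marginal_const TYPE('n) m * (\<integral>t. (1 - t\<^sup>2) ^ m \<partial>slice_measure CARD('n))"
proof -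
  have "AE t in slice_measure CARD('n). 0 \<le> (1 - t\<^sup>2) ^ m"
    using AE_slice_measure[of "CARD('n)"] by eventually_elim (rule slice_power_bounds)
  then have "0 \<le> (\<integral>t. (1 - t\<^sup>2) ^ m \<partial>slice_measure CARD('n))"
    by (rule integral_nonneg_AE)
  then show ?thesis
    using marginal_const_pos[of m, where ?'n = 'n]
    by (simp add: measure_def emeasure_ball_measure nn_integral_slice_power Suc_leI enn2real_mult)
qed

text \<open>Fubini for nested weighted integrals, in the shape that moves the direction outside one
  point variable at a time.\<close>

lemma nn_integral_swap_weights:
  fixes H J :: "'a::euclidean_space \<Rightarrow> ennreal"
  assumes [measurable]: "H \<in> borel_measurable borel" "J \<in> borel_measurable borel"
    and [measurable]: "(\<lambda>z. e (fst z) (snd z)) \<in> borel_measurable (lborel \<Otimes>\<^sub>M lborel)"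
  shows "(\<integral>\<^sup>+x. H x * (\<integral>\<^sup>+\<theta>. J \<theta> * e x \<theta> \<partial>lborel) \<partial>lborel) = (\<integral>\<^sup>+\<theta>. J \<theta> * (\<integral>\<^sup>+x. H x * e x \<theta> \<partial>lborel) \<partial>lborel)"
proof -
  have pair: "pair_sigma_finite (lborel :: 'a measure) (lborel :: 'a measure)" by standard
  have m1: "(\<lambda>\<theta>. J \<theta> * e x \<theta>) \<in> borel_measurable lborel" for x
    using measurable_compose[OF measurable_Pair1'[of x lborel lborel] assms(3)] by simp
  have m2: "(\<lambda>x. H x * e x \<theta>) \<in> borel_measurable lborel" for \<theta>
    using measurable_compose[OF measurable_Pair2'[of \<theta> lborel lborel] assms(3)] by simp
  have "(\<integral>\<^sup>+x. H x * (\<integral>\<^sup>+\<theta>. J \<theta> * e x \<theta> \<partial>lborel) \<partial>lborel) = (\<integral>\<^sup>+x. \<integral>\<^sup>+\<theta>. H x * (J \<theta> * e x \<theta>) \<partial>lborel \<partial>lborel)"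
    by (intro nn_integral_cong nn_integral_cmult[symmetric] m1)
  also have "\<dots> = (\<integral>\<^sup>+\<theta>. \<integral>\<^sup>+x. H x * (J \<theta> * e x \<theta>) \<partial>lborel \<partial>lborel)"
  proof (rule pair_sigma_finite.Fubini'[OF pair, symmetric])
    show "(\<lambda>(x, \<theta>). H x * (J \<theta> * e x \<theta>)) \<in> borel_measurable (lborel \<Otimes>\<^sub>M lborel)"
      unfolding case_prod_beta by measurable
  qed
  also have "\<dots> = (\<integral>\<^sup>+\<theta>. \<integral>\<^sup>+x. J \<theta> * (H x * e x \<theta>) \<partial>lborel \<partial>lborel)"
    by (simp only: mult.left_commute)
  also have "\<dots> = (\<integral>\<^sup>+\<theta>. J \<theta> * (\<integral>\<^sup>+x. H x * e x \<theta> \<partial>lborel) \<partial>lborel)"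
    by (intro nn_integral_cong nn_integral_cmult m2)
  finally show ?thesis .
qed

text \<open>By \<open>ball_projection\<close>, \<open>norm (x - y) powr p\<close> is a superposition of functions of \<open>x \<bullet> \<theta>\<close> and
  \<open>y \<bullet> \<theta>\<close>, and radial measures have the same marginal in every direction \<open>\<theta>\<close>.\<close>
lemma nn_ball_energy:
  assumes p: "0 < p"
  shows "(\<integral>\<^sup>+y. \<integral>\<^sup>+x. ennreal (dist x y powr p) \<partial>ball_measure m \<partial>(ball_measure k :: (real ^ 'n) measure)) =
    ennreal (proj_const p CARD('n) * marginal_const TYPE('n) m * marginal_const TYPE('n) k) *
    (\<integral>\<^sup>+t. ennreal ((1 - t\<^sup>2) ^ k) * (\<integral>\<^sup>+s. ennreal ((1 - s\<^sup>2) ^ m) * ennreal (\<bar>s - t\<bar> powr p)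
      \<partial>slice_measure CARD('n)) \<partial>slice_measure CARD('n))"
proof -
  define W where "W = slice_measure CARD('n)"
  have Wb [measurable_cong]: "sets W = sets borel" by (simp add: W_def)
  define bm bk where "bm = marginal_const TYPE('n) m" and "bk = marginal_const TYPE('n) k"
  have b: "0 < bm" "0 < bk" by (simp_all add: bm_def bk_def marginal_const_pos)
  define c where "c = proj_const p CARD('n)"
  have c: "0 < c" unfolding c_def using p by (intro proj_const_pos) (auto simp: Suc_leI)
  let ?B = "cball 0 1 :: (real ^ 'n) set"
  have [measurable]: "?B \<in> sets borel" by simp
  obtain K where K: "0 < K"
    "\<And>x :: real ^ 'n. (\<integral>\<^sup>+y. indicator ?B y * ennreal (\<bar>y \<bullet> x\<bar> powr p) \<partial>lborel) = ennreal (K * norm x powr p)"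
    "(\<integral>\<^sup>+y. indicator ?B y * ennreal (norm y powr p) \<partial>lborel) = ennreal (c * K)"
  proof (rule ball_projection[OF p, where ?'n = 'n], goal_cases)
    case (1 K)
    show ?case by (rule 1(1)[OF 1(2-3) 1(4)[folded c_def]])
  qed
  interpret W: sigma_finite_measure W
    using finite_slice_measure[of "CARD('n)"] unfolding W_def
    by (simp add: finite_measure_def Suc_leI)
  let ?h = "\<lambda>i y :: real ^ 'n. ennreal (cut_power i (1 - (norm y)\<^sup>2))"
  let ?D = "\<integral>\<^sup>+t. ennreal ((1 - t\<^sup>2) ^ k) * (\<integral>\<^sup>+s. ennreal ((1 - s\<^sup>2) ^ m) * ennreal (\<bar>s - t\<bar> powr p) \<partial>W) \<partial>W"
  define A where "A = (\<integral>\<^sup>+y. \<integral>\<^sup>+x. ennreal (dist x y powr p) \<partial>ball_measure m \<partial>(ball_measure k :: (real ^ 'n) measure))"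
  have A: "A = (\<integral>\<^sup>+y. ?h k y * (\<integral>\<^sup>+x. ?h m x * ennreal (dist x y powr p) \<partial>lborel) \<partial>lborel)"
    unfolding A_def by (subst (1 2) nn_integral_ball_measure) measurable
  \<comment> \<open>For a fixed direction both integrals reduce to the slice measure, and
    \<open>\<theta>\<close> survives only through the factor
    \<open>norm \<theta> powr p\<close>.\<close>
  have inner: "(\<integral>\<^sup>+y. ?h k y * (\<integral>\<^sup>+x. ?h m x * ennreal (\<bar>\<theta> \<bullet> (x - y)\<bar> powr p) \<partial>lborel) \<partial>lborel) =
      ennreal (norm \<theta> powr p) * (ennreal (bm * bk) * ?D)" for \<theta> :: "real ^ 'n"
  proof (cases "\<theta> = 0")
    case True
    then show ?thesis using p by simp
  next
    case False
    define \<phi> where "\<phi> = \<theta> /\<^sub>R norm \<theta>"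
    have \<phi>: "norm \<phi> = 1" using False by (simp add: \<phi>_def)
    have e: "ennreal (\<bar>\<theta> \<bullet> (x - y)\<bar> powr p) = ennreal (norm \<theta> powr p) * ennreal (\<bar>x \<bullet> \<phi> - y \<bullet> \<phi>\<bar> powr p)" for x y
    proof -
      have "\<theta> = norm \<theta> *\<^sub>R \<phi>" using False by (simp add: \<phi>_def)
      then have "\<theta> \<bullet> (x - y) = norm \<theta> * (x \<bullet> \<phi> - y \<bullet> \<phi>)"
        by (metis inner_commute inner_diff_left inner_scaleR_right)
      then show ?thesis by (simp add: abs_mult powr_mult ennreal_mult)
    qed
    define g where "g t = (\<integral>\<^sup>+s. ennreal ((1 - s\<^sup>2) ^ m) * ennreal (\<bar>s - t\<bar> powr p) \<partial>W)" for t
    have g [measurable]: "g \<in> borel_measurable borel" unfolding g_def by measurable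
    have "(\<integral>\<^sup>+x. ?h m x * ennreal (\<bar>\<theta> \<bullet> (x - y)\<bar> powr p) \<partial>lborel) =
        ennreal (norm \<theta> powr p) * (ennreal bm * g (y \<bullet> \<phi>))" for y
    proof -
      have "(\<integral>\<^sup>+x. ?h m x * ennreal (\<bar>\<theta> \<bullet> (x - y)\<bar> powr p) \<partial>lborel) =
          (\<integral>\<^sup>+x. ennreal (norm \<theta> powr p) * (?h m x * ennreal (\<bar>x \<bullet> \<phi> - y \<bullet> \<phi>\<bar> powr p)) \<partial>lborel)"
        unfolding e by (simp only: mult.left_commute)
      also have "\<dots> = ennreal (norm \<theta> powr p) * (\<integral>\<^sup>+x. ?h m x * ennreal (\<bar>x \<bullet> \<phi> - y \<bullet> \<phi>\<bar> powr p) \<partial>lborel)"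
        by (rule nn_integral_cmult) measurable
      also have "(\<integral>\<^sup>+x. ?h m x * ennreal (\<bar>x \<bullet> \<phi> - y \<bullet> \<phi>\<bar> powr p) \<partial>lborel) = ennreal bm * g (y \<bullet> \<phi>)"
        unfolding g_def bm_def W_def
        by (rule marginal_const[OF _ \<phi>, of "\<lambda>s. ennreal (\<bar>s - y \<bullet> \<phi>\<bar> powr p)"]) measurable
      finally show ?thesis .
    qed
    then have "(\<integral>\<^sup>+y. ?h k y * (\<integral>\<^sup>+x. ?h m x * ennreal (\<bar>\<theta> \<bullet> (x - y)\<bar> powr p) \<partial>lborel) \<partial>lborel) =
        (\<integral>\<^sup>+y. (ennreal (norm \<theta> powr p) * ennreal bm) * (?h k y * g (y \<bullet> \<phi>)) \<partial>lborel)"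
      by (simp only: mult_ac)
    also have "\<dots> = (ennreal (norm \<theta> powr p) * ennreal bm) * (\<integral>\<^sup>+y. ?h k y * g (y \<bullet> \<phi>) \<partial>lborel)"
      by (rule nn_integral_cmult) measurable
    also have "(\<integral>\<^sup>+y. ?h k y * g (y \<bullet> \<phi>) \<partial>lborel) = ennreal bk * (\<integral>\<^sup>+t. ennreal ((1 - t\<^sup>2) ^ k) * g t \<partial>W)"
      unfolding bk_def W_def by (rule marginal_const[OF g \<phi>])
    finally show ?thesis using b by (simp add: g_def ennreal_mult mult.assoc)
  qed
  \<comment> \<open>Each \<open>K * dist x y powr p\<close> is expanded as an integral over
    directions, which two applications of Fubini then carry to the outside.\<close>
  have "ennreal K * A = (\<integral>\<^sup>+y. ?h k y * (\<integral>\<^sup>+x. ?h m x * (\<integral>\<^sup>+\<theta>. indicator ?B \<theta> * ennreal (\<bar>\<theta> \<bullet> (x - y)\<bar> powr p) \<partial>lborel) \<partial>lborel) \<partial>lborel)"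
  proof -
    have KE: "ennreal K * ennreal (dist x y powr p) =
        (\<integral>\<^sup>+\<theta>. indicator ?B \<theta> * ennreal (\<bar>\<theta> \<bullet> (x - y)\<bar> powr p) \<partial>lborel)" for x y
      using K(1) K(2)[of "x - y"] by (simp add: dist_norm ennreal_mult)
    have "ennreal K * A = (\<integral>\<^sup>+y. ennreal K * (?h k y * (\<integral>\<^sup>+x. ?h m x * ennreal (dist x y powr p) \<partial>lborel)) \<partial>lborel)"
      unfolding A by (rule nn_integral_cmult[symmetric]) measurable
    also have "\<dots> = (\<integral>\<^sup>+y. ?h k y * (ennreal K * (\<integral>\<^sup>+x. ?h m x * ennreal (dist x y powr p) \<partial>lborel)) \<partial>lborel)"
      by (simp only: mult.left_commute)
    also have "\<dots> = (\<integral>\<^sup>+y. ?h k y * (\<integral>\<^sup>+x. ennreal K * (?h m x * ennreal (dist x y powr p)) \<partial>lborel) \<partial>lborel)"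
      by (subst nn_integral_cmult) simp_all
    also have "\<dots> = (\<integral>\<^sup>+y. ?h k y * (\<integral>\<^sup>+x. ?h m x * (ennreal K * ennreal (dist x y powr p)) \<partial>lborel) \<partial>lborel)"
      by (simp only: mult.left_commute)
    finally show ?thesis unfolding KE .
  qed
  also have "\<dots> = (\<integral>\<^sup>+y. ?h k y * (\<integral>\<^sup>+\<theta>. indicator ?B \<theta> * (\<integral>\<^sup>+x. ?h m x * ennreal (\<bar>\<theta> \<bullet> (x - y)\<bar> powr p) \<partial>lborel) \<partial>lborel) \<partial>lborel)"
  proof (rule nn_integral_cong)
    fix y :: "real ^ 'n"
    show "?h k y * (\<integral>\<^sup>+x. ?h m x * (\<integral>\<^sup>+\<theta>. indicator ?B \<theta> * ennreal (\<bar>\<theta> \<bullet> (x - y)\<bar> powr p) \<partial>lborel) \<partial>lborel) =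
        ?h k y * (\<integral>\<^sup>+\<theta>. indicator ?B \<theta> * (\<integral>\<^sup>+x. ?h m x * ennreal (\<bar>\<theta> \<bullet> (x - y)\<bar> powr p) \<partial>lborel) \<partial>lborel)"
      by (subst nn_integral_swap_weights) simp_all
  qed
  also have "\<dots> = (\<integral>\<^sup>+\<theta>. indicator ?B \<theta> * (\<integral>\<^sup>+y. ?h k y * (\<integral>\<^sup>+x. ?h m x * ennreal (\<bar>\<theta> \<bullet> (x - y)\<bar> powr p) \<partial>lborel) \<partial>lborel) \<partial>lborel)"
    by (rule nn_integral_swap_weights) simp_all
  also have "\<dots> = (\<integral>\<^sup>+\<theta>. indicator ?B \<theta> * ennreal (norm \<theta> powr p) * (ennreal (bm * bk) * ?D) \<partial>lborel)"
    by (simp only: inner mult.assoc)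
  also have "\<dots> = ennreal (c * K) * (ennreal (bm * bk) * ?D)"
    unfolding K(3)[symmetric] by (rule nn_integral_multc) measurable
  also have "\<dots> = ennreal K * (ennreal (c * bm * bk) * ?D)"
    using b c K(1) by (simp add: ennreal_mult mult_ac)
  finally have "A = ennreal (c * bm * bk) * ?D"
    using K(1) ennreal_mult_cancel_left[of "ennreal K" A "ennreal (c * bm * bk) * ?D"] by simp
  then show ?thesis by (simp add: A_def W_def c_def bm_def bk_def)
qed

lemma ident_ball_measure: "(\<lambda>x. x) \<in> borel_measurable (ball_measure m :: (real ^ 'n) measure)"
  unfolding measurable_cong_sets[OF sets_ball_measure refl] by (rule measurable_restrict_space1) simp

lemma ball_potential:
  fixes y :: "real ^ 'n"
  assumes p: "0 < p"
  shows "(\<integral>\<^sup>+x. ennreal (dist x y powr p) \<partial>ball_measure m) = ennreal (\<integral>x. dist x y powr p \<partial>ball_measure m)"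
    and "0 \<le> (\<integral>x. dist x y powr p \<partial>ball_measure m)"
    and "y \<in> cball 0 1 \<Longrightarrow> \<bar>\<integral>x. dist x y powr p \<partial>ball_measure m\<bar> \<le>
      2 powr p * measure (ball_measure m :: (real ^ 'n) measure) (cball 0 1)"
proof -
  let ?M = "ball_measure m :: (real ^ 'n) measure"
  have meas: "(\<lambda>x. dist x y powr p) \<in> borel_measurable ?M"
    by (rule measurable_compose[OF ident_ball_measure]) measurable
  have bd: "dist x y powr p \<le> (1 + norm y) powr p" if "x \<in> cball 0 1" for x
  proof (rule powr_mono2)
    show "dist x y \<le> 1 + norm y" using that dist_triangle[of x y 0] by (simp add: dist_commute)
  qed (use p in auto)
  have int: "integrable ?M (\<lambda>x. dist x y powr p)"
    using meas bd by (intro integrable_bounded[OF finite_ball_measure, where B = "(1 + norm y) powr p"]) auto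
  show "(\<integral>\<^sup>+x. ennreal (dist x y powr p) \<partial>?M) = ennreal (\<integral>x. dist x y powr p \<partial>?M)"
    by (rule nn_integral_eq_integral[OF int]) simp
  show nn: "0 \<le> (\<integral>x. dist x y powr p \<partial>?M)" by (rule Bochner_Integration.integral_nonneg) simp
  assume y: "y \<in> cball 0 1"
  have "(\<integral>x. dist x y powr p \<partial>?M) \<le> (\<integral>x. 2 powr p \<partial>?M)"
  proof (rule integral_mono[OF int])
    show "integrable ?M (\<lambda>x. 2 powr p)" by (rule finite_measure.integrable_const[OF finite_ball_measure])
    fix x assume "x \<in> space ?M"
    then have "dist x y powr p \<le> (1 + norm y) powr p" by (intro bd) simp
    also have "\<dots> \<le> 2 powr p" using y p by (intro powr_mono2) auto
    finally show "dist x y powr p \<le> 2 powr p" .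
  qed
  then show "\<bar>\<integral>x. dist x y powr p \<partial>?M\<bar> \<le> 2 powr p * measure ?M (cball 0 1)"
    using nn by (simp add: mult.commute)
qed

lemma measurable_ball_potential:
  "(\<lambda>y. \<integral>x. dist x y powr p \<partial>(ball_measure m :: (real ^ 'n) measure)) \<in> borel_measurable (ball_measure k)"
proof -
  interpret sigma_finite_measure "ball_measure m :: (real ^ 'n) measure"
    using finite_ball_measure[of m, where ?'n = 'n] by (simp add: finite_measure_def)
  have f: "(\<lambda>z. fst z) \<in> borel_measurable (ball_measure k \<Otimes>\<^sub>M (ball_measure m :: (real ^ 'n) measure))"
    by (rule measurable_compose[OF measurable_fst ident_ball_measure])
  have s: "(\<lambda>z. snd z) \<in> borel_measurable (ball_measure k \<Otimes>\<^sub>M (ball_measure m :: (real ^ 'n) measure))"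
    by (rule measurable_compose[OF measurable_snd ident_ball_measure])
  have "(\<lambda>z. dist (snd z) (fst z) powr p) \<in> borel_measurable (ball_measure k \<Otimes>\<^sub>M (ball_measure m :: (real ^ 'n) measure))"
    by (rule measurable_compose[OF borel_measurable_dist[OF s f], of "\<lambda>r. r powr p"]) measurable
  then show ?thesis
    by (intro borel_measurable_lebesgue_integral) (simp add: case_prod_beta)
qed

lemma slice_potential:
  assumes p: "0 < p" and n: "1 \<le> n"
  shows "integrable (slice_measure n) (\<lambda>s. \<bar>s - t\<bar> powr p * (1 - s\<^sup>2) ^ m)"
    and "(\<integral>\<^sup>+s. ennreal ((1 - s\<^sup>2) ^ m) * ennreal (\<bar>s - t\<bar> powr p) \<partial>slice_measure n) =
      ennreal (\<integral>s. \<bar>s - t\<bar> powr p * (1 - s\<^sup>2) ^ m \<partial>slice_measure n)"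
    and "0 \<le> (\<integral>s. \<bar>s - t\<bar> powr p * (1 - s\<^sup>2) ^ m \<partial>slice_measure n)"
proof -
  show int: "integrable (slice_measure n) (\<lambda>s. \<bar>s - t\<bar> powr p * (1 - s\<^sup>2) ^ m)"
  proof (rule integrable_slice[OF n, where B = "(1 + \<bar>t\<bar>) powr p"])
    fix s :: real assume s: "s \<in> {-1..1}"
    have "\<bar>s - t\<bar> powr p * (1 - s\<^sup>2) ^ m \<le> (1 + \<bar>t\<bar>) powr p * 1"
      using s p slice_power_bounds[OF s] by (intro mult_mono powr_mono2) auto
    then show "\<bar>\<bar>s - t\<bar> powr p * (1 - s\<^sup>2) ^ m\<bar> \<le> (1 + \<bar>t\<bar>) powr p"
      using slice_power_bounds[OF s] by simp
  qed measurable
  have nn: "AE s in slice_measure n. 0 \<le> \<bar>s - t\<bar> powr p * (1 - s\<^sup>2) ^ m"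
    using AE_slice_measure[of n] by eventually_elim (simp add: slice_power_bounds)
  have "(\<integral>\<^sup>+s. ennreal ((1 - s\<^sup>2) ^ m) * ennreal (\<bar>s - t\<bar> powr p) \<partial>slice_measure n) =
      (\<integral>\<^sup>+s. ennreal (\<bar>s - t\<bar> powr p * (1 - s\<^sup>2) ^ m) \<partial>slice_measure n)"
  proof (rule nn_integral_cong_AE)
    show "AE s in slice_measure n. ennreal ((1 - s\<^sup>2) ^ m) * ennreal (\<bar>s - t\<bar> powr p) =
        ennreal (\<bar>s - t\<bar> powr p * (1 - s\<^sup>2) ^ m)"
      using AE_slice_measure[of n]
    proof eventually_elim
      case (elim s)
      show ?case using slice_power_bounds(1)[OF elim, of m] by (subst mult.commute, subst ennreal_mult) auto
    qed
  qed
  also have "\<dots> = ennreal (\<integral>s. \<bar>s - t\<bar> powr p * (1 - s\<^sup>2) ^ m \<partial>slice_measure n)"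
    by (rule nn_integral_eq_integral[OF int nn])
  finally show "(\<integral>\<^sup>+s. ennreal ((1 - s\<^sup>2) ^ m) * ennreal (\<bar>s - t\<bar> powr p) \<partial>slice_measure n) =
      ennreal (\<integral>s. \<bar>s - t\<bar> powr p * (1 - s\<^sup>2) ^ m \<partial>slice_measure n)" .
  show "0 \<le> (\<integral>s. \<bar>s - t\<bar> powr p * (1 - s\<^sup>2) ^ m \<partial>slice_measure n)"
    by (rule integral_nonneg_AE[OF nn])
qed

lemma measurable_slice_potential:
  assumes n: "1 \<le> n" and [measurable]: "f \<in> borel_measurable borel"
  shows "(\<lambda>t. \<integral>s. \<bar>s - t\<bar> powr p * f s \<partial>slice_measure n) \<in> borel_measurable borel"
proof -
  interpret sigma_finite_measure "slice_measure n"
    using finite_slice_measure[OF n] by (simp add: finite_measure_def)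
  show ?thesis by (rule borel_measurable_lebesgue_integral) measurable
qed

text \<open>Passage from nonnegative integrals to Bochner integrals, which can be combined with
  coefficients of either sign.\<close>

lemma ball_energy:
  assumes p: "0 < p"
  shows "(\<integral>y. (\<integral>x. dist x y powr p \<partial>ball_measure m) \<partial>(ball_measure k :: (real ^ 'n) measure)) =
    proj_const p CARD('n) * marginal_const TYPE('n) m * marginal_const TYPE('n) k *
    (\<integral>t. (\<integral>s. \<bar>s - t\<bar> powr p * (1 - s\<^sup>2) ^ m \<partial>slice_measure CARD('n)) * (1 - t\<^sup>2) ^ k \<partial>slice_measure CARD('n))"
proof -
  define W where "W = slice_measure CARD('n)"
  have n: "1 \<le> CARD('n)" by (simp add: Suc_leI)
  define c where "c = proj_const p CARD('n) * marginal_const TYPE('n) m * marginal_const TYPE('n) k"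
  have c: "0 \<le> c" unfolding c_def using proj_const_pos[OF p n] marginal_const_pos[of _, where ?'n = 'n]
    by (simp add: less_imp_le)
  let ?h = "\<lambda>t. \<integral>s. \<bar>s - t\<bar> powr p * (1 - s\<^sup>2) ^ m \<partial>W"
  note pot = slice_potential[OF p n, folded W_def]
  have hm [measurable]: "?h \<in> borel_measurable W"
    using measurable_slice_potential[OF n, of "\<lambda>s. (1 - s\<^sup>2) ^ m" p] by (simp add: W_def)
  have "(\<integral>y. (\<integral>x. dist x y powr p \<partial>ball_measure m) \<partial>(ball_measure k :: (real ^ 'n) measure)) =
      enn2real (\<integral>\<^sup>+y. ennreal (\<integral>x. dist x y powr p \<partial>ball_measure m) \<partial>(ball_measure k :: (real ^ 'n) measure))"
    by (rule integral_eq_nn_integral[OF measurable_ball_potential]) (simp add: ball_potential(2)[OF p])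
  also have "\<dots> = enn2real (\<integral>\<^sup>+y. \<integral>\<^sup>+x. ennreal (dist x y powr p) \<partial>ball_measure m \<partial>(ball_measure k :: (real ^ 'n) measure))"
    by (simp only: ball_potential(1)[OF p])
  also have "\<dots> = c * enn2real (\<integral>\<^sup>+t. ennreal ((1 - t\<^sup>2) ^ k) * ennreal (?h t) \<partial>W)"
    unfolding nn_ball_energy[OF p] c_def[symmetric] W_def[symmetric] pot(2) using c by (simp add: enn2real_mult)
  also have "(\<integral>\<^sup>+t. ennreal ((1 - t\<^sup>2) ^ k) * ennreal (?h t) \<partial>W) = (\<integral>\<^sup>+t. ennreal (?h t * (1 - t\<^sup>2) ^ k) \<partial>W)"
  proof (rule nn_integral_cong_AE)
    show "AE t in W. ennreal ((1 - t\<^sup>2) ^ k) * ennreal (?h t) = ennreal (?h t * (1 - t\<^sup>2) ^ k)"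
      using AE_slice_measure[of "CARD('n)"] unfolding W_def[symmetric]
    proof eventually_elim
      case (elim t)
      show ?case using slice_power_bounds(1)[OF elim, of k] pot(3)[of t m] by (subst mult.commute, subst ennreal_mult) auto
    qed
  qed
  also have "enn2real \<dots> = (\<integral>t. ?h t * (1 - t\<^sup>2) ^ k \<partial>W)"
  proof (rule integral_eq_nn_integral[symmetric])
    show "AE t in W. 0 \<le> ?h t * (1 - t\<^sup>2) ^ k"
      using AE_slice_measure[of "CARD('n)"] unfolding W_def[symmetric]
      by eventually_elim (simp add: slice_power_bounds pot(3))
    show "(\<lambda>t. ?h t * (1 - t\<^sup>2) ^ k) \<in> borel_measurable W"
      using hm by (intro borel_measurable_times) (auto simp: W_def)
  qed
  finally show ?thesis by (simp add: c_def W_def)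
qed

text \<open>The coefficients may be negative, so the radial density on the ball with the prescribed marginal
  is signed.\<close>
lemma poly_slice_energy:
  fixes j :: "real ^ 'n \<Rightarrow> ell2" and P :: "real poly"
  assumes p: "0 < p" and norm: "\<And>x. x \<in> cball 0 1 \<Longrightarrow> norm (j x) = R"
    and dist: "\<And>x y. x \<in> cball 0 1 \<Longrightarrow> y \<in> cball 0 1 \<Longrightarrow> dist (j x) (j y) = dist x y powr (p / 2)"
  defines "W \<equiv> slice_measure CARD('n)"
  shows "proj_const p CARD('n) *
      (\<integral>t. (\<integral>s. \<bar>s - t\<bar> powr p * poly P (1 - s\<^sup>2) \<partial>W) * poly P (1 - t\<^sup>2) \<partial>W) \<le>
    2 * R\<^sup>2 * (\<integral>t. poly P (1 - t\<^sup>2) \<partial>W)\<^sup>2"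
proof -
  have n: "1 \<le> CARD('n)" by (simp add: Suc_leI)
  define b where "b m = marginal_const TYPE('n) m" for m
  have b: "b m \<noteq> 0" for m using marginal_const_pos[of m, where ?'n = 'n] by (simp add: b_def)
  define c where "c = proj_const p CARD('n)"
  define I where "I = {..degree P}"
  let ?M = "restrict_space borel (cball 0 1) :: (real ^ 'n) measure"
  let ?mu = "ball_measure :: nat \<Rightarrow> (real ^ 'n) measure"
  \<comment> \<open>Dividing by \<open>b m\<close> gives the \<open>m\<close>-th density exactly the
    marginal \<open>(1 - t^2)^m\<close>, so the combination has marginal density
    \<open>poly P (1 - t^2)\<close> with respect to \<open>W\<close>.\<close>
  interpret measure_family ?M I "\<lambda>m. coeff P m / b m" ?mu
    by (rule measure_family.intro) (simp_all add: finite_ball_measure)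
  have sp: "space ?M = cball 0 1" by (simp add: space_restrict_space)
  have cont: "continuous_on (cball 0 1) j"
    using p dist by (intro continuous_on_snowflake[of "p / 2"]) auto
  have E: "dist x y powr p = (dist (j x) (j y))\<^sup>2" if "x \<in> cball 0 1" "y \<in> cball 0 1" for x y
    using dist[OF that] by (simp add: power2_eq_square flip: powr_add)
  let ?g = "\<lambda>m y. \<integral>x. dist x y powr p \<partial>?mu m"
  define D where "D m k = (\<integral>t. (\<integral>s. \<bar>s - t\<bar> powr p * (1 - s\<^sup>2) ^ m \<partial>W) * (1 - t\<^sup>2) ^ k \<partial>W)" for m k
  have gD: "(\<integral>y. ?g m y \<partial>?mu k) = c * b m * b k * D m k" for m k
    unfolding D_def W_def b_def c_def by (rule ball_energy[OF p])
  have "comb_integral (\<lambda>y. comb_integral (\<lambda>x. dist x y powr p)) =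
      comb_integral (\<lambda>y. \<Sum>m\<in>I. coeff P m / b m * ?g m y)"
    by (simp add: comb_integral_def)
  also have "\<dots> = (\<Sum>m\<in>I. coeff P m / b m * comb_integral (?g m))"
    by (rule comb_integral_sum, rule integrable_bounded[OF finite_ball_measure measurable_ball_potential ball_potential(3)[OF p]]) simp
  also have "\<dots> = (\<Sum>m\<in>I. \<Sum>k\<in>I. c * (coeff P m * coeff P k * D m k))"
    unfolding comb_integral_def gD sum_distrib_left using b by (intro sum.cong refl) (simp add: field_simps)
  also have "\<dots> = c * (\<Sum>m\<in>I. \<Sum>k\<in>I. coeff P m * coeff P k * D m k)"
    by (simp add: sum_distrib_left)
  finally have lhs: "comb_integral (\<lambda>y. comb_integral (\<lambda>x. dist x y powr p)) =
      c * (\<Sum>m\<in>I. \<Sum>k\<in>I. coeff P m * coeff P k * D m k)" .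
  have poly: "poly P x = (\<Sum>m\<in>I. coeff P m * x ^ m)" for x
    by (simp add: poly_altdef I_def)
  have intz: "integrable W (\<lambda>t. (1 - t\<^sup>2) ^ m)" for m
    unfolding W_def using slice_power_bounds by (intro integrable_slice[OF n, where B = 1]) (auto simp: abs_of_nonneg)
  have "(\<Sum>m\<in>I. coeff P m / b m * measure (?mu m) (space ?M)) = (\<Sum>m\<in>I. coeff P m * (\<integral>t. (1 - t\<^sup>2) ^ m \<partial>W))"
    using b by (intro sum.cong refl) (simp add: sp measure_ball_measure b_def W_def)
  also have "\<dots> = (\<integral>t. poly P (1 - t\<^sup>2) \<partial>W)"
    using intz by (simp add: poly)
  finally have rhs: "(\<Sum>m\<in>I. coeff P m / b m * measure (?mu m) (space ?M)) = (\<integral>t. poly P (1 - t\<^sup>2) \<partial>W)" .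
  let ?h = "\<lambda>m t. \<integral>s. \<bar>s - t\<bar> powr p * (1 - s\<^sup>2) ^ m \<partial>W"
  have inner: "(\<integral>s. \<bar>s - t\<bar> powr p * poly P (1 - s\<^sup>2) \<partial>W) = (\<Sum>m\<in>I. coeff P m * ?h m t)" for t
  proof -
    have "(\<lambda>s. \<bar>s - t\<bar> powr p * poly P (1 - s\<^sup>2)) = (\<lambda>s. \<Sum>m\<in>I. coeff P m * (\<bar>s - t\<bar> powr p * (1 - s\<^sup>2) ^ m))"
      by (simp add: poly sum_distrib_left mult.left_commute)
    then show ?thesis using slice_potential(1)[OF p n] by (simp add: W_def)
  qed
  have inth: "integrable W (\<lambda>t. ?h m t * (1 - t\<^sup>2) ^ k)" for m k
  proof -
    have hm: "?h m \<in> borel_measurable borel"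
      unfolding W_def by (rule measurable_slice_potential[OF n]) measurable
    have hz: "(\<lambda>t. ?h m t * (1 - t\<^sup>2) ^ k) \<in> borel_measurable borel"
      by (rule borel_measurable_times[OF hm]) measurable
    have bd: "\<bar>?h m t * (1 - t\<^sup>2) ^ k\<bar> \<le> 2 powr p * measure W UNIV" if t: "t \<in> {-1..1}" for t
    proof -
      have "?h m t \<le> (\<integral>s. 2 powr p \<partial>W)"
        unfolding W_def
      proof (rule integral_mono_AE[OF slice_potential(1)[OF p n]])
        show "integrable (slice_measure CARD('n)) (\<lambda>s. 2 powr p)"
          by (rule finite_measure.integrable_const[OF finite_slice_measure[OF n]])
        show "AE s in slice_measure CARD('n). \<bar>s - t\<bar> powr p * (1 - s\<^sup>2) ^ m \<le> 2 powr p"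
          using AE_slice_measure[of "CARD('n)"]
        proof eventually_elim
          case (elim s)
          have "\<bar>s - t\<bar> powr p * (1 - s\<^sup>2) ^ m \<le> 2 powr p * 1"
            using elim t p slice_power_bounds[OF elim] by (intro mult_mono powr_mono2) auto
          then show ?case by simp
        qed
      qed
      also have "\<dots> = 2 powr p * measure W UNIV" by (simp add: W_def mult.commute)
      finally have "?h m t * (1 - t\<^sup>2) ^ k \<le> 2 powr p * measure W UNIV * 1"
        using slice_power_bounds[OF t] by (intro mult_mono) auto
      moreover have "0 \<le> ?h m t" unfolding W_def by (rule slice_potential(3)[OF p n])
      ultimately show ?thesis using slice_power_bounds(1)[OF t] by simp
    qed
    show ?thesis unfolding W_def
      by (rule integrable_slice[OF n hz[unfolded W_def] bd[unfolded W_def]])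
  qed
  have "(\<integral>t. (\<integral>s. \<bar>s - t\<bar> powr p * poly P (1 - s\<^sup>2) \<partial>W) * poly P (1 - t\<^sup>2) \<partial>W) =
      (\<integral>t. (\<Sum>m\<in>I. \<Sum>k\<in>I. coeff P m * coeff P k * (?h m t * (1 - t\<^sup>2) ^ k)) \<partial>W)"
    unfolding inner unfolding poly sum_product by (simp only: mult_ac)
  also have "\<dots> = (\<Sum>m\<in>I. \<Sum>k\<in>I. coeff P m * coeff P k * D m k)"
    using inth by (simp add: D_def)
  finally have eq: "(\<integral>t. (\<integral>s. \<bar>s - t\<bar> powr p * poly P (1 - s\<^sup>2) \<partial>W) * poly P (1 - t\<^sup>2) \<partial>W) =
      (\<Sum>m\<in>I. \<Sum>k\<in>I. coeff P m * coeff P k * D m k)" .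
  show ?thesis
    using sphere_energy_le[OF borel_measurable_ell2_nth[OF cont], unfolded sp, OF norm E]
    unfolding lhs rhs[unfolded sp] eq c_def .
qed

section \<open>Concentration at two points\<close>

text \<open>Laplace's principle: as \<open>N\<close> grows, \<open>(1 - q)^N\<close> puts its mass
  where \<open>q\<close> is small. The part with \<open>q > e / 2\<close> contributes at most a
  multiple of \<open>r2 ^ N\<close>, whereas the total is at least a multiple of
  \<open>r1 ^ N\<close> for a larger base \<open>r1\<close>.\<close>

lemma concentration_ratio:
  fixes q :: "'a \<Rightarrow> real"
  assumes M: "finite_measure M" and q: "q \<in> borel_measurable M" and q01: "AE x in M. 0 \<le> q x \<and> q x \<le> 1"
    and pos: "\<And>\<delta>. 0 < \<delta> \<Longrightarrow> 0 < measure M {x \<in> space M. q x < \<delta>}"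
  shows "0 < (\<integral>x. (1 - q x) ^ N \<partial>M)"
    and "(\<lambda>N. (\<integral>x. q x * (1 - q x) ^ N \<partial>M) / (\<integral>x. (1 - q x) ^ N \<partial>M)) \<longlonglongrightarrow> 0"
proof -
  interpret finite_measure M by (rule M)
  note [measurable] = q
  let ?Z = "\<lambda>N. \<integral>x. (1 - q x) ^ N \<partial>M" and ?m = "\<lambda>N. \<integral>x. q x * (1 - q x) ^ N \<partial>M"
  define T where "T = measure M (space M)"
  have int1: "integrable M (\<lambda>x. (1 - q x) ^ N)" for N
  proof (rule integrable_const_bound[where B = 1])
    show "AE x in M. norm ((1 - q x) ^ N) \<le> 1" using q01 by eventually_elim (auto simp: power_le_one)
  qed measurable
  have int2: "integrable M (\<lambda>x. q x * (1 - q x) ^ N)" for N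
  proof (rule integrable_const_bound[where B = 1])
    show "AE x in M. norm (q x * (1 - q x) ^ N) \<le> 1"
      using q01 by eventually_elim (auto simp: power_le_one abs_mult intro!: mult_le_one)
  qed measurable
  have Zlow: "(1 - d) ^ N * measure M {x \<in> space M. q x < d} \<le> ?Z N" if d: "0 < d" "d \<le> 1" for d N
  proof -
    have "(1 - d) ^ N * measure M {x \<in> space M. q x < d} =
        (\<integral>x. (1 - d) ^ N * indicator {x \<in> space M. q x < d} x \<partial>M)"
      by simp
    also have "\<dots> \<le> ?Z N"
    proof (rule integral_mono_AE[OF _ int1])
      show "integrable M (\<lambda>x. (1 - d) ^ N * indicator {x \<in> space M. q x < d} x)"
        by (intro integrable_mult_right integrable_real_indicator) (auto simp: emeasure_eq_measure)
      show "AE x in M. (1 - d) ^ N * indicator {x \<in> space M. q x < d} x \<le> (1 - q x) ^ N"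
        using q01
      proof eventually_elim
        case (elim x)
        then show ?case using d by (auto simp: indicator_def intro!: power_mono)
      qed
    qed
    finally show ?thesis .
  qed
  show Z: "0 < ?Z N" for N
  proof -
    have "0 < (1 - 1 / 2) ^ N * measure M {x \<in> space M. q x < 1 / 2}"
      by (intro mult_pos_pos zero_less_power pos) auto
    also have "\<dots> \<le> ?Z N" by (rule Zlow) auto
    finally show ?thesis .
  qed
  have m0: "0 \<le> ?m N" for N
  proof (rule integral_nonneg_AE)
    show "AE x in M. 0 \<le> q x * (1 - q x) ^ N" using q01 by eventually_elim auto
  qed
  show "(\<lambda>N. ?m N / ?Z N) \<longlonglongrightarrow> 0"
  proof (rule tendstoI)
    fix \<epsilon> :: real assume \<epsilon>: "0 < \<epsilon>"
    \<comment> \<open>Capping by 1 keeps both bases below positive.\<close>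
    define e where "e = min \<epsilon> 1"
    have e: "0 < e" "e \<le> 1" "e \<le> \<epsilon>" using \<epsilon> by (auto simp: e_def)
    define r1 r2 where "r1 = 1 - e / 4" and "r2 = 1 - e / 2"
    have r: "0 < r1" "0 < r2" "r2 < r1" using e by (auto simp: r1_def r2_def)
    define w where "w = measure M {x \<in> space M. q x < e / 4}"
    have w: "0 < w" unfolding w_def using e by (intro pos) simp
    have up: "?m N \<le> e / 2 * ?Z N + r2 ^ N * T" for N
    proof -
      have "?m N \<le> (\<integral>x. e / 2 * (1 - q x) ^ N + r2 ^ N \<partial>M)"
      proof (rule integral_mono_AE[OF int2])
        show "integrable M (\<lambda>x. e / 2 * (1 - q x) ^ N + r2 ^ N)"
          by (intro Bochner_Integration.integrable_add integrable_mult_right int1 integrable_const)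
        show "AE x in M. q x * (1 - q x) ^ N \<le> e / 2 * (1 - q x) ^ N + r2 ^ N"
          using q01
        proof eventually_elim
          case (elim x)
          show ?case
          proof (cases "q x \<le> e / 2")
            case True
            then have "q x * (1 - q x) ^ N \<le> e / 2 * (1 - q x) ^ N" using elim by (intro mult_right_mono) auto
            moreover have "0 \<le> r2 ^ N" using r by simp
            ultimately show ?thesis by linarith
          next
            case False
            have "q x * (1 - q x) ^ N \<le> 1 * r2 ^ N"
              using elim False r by (intro mult_mono power_mono) (auto simp: r2_def)
            moreover have "0 \<le> e / 2 * (1 - q x) ^ N" using elim e by simp
            ultimately show ?thesis by linarith
          qed
        qed
      qed
      also have "\<dots> = e / 2 * ?Z N + r2 ^ N * T" using int1 by (simp add: T_def mult.commute)
      finally show ?thesis .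
    qed
    have bound: "?m N / ?Z N \<le> e / 2 + (r2 / r1) ^ N * (T / w)" for N
    proof -
      have low: "r1 ^ N * w \<le> ?Z N" unfolding r1_def w_def using e by (intro Zlow) auto
      have "?m N / ?Z N \<le> (e / 2 * ?Z N + r2 ^ N * T) / ?Z N"
        using up[of N] Z[of N] by (intro divide_right_mono) auto
      also have "\<dots> = e / 2 + r2 ^ N * T / ?Z N" using Z[of N] by (simp add: add_divide_distrib)
      also have "r2 ^ N * T / ?Z N \<le> r2 ^ N * T / (r1 ^ N * w)"
        using low r w Z[of N] by (intro divide_left_mono mult_pos_pos) (auto simp: T_def)
      also have "\<dots> = (r2 / r1) ^ N * (T / w)" by (simp add: power_divide)
      finally show ?thesis by simp
    qed
    have "(\<lambda>N. e / 2 + (r2 / r1) ^ N * (T / w)) \<longlonglongrightarrow> e / 2 + 0 * (T / w)"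
      using r by (intro tendsto_intros LIMSEQ_power_zero) auto
    moreover have "e / 2 + 0 * (T / w) < \<epsilon>" using e by simp
    ultimately have "eventually (\<lambda>N. e / 2 + (r2 / r1) ^ N * (T / w) < \<epsilon>) sequentially"
      by (rule order_tendstoD(2))
    then show "eventually (\<lambda>N. dist (?m N / ?Z N) 0 < \<epsilon>) sequentially"
    proof eventually_elim
      case (elim N)
      have "0 \<le> ?m N / ?Z N" using m0[of N] Z[of N] by simp
      then show ?case using bound[of N] elim by (simp only: dist_0_norm dist_commute[of _ 0] real_norm_def)
    qed
  qed
qed

text \<open>It vanishes exactly at \<open>t = u\<close> and \<open>t = -u\<close>, takes values in
  \<open>[0, 1]\<close> for arguments in \<open>[-1, 1]\<close>, and is a polynomial in
  \<open>1 - t^2\<close>, as the lift to the ball requires.\<close>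

definition sqdist :: "real \<Rightarrow> real \<Rightarrow> real" where "sqdist u t = (t\<^sup>2 - u\<^sup>2)\<^sup>2"

lemma sqdist_01:
  assumes "u \<in> {-1..1}" "t \<in> {-1..1}"
  shows "0 \<le> sqdist u t" "sqdist u t \<le> 1"
proof -
  have "u\<^sup>2 \<le> 1" "t\<^sup>2 \<le> 1" using assms by (auto simp: abs_square_le_1 abs_le_iff)
  then have "\<bar>t\<^sup>2 - u\<^sup>2\<bar> \<le> 1" using zero_le_power2[of u] zero_le_power2[of t] by linarith
  then show "sqdist u t \<le> 1" unfolding sqdist_def by (simp add: abs_square_le_1)
qed (simp add: sqdist_def)

lemma slice_measure_sqdist_pos:
  assumes n: "1 \<le> n" and u: "u \<in> {-1<..<1}" and \<delta>: "0 < \<delta>"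
  shows "0 < measure (slice_measure n) {t \<in> space (slice_measure n). sqdist u t < \<delta>}"
proof -
  interpret finite_measure "slice_measure n" by (rule finite_slice_measure[OF n])
  let ?S = "{t. sqdist u t < \<delta>}"
  have "continuous_on UNIV (sqdist u)" unfolding sqdist_def by (intro continuous_intros)
  then have "open {t. sqdist u t < \<delta>}" by (intro open_Collect_less) (auto intro: continuous_intros)
  \<comment> \<open>Inside the open interval the density of the slice measure is strictly
    positive.\<close>
  then have "open (?S \<inter> {-1<..<1})" by (intro open_Int) auto
  moreover have "u \<in> ?S \<inter> {-1<..<1}" using u \<delta> by (simp add: sqdist_def)
  ultimately obtain e where e: "0 < e" "cball u e \<subseteq> ?S \<inter> {-1<..<1}"
    by (meson open_contains_cball)
  have "measure (slice_measure n) ?S \<noteq> 0"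
  proof
    assume "measure (slice_measure n) ?S = 0"
    then have "emeasure (slice_measure n) ?S = 0" by (simp add: emeasure_eq_measure)
    have S [measurable]: "?S \<in> sets borel" by (rule borel_open) fact
    have "AE t in lborel. t \<in> ?S \<longrightarrow> ennreal (indicator {-1..1} t * (1 - t\<^sup>2) powr ((real n - 1) / 2)) = 0"
    proof -
      have "?S \<in> null_sets (slice_measure n)"
        using \<open>emeasure (slice_measure n) ?S = 0\<close> S by (simp add: null_sets_def)
      then show ?thesis
        unfolding slice_measure_def
        by (subst (asm) null_sets_density_iff) auto
    qed
    then have "AE t in lborel. t \<notin> cball u e"
    proof eventually_elim
      case (elim t)
      show ?case
      proof
        assume "t \<in> cball u e"
        then have t: "t \<in> ?S" "\<bar>t\<bar> < 1" using e(2) by (auto simp: abs_less_iff)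
        then have "0 < 1 - t\<^sup>2" by (simp add: abs_square_less_1)
        then have "0 < (1 - t\<^sup>2) powr ((real n - 1) / 2)" by simp
        moreover have "t \<in> {-1..1}" using t by auto
        ultimately show False using elim t(1) by simp
      qed
    qed
    then have "emeasure lborel (cball u e) = 0"
      by (subst (asm) AE_iff_measurable[of "cball u e"]) auto
    then show False using e(1) by (simp add: emeasure_cball)
  qed
  then show ?thesis by (simp add: zero_less_measure_iff)
qed

text \<open>The mutual energy of the pairs \<open>s\<close>, \<open>-s\<close> and \<open>t\<close>,
  \<open>-t\<close> with mass 1/2 at each point.\<close>

definition sym_kernel :: "real \<Rightarrow> real \<Rightarrow> real \<Rightarrow> real" where
  "sym_kernel p s t = (\<bar>s - t\<bar> powr p + \<bar>s + t\<bar> powr p) / 2"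

lemma sym_kernel_abs: "sym_kernel p s t = sym_kernel p \<bar>s\<bar> \<bar>t\<bar>"
proof -
  consider "0 \<le> s" "0 \<le> t" | "0 \<le> s" "t < 0" | "s < 0" "0 \<le> t" | "s < 0" "t < 0" by linarith
  then show ?thesis
  proof cases
    case 1 then show ?thesis by simp
  next
    case 2 then show ?thesis by (simp add: sym_kernel_def add.commute)
  next
    case 3
    then have "\<bar>s - t\<bar> = \<bar>\<bar>s\<bar> + \<bar>t\<bar>\<bar>" "\<bar>s + t\<bar> = \<bar>\<bar>s\<bar> - \<bar>t\<bar>\<bar>" by auto
    then show ?thesis by (simp add: sym_kernel_def add.commute)
  next
    case 4
    then have "\<bar>s - t\<bar> = \<bar>\<bar>s\<bar> - \<bar>t\<bar>\<bar>" "\<bar>s + t\<bar> = \<bar>\<bar>s\<bar> + \<bar>t\<bar>\<bar>" by auto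
    then show ?thesis by (simp add: sym_kernel_def)
  qed
qed

lemma sym_kernel_bounds:
  assumes p: "0 < p" and "s \<in> {-1..1}" "t \<in> {-1..1}"
  shows "0 \<le> sym_kernel p s t" "sym_kernel p s t \<le> 2 powr p"
proof -
  have "\<bar>s - t\<bar> powr p \<le> 2 powr p" "\<bar>s + t\<bar> powr p \<le> 2 powr p"
    using assms by (auto intro!: powr_mono2)
  then show "sym_kernel p s t \<le> 2 powr p" by (simp add: sym_kernel_def)
qed (simp add: sym_kernel_def)

text \<open>Being even in each variable, \<open>sym_kernel\<close> is a continuous function of the
  squares, and \<open>sqdist u s + sqdist v t\<close> is the squared distance of
  \<open>(s^2, t^2)\<close> from \<open>(u^2, v^2)\<close>. Away from that point \<open>D\<close>
  lets the distance absorb the whole oscillation. An error of this form can be integrated against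
  the bumps.\<close>

lemma sym_kernel_close:
  assumes p: "0 < p" and u: "u \<in> {-1..1}" and v: "v \<in> {-1..1}" and \<epsilon>: "0 < \<epsilon>"
  obtains D where "0 \<le> D" and "\<And>s t. s \<in> {-1..1} \<Longrightarrow> t \<in> {-1..1} \<Longrightarrow>
    \<bar>sym_kernel p s t - sym_kernel p u v\<bar> \<le> \<epsilon> + D * (sqdist u s + sqdist v t)"
proof -
  let ?\<psi> = "\<lambda>z :: real \<times> real. sym_kernel p (sqrt (fst z)) (sqrt (snd z))"
  have c: "continuous_on (UNIV :: (real \<times> real) set) (\<lambda>z. \<bar>sqrt (fst z) - sqrt (snd z)\<bar>)"
    "continuous_on (UNIV :: (real \<times> real) set) (\<lambda>z. \<bar>sqrt (fst z) + sqrt (snd z)\<bar>)"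
    by (intro continuous_intros)+
  have "continuous_on UNIV ?\<psi>"
    unfolding sym_kernel_def
    by (intro continuous_on_divide continuous_on_add continuous_on_const
        continuous_on_powr'[OF c(1) continuous_on_const] continuous_on_powr'[OF c(2) continuous_on_const]) (use p in auto)
  then have "isCont ?\<psi> (u\<^sup>2, v\<^sup>2)" by (simp add: continuous_on_eq_continuous_at)
  then obtain \<delta> where \<delta>: "0 < \<delta>" "\<And>z. dist z (u\<^sup>2, v\<^sup>2) < \<delta> \<Longrightarrow> dist (?\<psi> z) (?\<psi> (u\<^sup>2, v\<^sup>2)) < \<epsilon>"
    using \<epsilon> unfolding continuous_at_eps_delta by (metis dist_commute)
  have \<psi>: "?\<psi> (s\<^sup>2, t\<^sup>2) = sym_kernel p s t" for s t by (simp add: sym_kernel_abs[of p s t])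
  define D where "D = 2 powr p / \<delta>\<^sup>2"
  have D: "0 \<le> D" by (simp add: D_def)
  show ?thesis
  proof (rule that[OF D])
    fix s t :: real assume st: "s \<in> {-1..1}" "t \<in> {-1..1}"
    have d2: "(dist (s\<^sup>2, t\<^sup>2) (u\<^sup>2, v\<^sup>2))\<^sup>2 = sqdist u s + sqdist v t"
      by (simp add: dist_prod_def dist_real_def sqdist_def)
    have nn: "0 \<le> D * (sqdist u s + sqdist v t)" using D by (simp add: sqdist_def)
    show "\<bar>sym_kernel p s t - sym_kernel p u v\<bar> \<le> \<epsilon> + D * (sqdist u s + sqdist v t)"
    proof (cases "dist (s\<^sup>2, t\<^sup>2) (u\<^sup>2, v\<^sup>2) < \<delta>")
      case True
      from \<delta>(2)[OF this] show ?thesis using nn unfolding \<psi> dist_real_def by linarith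
    next
      case False
      then have "\<delta>\<^sup>2 \<le> sqdist u s + sqdist v t"
        unfolding d2[symmetric] using \<delta>(1) by (intro power_mono) auto
      then have "D * \<delta>\<^sup>2 \<le> D * (sqdist u s + sqdist v t)" using D by (rule mult_left_mono)
      moreover have "D * \<delta>\<^sup>2 = 2 powr p" using \<delta>(1) by (simp add: D_def)
      moreover have "\<bar>sym_kernel p s t - sym_kernel p u v\<bar> \<le> 2 powr p"
        using sym_kernel_bounds[OF p st] sym_kernel_bounds[OF p u v] by linarith
      ultimately show ?thesis using \<epsilon> by linarith
    qed
  qed
qed

text \<open>The bump \<open>(1 - sqdist u t)^N\<close> stands in for a pair of point masses at
  \<open>u\<close> and \<open>-u\<close>. Its mass is used for normalisation, and
  \<open>bump_defect\<close> measures how far the bump is from being concentrated there.\<close>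

definition bump_mass :: "nat \<Rightarrow> nat \<Rightarrow> real \<Rightarrow> real" where
  "bump_mass n N u = (\<integral>t. (1 - sqdist u t) ^ N \<partial>slice_measure n)"

definition bump_defect :: "nat \<Rightarrow> nat \<Rightarrow> real \<Rightarrow> real" where
  "bump_defect n N u = (\<integral>t. sqdist u t * (1 - sqdist u t) ^ N \<partial>slice_measure n)"

definition bump_energy :: "nat \<Rightarrow> nat \<Rightarrow> (real \<Rightarrow> real \<Rightarrow> real) \<Rightarrow> real \<Rightarrow> real \<Rightarrow> real" where
  "bump_energy n N F u v =
    (\<integral>t. (\<integral>s. F s t * (1 - sqdist u s) ^ N \<partial>slice_measure n) * (1 - sqdist v t) ^ N \<partial>slice_measure n)"

lemma borel_measurable_sqdist [measurable]: "sqdist u \<in> borel_measurable borel"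
  unfolding sqdist_def by measurable

lemma bump_01:
  assumes "u \<in> {-1..1}" "t \<in> {-1..1}"
  shows "0 \<le> (1 - sqdist u t) ^ N" "(1 - sqdist u t) ^ N \<le> 1"
  using sqdist_01[OF assms] by (auto simp: power_le_one)

lemma bump_ratio:
  assumes n: "1 \<le> n" and u: "u \<in> {-1<..<1}"
  shows "0 < bump_mass n N u" and "(\<lambda>N. bump_defect n N u / bump_mass n N u) \<longlonglongrightarrow> 0"
proof -
  have q: "sqdist u \<in> borel_measurable (slice_measure n)" by simp
  have "u \<in> {-1..1}" using u by auto
  have "AE t in slice_measure n. 0 \<le> sqdist u t \<and> sqdist u t \<le> 1"
    using AE_slice_measure[of n]
  proof eventually_elim
    case (elim t)
    show ?case using sqdist_01[OF \<open>u \<in> {-1..1}\<close> elim] by simp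
  qed
  note conc = concentration_ratio[OF finite_slice_measure[OF n] q this slice_measure_sqdist_pos[OF n u]]
  show "0 < bump_mass n N u" "(\<lambda>N. bump_defect n N u / bump_mass n N u) \<longlonglongrightarrow> 0"
    using conc by (simp_all add: bump_mass_def bump_defect_def)
qed

lemma integrable_bump:
  assumes n: "1 \<le> n" and u: "u \<in> {-1..1}" and F: "F \<in> borel_measurable borel"
    and bd: "\<And>s. s \<in> {-1..1} \<Longrightarrow> \<bar>F s\<bar> \<le> B"
  shows "integrable (slice_measure n) (\<lambda>s. F s * (1 - sqdist u s) ^ N)"
proof (rule integrable_slice[OF n, where B = B])
  show "(\<lambda>s. F s * (1 - sqdist u s) ^ N) \<in> borel_measurable borel" using F by measurable
  fix s :: real assume s: "s \<in> {-1..1}"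
  have "\<bar>F s\<bar> * (1 - sqdist u s) ^ N \<le> B * 1"
    using bd[OF s] bump_01[OF u s] by (intro mult_mono) auto
  then show "\<bar>F s * (1 - sqdist u s) ^ N\<bar> \<le> B" using bump_01[OF u s] by (simp add: abs_mult)
qed

lemma integrable_bump_outer:
  assumes n: "1 \<le> n" and u: "u \<in> {-1..1}" and v: "v \<in> {-1..1}"
    and F: "(\<lambda>z. F (fst z) (snd z)) \<in> borel_measurable (borel \<Otimes>\<^sub>M borel)"
    and bd: "\<And>s t. s \<in> {-1..1} \<Longrightarrow> t \<in> {-1..1} \<Longrightarrow> \<bar>F s t\<bar> \<le> B"
  shows "integrable (slice_measure n) (\<lambda>t. (\<integral>s. F s t * (1 - sqdist u s) ^ N \<partial>slice_measure n) * (1 - sqdist v t) ^ N)"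
    and "\<And>t. t \<in> {-1..1} \<Longrightarrow> integrable (slice_measure n) (\<lambda>s. F s t * (1 - sqdist u s) ^ N)"
proof -
  interpret finite_measure "slice_measure n" by (rule finite_slice_measure[OF n])
  have Ft: "(\<lambda>s. F s t) \<in> borel_measurable borel" for t
    using measurable_compose[OF measurable_Pair2'[of t borel borel] F] by simp
  show int: "integrable (slice_measure n) (\<lambda>s. F s t * (1 - sqdist u s) ^ N)" if "t \<in> {-1..1}" for t
    using that bd by (intro integrable_bump[OF n u Ft]) auto
  let ?h = "\<lambda>t. \<integral>s. F s t * (1 - sqdist u s) ^ N \<partial>slice_measure n"
  have sw: "(\<lambda>(t, s). F s t * (1 - sqdist u s) ^ N) \<in> borel_measurable (borel \<Otimes>\<^sub>M slice_measure n)"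
  proof -
    have swap: "(\<lambda>z. (snd z, fst z)) \<in> measurable (borel \<Otimes>\<^sub>M slice_measure n) (borel \<Otimes>\<^sub>M borel :: (real \<times> real) measure)"
      by measurable
    have [measurable]: "(\<lambda>z. F (snd z) (fst z)) \<in> borel_measurable (borel \<Otimes>\<^sub>M slice_measure n)"
      using measurable_compose[OF swap F] by simp
    show ?thesis unfolding case_prod_beta by measurable
  qed
  have hm: "?h \<in> borel_measurable borel"
    by (rule borel_measurable_lebesgue_integral[OF sw])
  have hb: "\<bar>?h t\<bar> \<le> B * measure (slice_measure n) UNIV" if t: "t \<in> {-1..1}" for t
  proof -
    have "\<bar>?h t\<bar> \<le> (\<integral>s. \<bar>F s t * (1 - sqdist u s) ^ N\<bar> \<partial>slice_measure n)" by (rule integral_abs_bound)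
    also have "\<dots> \<le> (\<integral>s. B \<partial>slice_measure n)"
    proof (rule integral_mono_AE[OF integrable_abs[OF int[OF t]] integrable_const])
      show "AE s in slice_measure n. \<bar>F s t * (1 - sqdist u s) ^ N\<bar> \<le> B"
        using AE_slice_measure[of n]
      proof eventually_elim
        case (elim s)
        have "\<bar>F s t\<bar> * (1 - sqdist u s) ^ N \<le> B * 1"
          using bd[OF elim t] bump_01[OF u elim] by (intro mult_mono) auto
        then show ?case using bump_01[OF u elim] by (simp add: abs_mult)
      qed
    qed
    finally show ?thesis by (simp add: mult.commute)
  qed
  show "integrable (slice_measure n) (\<lambda>t. ?h t * (1 - sqdist v t) ^ N)"
    by (rule integrable_bump[OF n v hm hb])
qed

text \<open>The error is a term in \<open>s\<close> plus a term in \<open>t\<close>, so its double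
  integral splits into products of masses and defects. The bound is one-sided; applied to the
  negated kernel it also gives the lower estimate.\<close>

lemma bump_energy_upper:
  assumes n: "1 \<le> n" and u: "u \<in> {-1..1}" and v: "v \<in> {-1..1}"
    and F: "(\<lambda>z. F (fst z) (snd z)) \<in> borel_measurable (borel \<Otimes>\<^sub>M borel)"
    and bd: "\<And>s t. s \<in> {-1..1} \<Longrightarrow> t \<in> {-1..1} \<Longrightarrow> \<bar>F s t\<bar> \<le> B"
    and le: "\<And>s t. s \<in> {-1..1} \<Longrightarrow> t \<in> {-1..1} \<Longrightarrow> F s t \<le> L + D * (sqdist u s + sqdist v t)"
  shows "bump_energy n N F u v \<le> L * bump_mass n N u * bump_mass n N v +
    D * (bump_defect n N u * bump_mass n N v + bump_mass n N u * bump_defect n N v)"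
proof -
  let ?W = "slice_measure n"
  let ?b = "\<lambda>u s. (1 - sqdist u s) ^ N"
  have ib: "integrable ?W (?b w)" if "w \<in> {-1..1}" for w
    using integrable_bump[OF n that, of "\<lambda>_. 1" 1] by simp
  have iq: "integrable ?W (\<lambda>s. sqdist w s * ?b w s)" if "w \<in> {-1..1}" for w
    using that sqdist_01[OF that] by (intro integrable_bump[OF n that, where B = 1]) auto
  note outer = integrable_bump_outer[OF n u v F bd]
  have inner: "(\<integral>s. F s t * ?b u s \<partial>?W) \<le> (L + D * sqdist v t) * bump_mass n N u + D * bump_defect n N u"
    if t: "t \<in> {-1..1}" for t
  proof -
    have "(\<integral>s. F s t * ?b u s \<partial>?W) \<le> (\<integral>s. (L + D * sqdist v t) * ?b u s + D * (sqdist u s * ?b u s) \<partial>?W)"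
    proof (rule integral_mono_AE[OF outer(2)[OF _ _ t]])
      show "integrable ?W (\<lambda>s. (L + D * sqdist v t) * ?b u s + D * (sqdist u s * ?b u s))"
        using ib[OF u] iq[OF u] by (intro Bochner_Integration.integrable_add integrable_mult_right)
      show "AE s in ?W. F s t * ?b u s \<le> (L + D * sqdist v t) * ?b u s + D * (sqdist u s * ?b u s)"
        using AE_slice_measure[of n]
      proof eventually_elim
        case (elim s)
        have "F s t * ?b u s \<le> (L + D * (sqdist u s + sqdist v t)) * ?b u s"
          using le[OF elim t] bump_01[OF u elim] by (intro mult_right_mono) auto
        then show ?case by (simp add: algebra_simps)
      qed
    qed
    then show ?thesis using ib[OF u] iq[OF u] by (simp add: bump_mass_def bump_defect_def)
  qed
  have "bump_energy n N F u v \<le> (\<integral>t. (L * bump_mass n N u + D * bump_defect n N u) * ?b v t +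
      D * bump_mass n N u * (sqdist v t * ?b v t) \<partial>?W)"
    unfolding bump_energy_def
  proof (rule integral_mono_AE[OF outer(1)])
    show "integrable ?W (\<lambda>t. (L * bump_mass n N u + D * bump_defect n N u) * ?b v t + D * bump_mass n N u * (sqdist v t * ?b v t))"
      using ib[OF v] iq[OF v] by (intro Bochner_Integration.integrable_add integrable_mult_right)
    show "AE t in ?W. (\<integral>s. F s t * ?b u s \<partial>?W) * ?b v t \<le>
        (L * bump_mass n N u + D * bump_defect n N u) * ?b v t + D * bump_mass n N u * (sqdist v t * ?b v t)"
      using AE_slice_measure[of n]
    proof eventually_elim
      case (elim t)
      have "(\<integral>s. F s t * ?b u s \<partial>?W) * ?b v t \<le> ((L + D * sqdist v t) * bump_mass n N u + D * bump_defect n N u) * ?b v t"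
        using inner[OF elim] bump_01[OF v elim] by (intro mult_right_mono) auto
      then show ?case by (simp add: algebra_simps)
    qed
  qed
  also have "\<dots> = (L * bump_mass n N u + D * bump_defect n N u) * bump_mass n N v + D * bump_mass n N u * bump_defect n N v"
    using ib[OF v] iq[OF v] by (simp add: bump_mass_def bump_defect_def)
  finally show ?thesis by (simp add: algebra_simps)
qed

lemma measurable_sym_kernel:
  "(\<lambda>z. sym_kernel p (fst z) (snd z)) \<in> borel_measurable (borel \<Otimes>\<^sub>M borel)"
  unfolding sym_kernel_def by measurable

lemma bump_energy_uminus: "bump_energy n N (\<lambda>s t. - F s t) u v = - bump_energy n N F u v"
  by (simp add: bump_energy_def)

text \<open>After division by the masses the error is half of the tolerance plus a multiple of the
  two defect ratios, which tend to 0.\<close>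

lemma bump_energy_tendsto:
  assumes p: "0 < p" and n: "1 \<le> n" and u: "u \<in> {-1<..<1}" and v: "v \<in> {-1<..<1}"
  shows "(\<lambda>N. bump_energy n N (sym_kernel p) u v / (bump_mass n N u * bump_mass n N v)) \<longlonglongrightarrow> sym_kernel p u v"
proof (rule tendstoI)
  fix \<epsilon> :: real assume \<epsilon>: "0 < \<epsilon>"
  have uv: "u \<in> {-1..1}" "v \<in> {-1..1}" using u v by auto
  define L where "L = sym_kernel p u v"
  obtain D where D: "0 \<le> D" "\<And>s t. s \<in> {-1..1} \<Longrightarrow> t \<in> {-1..1} \<Longrightarrow>
      \<bar>sym_kernel p s t - L\<bar> \<le> \<epsilon> / 2 + D * (sqdist u s + sqdist v t)"
    using sym_kernel_close[OF p uv, of "\<epsilon> / 2"] \<epsilon> unfolding L_def by (metis half_gt_zero)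
  have bd: "\<bar>sym_kernel p s t\<bar> \<le> 2 powr p" "\<bar>- sym_kernel p s t\<bar> \<le> 2 powr p" if "s \<in> {-1..1}" "t \<in> {-1..1}" for s t
    using sym_kernel_bounds[OF p that] by auto
  let ?Z = "bump_mass n" and ?m = "bump_defect n"
  let ?E = "\<lambda>N. bump_energy n N (sym_kernel p) u v"
  have diff: "\<bar>?E N / (?Z N u * ?Z N v) - L\<bar> \<le> \<epsilon> / 2 + D * (?m N u / ?Z N u + ?m N v / ?Z N v)" for N
  proof -
    note Z = bump_ratio(1)[OF n u, of N] bump_ratio(1)[OF n v, of N]
    let ?R = "D * (?m N u * ?Z N v + ?Z N u * ?m N v)"
    have up: "?E N \<le> (L + \<epsilon> / 2) * ?Z N u * ?Z N v + ?R"
    proof (rule bump_energy_upper[OF n uv measurable_sym_kernel bd(1)])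
      fix s t :: real assume "s \<in> {-1..1}" "t \<in> {-1..1}"
      from D(2)[OF this] show "sym_kernel p s t \<le> L + \<epsilon> / 2 + D * (sqdist u s + sqdist v t)" by linarith
    qed
    have "bump_energy n N (\<lambda>s t. - sym_kernel p s t) u v \<le> (- L + \<epsilon> / 2) * ?Z N u * ?Z N v + ?R"
    proof (rule bump_energy_upper[OF n uv _ bd(2)])
      show "(\<lambda>z. - sym_kernel p (fst z) (snd z)) \<in> borel_measurable (borel \<Otimes>\<^sub>M borel)"
        by (rule borel_measurable_uminus[OF measurable_sym_kernel])
      fix s t :: real assume "s \<in> {-1..1}" "t \<in> {-1..1}"
      from D(2)[OF this] show "- sym_kernel p s t \<le> - L + \<epsilon> / 2 + D * (sqdist u s + sqdist v t)" by linarith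
    qed
    then have lo: "- ?E N \<le> (- L + \<epsilon> / 2) * ?Z N u * ?Z N v + ?R" by (simp only: bump_energy_uminus)
    have ZZ: "0 < ?Z N u * ?Z N v" using Z by simp
    have "\<bar>?E N - L * (?Z N u * ?Z N v)\<bar> \<le> \<epsilon> / 2 * (?Z N u * ?Z N v) + ?R"
      using up lo by (simp add: abs_le_iff algebra_simps)
    then have "\<bar>?E N - L * (?Z N u * ?Z N v)\<bar> / (?Z N u * ?Z N v) \<le>
        (\<epsilon> / 2 * (?Z N u * ?Z N v) + ?R) / (?Z N u * ?Z N v)"
      using ZZ by (intro divide_right_mono) auto
    moreover have "\<bar>?E N - L * (?Z N u * ?Z N v)\<bar> / (?Z N u * ?Z N v) = \<bar>?E N / (?Z N u * ?Z N v) - L\<bar>"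
    proof -
      have "?E N / (?Z N u * ?Z N v) - L = (?E N - L * (?Z N u * ?Z N v)) / (?Z N u * ?Z N v)"
        using Z by (simp add: diff_divide_distrib)
      then show ?thesis using ZZ by (simp only: abs_divide abs_of_pos)
    qed
    moreover have "(\<epsilon> / 2 * (?Z N u * ?Z N v) + ?R) / (?Z N u * ?Z N v) = \<epsilon> / 2 + D * (?m N u / ?Z N u + ?m N v / ?Z N v)"
      using Z by (simp add: add_divide_distrib distrib_left)
    ultimately show ?thesis by simp
  qed
  have "(\<lambda>N. \<epsilon> / 2 + D * (?m N u / ?Z N u + ?m N v / ?Z N v)) \<longlonglongrightarrow> \<epsilon> / 2 + D * (0 + 0)"
    by (intro tendsto_intros bump_ratio(2)[OF n u] bump_ratio(2)[OF n v])
  moreover have "\<epsilon> / 2 + D * (0 + 0) < \<epsilon>" using \<epsilon> by simp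
  ultimately have "eventually (\<lambda>N. \<epsilon> / 2 + D * (?m N u / ?Z N u + ?m N v / ?Z N v) < \<epsilon>) sequentially"
    by (rule order_tendstoD(2))
  then show "eventually (\<lambda>N. dist (?E N / (?Z N u * ?Z N v)) (sym_kernel p u v) < \<epsilon>) sequentially"
  proof eventually_elim
    case (elim N)
    then show ?case using diff[of N] unfolding dist_real_def L_def[symmetric] by linarith
  qed
qed

lemma integral_slice_reflect:
  fixes f :: "real \<Rightarrow> real"
  assumes [measurable]: "f \<in> borel_measurable borel"
  shows "(\<integral>t. f (- t) \<partial>slice_measure n) = (\<integral>t. f t \<partial>slice_measure n)"
proof -
  let ?w = "\<lambda>t. indicator {-1..1} t * (1 - t\<^sup>2) powr ((real n - 1) / 2)"
  have eq: "(\<integral>t. g t \<partial>slice_measure n) = (\<integral>t. ?w t *\<^sub>R g t \<partial>lborel)" if "g \<in> borel_measurable borel" for g :: "real \<Rightarrow> real"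
    unfolding slice_measure_def using that by (intro integral_density) auto
  have "(\<integral>t. f t \<partial>slice_measure n) = (\<integral>t. ?w t *\<^sub>R f t \<partial>lborel)" by (rule eq) fact
  also have "\<dots> = \<bar>- 1\<bar> *\<^sub>R (\<integral>t. ?w (0 + (- 1) * t) *\<^sub>R f (0 + (- 1) * t) \<partial>lborel)"
    by (rule lborel_integral_real_affine) simp
  also have "\<dots> = (\<integral>t. ?w t *\<^sub>R f (- t) \<partial>lborel)"
  proof -
    have "indicator {-1..1} (- t) = (indicator {-1..1} t :: real)" for t :: real by (auto simp: indicator_def)
    then show ?thesis by simp
  qed
  also have "\<dots> = (\<integral>t. f (- t) \<partial>slice_measure n)" by (rule eq[symmetric]) measurable
  finally show ?thesis ..
qed

text \<open>For even \<open>f\<close> the integral equals its average with the reflected one. The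
  averaged kernel is even in \<open>t\<close> as well, which is what \<open>sym_kernel_close\<close>
  exploits.\<close>

lemma integral_abs_eq_sym_kernel:
  assumes p: "0 < p" and n: "1 \<le> n" and f: "f \<in> borel_measurable borel"
    and even: "\<And>s. f (- s) = f s" and bd: "\<And>s. s \<in> {-1..1} \<Longrightarrow> \<bar>f s\<bar> \<le> B"
  shows "(\<integral>s. \<bar>s - t\<bar> powr p * f s \<partial>slice_measure n) = (\<integral>s. sym_kernel p s t * f s \<partial>slice_measure n)"
proof -
  have meas: "(\<lambda>s. \<bar>s - r\<bar> powr p * f s) \<in> borel_measurable borel" for r
    using f by measurable
  have int: "integrable (slice_measure n) (\<lambda>s. \<bar>s - r\<bar> powr p * f s)" for r
  proof (rule integrable_slice[OF n meas, where B = "(1 + \<bar>r\<bar>) powr p * B"])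
    fix s :: real assume s: "s \<in> {-1..1}"
    have "\<bar>s - r\<bar> powr p * \<bar>f s\<bar> \<le> (1 + \<bar>r\<bar>) powr p * B"
      using s bd[OF s] p by (intro mult_mono powr_mono2) auto
    then show "\<bar>\<bar>s - r\<bar> powr p * f s\<bar> \<le> (1 + \<bar>r\<bar>) powr p * B" by (simp add: abs_mult)
  qed
  have "\<bar>- s - t\<bar> powr p * f (- s) = \<bar>s - (- t)\<bar> powr p * f s" for s
    by (simp add: even abs_minus_commute flip: abs_minus_cancel[of "s + t"])
  then have "(\<integral>s. \<bar>s - (- t)\<bar> powr p * f s \<partial>slice_measure n) = (\<integral>s. \<bar>s - t\<bar> powr p * f s \<partial>slice_measure n)"
    using integral_slice_reflect[OF meas[of t], of n] by simp
  then have "(\<integral>s. \<bar>s - t\<bar> powr p * f s \<partial>slice_measure n) =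
      ((\<integral>s. \<bar>s - t\<bar> powr p * f s \<partial>slice_measure n) + (\<integral>s. \<bar>s - (- t)\<bar> powr p * f s \<partial>slice_measure n)) / 2"
    by simp
  also have "\<dots> = (\<integral>s. (\<bar>s - t\<bar> powr p * f s + \<bar>s - (- t)\<bar> powr p * f s) / 2 \<partial>slice_measure n)"
    using int[of t] int[of "- t"] by simp
  also have "\<dots> = (\<integral>s. sym_kernel p s t * f s \<partial>slice_measure n)"
    by (simp add: sym_kernel_def algebra_simps add_divide_distrib)
  finally show ?thesis .
qed

text \<open>At the argument \<open>1 - t^2\<close> the linear factor takes the value
  \<open>x^2 - t^2\<close>; hence the shift \<open>x^2 - 1\<close>.\<close>

definition bump_poly :: "real \<Rightarrow> nat \<Rightarrow> real poly" where
  "bump_poly x N = ([:1:] - [:x\<^sup>2 - 1, 1:] ^ 2) ^ N"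

lemma poly_bump: "poly (bump_poly x N) (1 - t\<^sup>2) = (1 - sqdist x t) ^ N"
proof -
  have "(x\<^sup>2 - 1 + (1 - t\<^sup>2))\<^sup>2 = sqdist x t" by (simp add: sqdist_def power2_commute)
  then show ?thesis by (simp add: bump_poly_def poly_power)
qed

lemma interior_energy_le:
  fixes j :: "real ^ 'n \<Rightarrow> ell2"
  assumes p: "0 < p" and norm: "\<And>x. x \<in> cball 0 1 \<Longrightarrow> norm (j x) = R"
    and dist: "\<And>x y. x \<in> cball 0 1 \<Longrightarrow> y \<in> cball 0 1 \<Longrightarrow> dist (j x) (j y) = dist x y powr (p / 2)"
    and F: "finite F" "F \<subseteq> {-1<..<1 :: real}"
  shows "proj_const p CARD('n) * (\<Sum>x\<in>F. \<Sum>y\<in>F. a x * a y * sym_kernel p x y) \<le> 2 * R\<^sup>2 * (\<Sum>x\<in>F. a x)\<^sup>2"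
proof -
  define n where "n = CARD('n)"
  have n: "1 \<le> n" by (simp add: n_def Suc_leI)
  have F1: "x \<in> {-1..1}" "x \<in> {-1<..<1}" if "x \<in> F" for x using F that by auto
  let ?W = "slice_measure n"
  let ?Z = "bump_mass n"
  let ?b = "\<lambda>N x s. (1 - sqdist x s) ^ N"
  have Z: "0 < ?Z N x" if "x \<in> F" for N x using bump_ratio(1)[OF n F1(2)[OF that]] .
  have "proj_const p n * (\<Sum>x\<in>F. \<Sum>y\<in>F. a x * a y * (bump_energy n N (sym_kernel p) x y / (?Z N x * ?Z N y))) \<le>
      2 * R\<^sup>2 * (\<Sum>x\<in>F. a x)\<^sup>2" for N
  proof -
    \<comment> \<open>The normalised bumps give \<open>P\<close> the total mass
      \<open>\<Sum>x\<in>F. a x\<close> for every \<open>N\<close>, so only the energy has to pass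
      to the limit.\<close>
    define P where "P = (\<Sum>x\<in>F. smult (a x / ?Z N x) (bump_poly x N))"
    have P: "poly P (1 - t\<^sup>2) = (\<Sum>x\<in>F. a x / ?Z N x * ?b N x t)" for t
      by (simp add: P_def poly_sum poly_bump)
    have b1: "\<bar>?b N x s\<bar> \<le> 1" if "x \<in> F" "s \<in> {-1..1}" for x s
      using bump_01[OF F1(1)[OF that(1)] that(2), of N] by simp
    have ib: "integrable ?W (?b N x)" if "x \<in> F" for x
      using integrable_bump[OF n F1(1)[OF that], of "\<lambda>_. 1" 1] by simp
    have mass: "(\<integral>t. poly P (1 - t\<^sup>2) \<partial>?W) = (\<Sum>x\<in>F. a x)"
    proof -
      have "(\<integral>t. poly P (1 - t\<^sup>2) \<partial>?W) = (\<Sum>x\<in>F. a x / ?Z N x * ?Z N x)"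
        using ib by (simp add: P bump_mass_def)
      also have "\<dots> = (\<Sum>x\<in>F. a x)"
      proof (rule sum.cong[OF refl])
        fix x assume "x \<in> F"
        from Z[OF this, of N] show "a x / ?Z N x * ?Z N x = a x" by simp
      qed
      finally show ?thesis .
    qed
    have isym: "integrable ?W (\<lambda>s. sym_kernel p s t * ?b N x s)" if "x \<in> F" for x t
    proof (rule integrable_bump[OF n F1(1)[OF that], where B = "(1 + \<bar>t\<bar>) powr p"])
      show "(\<lambda>s. sym_kernel p s t) \<in> borel_measurable borel" unfolding sym_kernel_def by measurable
      fix s :: real assume s: "s \<in> {-1..1}"
      have "\<bar>s - t\<bar> powr p \<le> (1 + \<bar>t\<bar>) powr p" "\<bar>s + t\<bar> powr p \<le> (1 + \<bar>t\<bar>) powr p"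
        using s p by (auto intro!: powr_mono2)
      then show "\<bar>sym_kernel p s t\<bar> \<le> (1 + \<bar>t\<bar>) powr p" by (simp add: sym_kernel_def)
    qed
    have inner: "(\<integral>s. \<bar>s - t\<bar> powr p * poly P (1 - s\<^sup>2) \<partial>?W) =
        (\<Sum>x\<in>F. a x / ?Z N x * (\<integral>s. sym_kernel p s t * ?b N x s \<partial>?W))" for t
    proof -
      have "(\<integral>s. \<bar>s - t\<bar> powr p * poly P (1 - s\<^sup>2) \<partial>?W) = (\<integral>s. sym_kernel p s t * poly P (1 - s\<^sup>2) \<partial>?W)"
      proof (rule integral_abs_eq_sym_kernel[OF p n, where B = "\<Sum>x\<in>F. \<bar>a x / ?Z N x\<bar> * 1"])
        show "(\<lambda>s. poly P (1 - s\<^sup>2)) \<in> borel_measurable borel" unfolding P by measurable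
        fix s :: real assume s: "s \<in> {-1..1}"
        have "\<bar>poly P (1 - s\<^sup>2)\<bar> \<le> (\<Sum>x\<in>F. \<bar>a x / ?Z N x * ?b N x s\<bar>)" unfolding P by (rule sum_abs)
        also have "\<dots> \<le> (\<Sum>x\<in>F. \<bar>a x / ?Z N x\<bar> * 1)"
          unfolding abs_mult using b1[OF _ s] by (intro sum_mono mult_left_mono) auto
        finally show "\<bar>poly P (1 - s\<^sup>2)\<bar> \<le> (\<Sum>x\<in>F. \<bar>a x / ?Z N x\<bar> * 1)" .
      qed simp
      also have "\<dots> = (\<integral>s. (\<Sum>x\<in>F. a x / ?Z N x * (sym_kernel p s t * ?b N x s)) \<partial>?W)"
        unfolding P sum_distrib_left by (simp only: mult_ac)
      also have "\<dots> = (\<Sum>x\<in>F. a x / ?Z N x * (\<integral>s. sym_kernel p s t * ?b N x s \<partial>?W))"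
        using isym by simp
      finally show ?thesis .
    qed
    have outer: "integrable ?W (\<lambda>t. (\<integral>s. sym_kernel p s t * ?b N x s \<partial>?W) * ?b N y t)" if "x \<in> F" "y \<in> F" for x y
    proof (rule integrable_bump_outer(1)[OF n F1(1)[OF that(1)] F1(1)[OF that(2)] measurable_sym_kernel])
      fix s t :: real assume "s \<in> {-1..1}" "t \<in> {-1..1}"
      then show "\<bar>sym_kernel p s t\<bar> \<le> 2 powr p" using sym_kernel_bounds[OF p] by simp
    qed
    have "(\<integral>t. (\<integral>s. \<bar>s - t\<bar> powr p * poly P (1 - s\<^sup>2) \<partial>?W) * poly P (1 - t\<^sup>2) \<partial>?W) =
        (\<integral>t. (\<Sum>x\<in>F. \<Sum>y\<in>F. a x / ?Z N x * (a y / ?Z N y) * ((\<integral>s. sym_kernel p s t * ?b N x s \<partial>?W) * ?b N y t)) \<partial>?W)"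
      unfolding inner unfolding P sum_product by (simp only: mult_ac)
    also have "\<dots> = (\<Sum>x\<in>F. \<Sum>y\<in>F. a x / ?Z N x * (a y / ?Z N y) * bump_energy n N (sym_kernel p) x y)"
      using outer by (simp add: bump_energy_def)
    also have "\<dots> = (\<Sum>x\<in>F. \<Sum>y\<in>F. a x * a y * (bump_energy n N (sym_kernel p) x y / (?Z N x * ?Z N y)))"
      by simp
    finally show ?thesis
      using poly_slice_energy[OF p norm dist, of P] unfolding n_def[symmetric] mass by simp
  qed
  moreover have "(\<lambda>N. proj_const p n * (\<Sum>x\<in>F. \<Sum>y\<in>F. a x * a y * (bump_energy n N (sym_kernel p) x y / (?Z N x * ?Z N y))))
      \<longlonglongrightarrow> proj_const p n * (\<Sum>x\<in>F. \<Sum>y\<in>F. a x * a y * sym_kernel p x y)"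
    using F1 by (intro tendsto_mult tendsto_const tendsto_sum bump_energy_tendsto[OF p n])
  ultimately show ?thesis
    unfolding n_def[symmetric] by (intro LIMSEQ_le_const2) auto
qed

text \<open>Passing to the even part does not decrease the energy: the odd part has total mass \<open>0\<close>, and
  \<open>energy_bound\<close> makes its energy nonpositive.\<close>
lemma energy_le_sym_energy:
  assumes p: "0 < p" "p < 2" and F: "finite F" "F \<subseteq> {-1..1 :: real}"
  shows "(\<Sum>x\<in>F. \<Sum>y\<in>F. a x * a y * \<bar>x - y\<bar> powr p) \<le> (\<Sum>x\<in>F. \<Sum>y\<in>F. a x * a y * sym_kernel p x y)"
proof -
  \<comment> \<open>Twice the odd part, with mass \<open>a x\<close> at \<open>x\<close> and
    \<open>- a x\<close> at \<open>- x\<close>. Tagging points with a sign keeps the two apart even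
    if \<open>x = 0\<close> or both lie in \<open>F\<close>.\<close>
  define I where "I = F \<times> (UNIV :: bool set)"
  define u where "u z = (if snd z then fst z else - fst z)" for z :: "real \<times> bool"
  define b where "b z = (if snd z then a (fst z) else - a (fst z))" for z :: "real \<times> bool"
  have sum: "(\<Sum>z\<in>I. f z) = (\<Sum>x\<in>F. f (x, True) + f (x, False))" for f :: "real \<times> bool \<Rightarrow> real"
    unfolding I_def sum.cartesian_product' by (simp add: UNIV_bool add.commute)
  have I: "finite I" using F by (simp add: I_def)
  have "u ` I \<subseteq> {-1..1}"
  proof
    fix r assume "r \<in> u ` I"
    then obtain z where z: "fst z \<in> F" "r = u z" by (auto simp: I_def)
    then have "fst z \<in> {-1..1}" using F(2) by blast
    then show "r \<in> {-1..1}" using z(2) by (auto simp: u_def)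
  qed
  from energy_bound_indexed[OF energy_bound_max_energy[OF p] I this, of b]
  have "(\<Sum>z\<in>I. \<Sum>w\<in>I. b z * b w * dist (u z) (u w) powr p) \<le> 0"
    by (simp add: sum b_def)
  \<comment> \<open>The four choices of signs add up to
    \<open>2 * |x - y| powr p - 2 * |x + y| powr p\<close>, which is four times the difference
    between the distance kernel and \<open>sym_kernel\<close>.\<close>
  also have "(\<Sum>z\<in>I. \<Sum>w\<in>I. b z * b w * dist (u z) (u w) powr p) =
      (\<Sum>x\<in>F. \<Sum>y\<in>F. 4 * (a x * a y * \<bar>x - y\<bar> powr p - a x * a y * sym_kernel p x y))"
  proof -
    have "\<bar>- x - y\<bar> = \<bar>x + y\<bar>" "\<bar>y - x\<bar> = \<bar>x - y\<bar>" for x y :: real by auto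
    then show ?thesis
      unfolding sum sum.distrib[symmetric]
      by (intro sum.cong refl) (simp add: b_def u_def dist_real_def sym_kernel_def algebra_simps)
  qed
  also have "\<dots> = 4 * ((\<Sum>x\<in>F. \<Sum>y\<in>F. a x * a y * \<bar>x - y\<bar> powr p) - (\<Sum>x\<in>F. \<Sum>y\<in>F. a x * a y * sym_kernel p x y))"
    by (simp add: sum_subtractf sum_distrib_left[symmetric])
  finally show ?thesis by simp
qed

text \<open>The bumps sit at interior points. The endpoints are reached by dilating with
  \<open>r < 1\<close>, which multiplies the energy by \<open>r powr p\<close>, and letting
  \<open>r\<close> tend to 1.\<close>

lemma energy_bound_of_embedding:
  fixes j :: "real ^ 'n \<Rightarrow> ell2"
  assumes p: "0 < p" "p < 2" and norm: "\<And>x. x \<in> cball 0 1 \<Longrightarrow> norm (j x) = R"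
    and dist: "\<And>x y. x \<in> cball 0 1 \<Longrightarrow> y \<in> cball 0 1 \<Longrightarrow> dist (j x) (j y) = dist x y powr (p / 2)"
  shows "energy_bound p {-1..1 :: real} (2 * R\<^sup>2 / proj_const p CARD('n))"
proof -
  define c where "c = proj_const p CARD('n)"
  have c: "0 < c" unfolding c_def using p by (intro proj_const_pos) (auto simp: Suc_leI)
  have inner: "energy_bound p {-1<..<1 :: real} (2 * R\<^sup>2 / c)"
    unfolding energy_bound_def
  proof (intro allI impI)
    fix F :: "real set" and a :: "real \<Rightarrow> real" assume F: "finite F" "F \<subseteq> {-1<..<1}"
    then have "F \<subseteq> {-1..1}" by auto
    have "c * (\<Sum>x\<in>F. \<Sum>y\<in>F. a x * a y * \<bar>x - y\<bar> powr p) \<le> c * (\<Sum>x\<in>F. \<Sum>y\<in>F. a x * a y * sym_kernel p x y)"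
      using c by (intro mult_left_mono energy_le_sym_energy[OF p F(1) \<open>F \<subseteq> {-1..1}\<close>]) auto
    also have "\<dots> \<le> 2 * R\<^sup>2 * (\<Sum>x\<in>F. a x)\<^sup>2"
      unfolding c_def by (rule interior_energy_le[OF p(1) norm dist F])
    finally show "(\<Sum>x\<in>F. \<Sum>y\<in>F. a x * a y * dist x y powr p) \<le> 2 * R\<^sup>2 / c * (\<Sum>x\<in>F. a x)\<^sup>2"
      using c by (simp add: dist_real_def field_simps)
  qed
  show ?thesis
    unfolding energy_bound_def c_def[symmetric]
  proof (intro allI impI)
    fix F :: "real set" and a :: "real \<Rightarrow> real" assume F: "finite F" "F \<subseteq> {-1..1}"
    let ?E = "\<Sum>x\<in>F. \<Sum>y\<in>F. a x * a y * dist x y powr p"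
    let ?C = "2 * R\<^sup>2 / c * (\<Sum>x\<in>F. a x)\<^sup>2"
    have le: "r powr p * ?E \<le> ?C" if r: "0 < r" "r < 1" for r :: real
    proof -
      have "(\<lambda>x. r * x) ` F \<subseteq> {-1<..<1}"
      proof
        fix z assume "z \<in> (\<lambda>x. r * x) ` F"
        then obtain x where x: "x \<in> F" "z = r * x" by auto
        have "\<bar>x\<bar> \<le> 1" using x F by (auto simp: abs_le_iff)
        then have "\<bar>z\<bar> \<le> r * 1" using x r by (simp add: abs_mult)
        then show "z \<in> {-1<..<1}" using r by auto
      qed
      from energy_bound_indexed[OF inner F(1) this, of a]
      have "(\<Sum>x\<in>F. \<Sum>y\<in>F. a x * a y * dist (r * x) (r * y) powr p) \<le> ?C" .
      moreover have "dist (r * x) (r * y) powr p = r powr p * dist x y powr p" for x y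
        using r by (simp add: dist_real_def abs_mult powr_mult flip: right_diff_distrib)
      ultimately show ?thesis by (simp add: sum_distrib_left mult_ac)
    qed
    have "((\<lambda>r. r powr p * ?E) \<longlongrightarrow> 1 powr p * ?E) (at_left 1)"
      by (intro tendsto_intros) auto
    moreover have "eventually (\<lambda>r. r powr p * ?E \<le> ?C) (at_left (1 :: real))"
      using eventually_at_left_real[of 0 1] by (rule eventually_mono) (simp, rule le, simp_all)
    ultimately have "1 powr p * ?E \<le> ?C"
      by (intro tendsto_upperbound) auto
    then show "?E \<le> ?C" by simp
  qed
qed

section \<open>Asymptotics\<close>

text \<open>Log-convexity of Gamma squeezes the quotient, as in Gautschi's inequality:
  \<open>\<alpha> + x\<close> lies between \<open>x\<close> and \<open>x + 1\<close>, and
  \<open>x + 1\<close> lies between \<open>\<alpha> + x\<close> and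
  \<open>\<alpha> + x + 1\<close>.\<close>

lemma Gamma_quotient_tendsto:
  fixes \<alpha> :: real
  assumes \<alpha>: "0 < \<alpha>" "\<alpha> < 1"
  shows "((\<lambda>x. Gamma (\<alpha> + x) / Gamma x / x powr \<alpha>) \<longlongrightarrow> 1) at_top"
proof -
  let ?r = "\<lambda>x. ln (Gamma (\<alpha> + x)) - ln (Gamma x) - \<alpha> * ln x"
  have cvx: "ln (Gamma ((1 - t) * x + t * y)) \<le> (1 - t) * ln (Gamma x) + t * ln (Gamma y)"
    if "0 < x" "0 < y" "0 \<le> t" "t \<le> 1" for x y t :: real
    using convex_onD[OF log_convex_Gamma_real, of t x y] that by simp
  have plus: "ln (Gamma (x + 1)) = ln x + ln (Gamma x)" if "0 < x" for x :: real
  proof -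
    have "Gamma (x + 1) = x * Gamma x" using that by (intro Gamma_plus1) (auto elim!: nonpos_Ints_cases)
    moreover have "Gamma x \<noteq> 0" using Gamma_real_pos[OF that] by simp
    ultimately show ?thesis using that by (simp add: ln_mult)
  qed
  have up: "?r x \<le> 0" if x: "0 < x" for x
  proof -
    have "(1 - \<alpha>) * x + \<alpha> * (x + 1) = \<alpha> + x" by (simp add: algebra_simps)
    then have "ln (Gamma (\<alpha> + x)) \<le> (1 - \<alpha>) * ln (Gamma x) + \<alpha> * ln (Gamma (x + 1))"
      using cvx[of x "x + 1" \<alpha>] x \<alpha> by simp
    then show ?thesis using plus[OF x] by (simp add: algebra_simps)
  qed
  have lo: "(1 - \<alpha>) * ln (x / (x + \<alpha>)) \<le> ?r x" if x: "0 < x" for x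
  proof -
    have "(1 - (1 - \<alpha>)) * (\<alpha> + x) + (1 - \<alpha>) * (\<alpha> + x + 1) = x + 1" by (simp add: algebra_simps)
    then have "ln (Gamma (x + 1)) \<le> (1 - (1 - \<alpha>)) * ln (Gamma (\<alpha> + x)) + (1 - \<alpha>) * ln (Gamma (\<alpha> + x + 1))"
      using cvx[of "\<alpha> + x" "\<alpha> + x + 1" "1 - \<alpha>"] x \<alpha> by simp
    then show ?thesis using plus[OF x] plus[of "\<alpha> + x"] x \<alpha> by (simp add: ln_div algebra_simps)
  qed
  have "filterlim (\<lambda>x. x + \<alpha>) at_top at_top"
    by (subst add.commute) (rule filterlim_tendsto_add_at_top[OF tendsto_const filterlim_ident])
  then have "((\<lambda>x. 1 - \<alpha> / (x + \<alpha>)) \<longlongrightarrow> 1 - 0) at_top"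
    by (intro tendsto_diff tendsto_const tendsto_divide_0[OF tendsto_const] filterlim_at_top_imp_at_infinity)
  moreover have "eventually (\<lambda>x. 1 - \<alpha> / (x + \<alpha>) = x / (x + \<alpha>)) at_top"
    using eventually_gt_at_top[of 0] by eventually_elim (use \<alpha> in \<open>simp add: field_simps\<close>)
  ultimately have "((\<lambda>x. x / (x + \<alpha>)) \<longlongrightarrow> 1) at_top"
    by (simp add: filterlim_cong[OF refl refl])
  then have "((\<lambda>x. (1 - \<alpha>) * ln (x / (x + \<alpha>))) \<longlongrightarrow> (1 - \<alpha>) * ln 1) at_top"
    by (intro tendsto_intros) auto
  then have lim0: "((\<lambda>x. (1 - \<alpha>) * ln (x / (x + \<alpha>))) \<longlongrightarrow> 0) at_top" by simp
  have "(?r \<longlongrightarrow> 0) at_top"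
  proof (rule tendsto_sandwich[OF _ _ lim0 tendsto_const])
    show "eventually (\<lambda>x. (1 - \<alpha>) * ln (x / (x + \<alpha>)) \<le> ?r x) at_top"
      using eventually_gt_at_top[of 0] by eventually_elim (rule lo)
    show "eventually (\<lambda>x. ?r x \<le> 0) at_top"
      using eventually_gt_at_top[of 0] by eventually_elim (rule up)
  qed
  then have "((\<lambda>x. exp (?r x)) \<longlongrightarrow> exp 0) at_top" by (rule tendsto_exp)
  moreover have "eventually (\<lambda>x. exp (?r x) = Gamma (\<alpha> + x) / Gamma x / x powr \<alpha>) at_top"
    using eventually_gt_at_top[of 0]
  proof eventually_elim
    case (elim x)
    then show ?case
      using Gamma_real_pos[of x] Gamma_real_pos[of "\<alpha> + x"] \<alpha> by (simp add: exp_diff powr_def)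
  qed
  ultimately show ?thesis by (simp add: filterlim_cong[OF refl refl])
qed

text \<open>Matches the radius \<open>sqrt (C / 2)\<close> of \<open>snowflake_embedding\<close> for
  the constant \<open>C\<close> of \<open>energy_bound_cball\<close>.\<close>

lemma optimal_radius_eq:
  "optimal_radius \<alpha> n = sqrt (proj_const (2 * \<alpha>) n * max_energy (2 * \<alpha>) / 2)"
  by (simp add: optimal_radius_def proj_const_def mult_ac)

lemma optimal_radius_asymptotics:
  assumes \<alpha>: "0 < \<alpha>" "\<alpha> < 1"
  shows "(\<lambda>n. optimal_radius \<alpha> n / real n powr (\<alpha> / 2)) \<longlonglongrightarrow>
    sqrt (max_energy (2 * \<alpha>) * pi powr (1 / 2) / (2 powr (1 + \<alpha>) * Gamma (\<alpha> + 1 / 2)))"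
proof -
  define A where "A = max_energy (2 * \<alpha>) * pi powr (1 / 2) / (2 * Gamma (\<alpha> + 1 / 2))"
  let ?g = "\<lambda>x. Gamma (\<alpha> + x) / Gamma x / x powr \<alpha>"
  have "filterlim (\<lambda>n. real n / 2) at_top sequentially"
    using filterlim_tendsto_pos_mult_at_top[OF tendsto_const[of "1 / 2 :: real"] _ filterlim_real_sequentially] by simp
  then have "(\<lambda>n. ?g (real n / 2)) \<longlonglongrightarrow> 1"
    by (rule filterlim_compose[OF Gamma_quotient_tendsto[OF \<alpha>]])
  \<comment> \<open>The Gamma quotient is evaluated at \<open>real n / 2\<close>, so a factor
    \<open>(1 / 2) powr \<alpha>\<close> turns the 2 in the denominator into
    \<open>2 powr (1 + \<alpha>)\<close>.\<close>
  then have "(\<lambda>n. sqrt (A * (1 / 2) powr \<alpha> * ?g (real n / 2))) \<longlonglongrightarrow> sqrt (A * (1 / 2) powr \<alpha> * 1)"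
    by (intro tendsto_intros)
  moreover have "A * (1 / 2) powr \<alpha> * 1 =
      max_energy (2 * \<alpha>) * pi powr (1 / 2) / (2 powr (1 + \<alpha>) * Gamma (\<alpha> + 1 / 2))"
    by (simp add: A_def powr_add powr_divide)
  moreover have "eventually (\<lambda>n. sqrt (A * (1 / 2) powr \<alpha> * ?g (real n / 2)) = optimal_radius \<alpha> n / real n powr (\<alpha> / 2)) sequentially"
    using eventually_gt_at_top[of 0]
  proof eventually_elim
    case (elim n)
    then have n: "0 < real n" by simp
    have "A * (1 / 2) powr \<alpha> * ?g (real n / 2) =
        (max_energy (2 * \<alpha>) * pi powr (1 / 2) * Gamma (\<alpha> + real n / 2) / (2 * Gamma (\<alpha> + 1 / 2) * Gamma (real n / 2))) / real n powr \<alpha>"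
      using n by (simp add: A_def powr_divide)
    moreover have "sqrt (real n powr \<alpha>) = real n powr (\<alpha> / 2)"
      using n by (simp add: powr_powr flip: powr_half_sqrt)
    ultimately show ?case unfolding optimal_radius_def by (simp only: real_sqrt_divide)
  qed
  ultimately show ?thesis by (simp add: filterlim_cong[OF refl refl])
qed

theorem theorem2p13:
  fixes \<alpha> :: real
  assumes "0 < \<alpha>" and "\<alpha> < 1"
  shows "bdd_above (energies (2 * \<alpha>)) \<and>
    (\<exists>j :: real ^ 'n \<Rightarrow> ell2. embeds_ball_in_sphere \<alpha> (optimal_radius \<alpha> CARD('n)) j) \<and>
    (\<forall>R. \<forall>j :: real ^ 'n \<Rightarrow> ell2.
       embeds_ball_in_sphere \<alpha> R j \<longrightarrow> optimal_radius \<alpha> CARD('n) \<le> R) \<and>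
    (\<exists>\<epsilon> :: nat \<Rightarrow> real. \<epsilon> \<in> o(\<lambda>_. 1) \<and>
       (\<forall>n\<ge>1. optimal_radius \<alpha> n =
          real n powr (\<alpha> / 2) *
            (sqrt (max_energy (2 * \<alpha>) * pi powr (1 / 2) / (2 powr (1 + \<alpha>) * Gamma (\<alpha> + 1 / 2))) + \<epsilon> n)))"
proof (intro conjI)
  define p where "p = 2 * \<alpha>"
  have p: "0 < p" "p < 2" "p / 2 = \<alpha>" using assms by (simp_all add: p_def)
  define c where "c = proj_const p CARD('n)"
  have c: "0 < c" unfolding c_def using p by (intro proj_const_pos) (auto simp: Suc_leI)
  have radius: "optimal_radius \<alpha> CARD('n) = sqrt (c * max_energy p / 2)"
    by (simp add: optimal_radius_eq c_def p_def)
  show "bdd_above (energies (2 * \<alpha>))" using bdd_above_energies[OF p(1,2)] by (simp add: p_def)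
  show "\<exists>j :: real ^ 'n \<Rightarrow> ell2. embeds_ball_in_sphere \<alpha> (optimal_radius \<alpha> CARD('n)) j"
  proof -
    obtain j :: "real ^ 'n \<Rightarrow> ell2" where
      "\<And>x. x \<in> cball 0 1 \<Longrightarrow> norm (j x) = sqrt (c * max_energy p / 2)"
      "\<And>x y. x \<in> cball 0 1 \<Longrightarrow> y \<in> cball 0 1 \<Longrightarrow> dist (j x) (j y) = dist x y powr (p / 2)"
    proof (rule snowflake_embedding[OF p(1) energy_bound_cball[OF p(1,2), where ?'n = 'n], folded c_def], goal_cases)
      case (1 j)
      show ?case by (rule 1(1)[OF 1(2,3)])
    qed
    then show ?thesis
      unfolding embeds_ball_in_sphere_def radius p(3) by (intro exI[of _ j]) auto
  qed
  show "\<forall>R. \<forall>j :: real ^ 'n \<Rightarrow> ell2. embeds_ball_in_sphere \<alpha> R j \<longrightarrow> optimal_radius \<alpha> CARD('n) \<le> R"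
  proof (intro allI impI)
    fix R and j :: "real ^ 'n \<Rightarrow> ell2" assume emb: "embeds_ball_in_sphere \<alpha> R j"
    have norm: "norm (j x) = R" if "x \<in> cball 0 1" for x
      using emb that unfolding embeds_ball_in_sphere_def by auto
    have dist: "dist (j x) (j y) = dist x y powr (p / 2)" if "x \<in> cball 0 1" "y \<in> cball 0 1" for x y
      using emb that unfolding embeds_ball_in_sphere_def p(3) by blast
    \<comment> \<open>The number \<open>R\<close> is an arbitrary real; the image of the centre of
      the ball shows that it is nonnegative.\<close>
    have R: "0 \<le> R" using norm[of 0] norm_ge_zero[of "j 0"] by simp
    have "max_energy p \<le> 2 * R\<^sup>2 / c"
      unfolding c_def by (rule max_energy_le[OF p(1) energy_bound_of_embedding[OF p(1,2) norm dist]])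
    then have "c * max_energy p / 2 \<le> R\<^sup>2" using c by (simp add: field_simps)
    then show "optimal_radius \<alpha> CARD('n) \<le> R" unfolding radius using R by (simp add: real_le_lsqrt)
  qed
  let ?k = "sqrt (max_energy (2 * \<alpha>) * pi powr (1 / 2) / (2 powr (1 + \<alpha>) * Gamma (\<alpha> + 1 / 2)))"
  show "\<exists>\<epsilon> :: nat \<Rightarrow> real. \<epsilon> \<in> o(\<lambda>_. 1) \<and>
       (\<forall>n\<ge>1. optimal_radius \<alpha> n = real n powr (\<alpha> / 2) * (?k + \<epsilon> n))"
  proof (intro exI conjI allI impI)
    let ?\<epsilon> = "\<lambda>n. optimal_radius \<alpha> n / real n powr (\<alpha> / 2) - ?k"
    have "?\<epsilon> \<longlonglongrightarrow> ?k - ?k" by (intro tendsto_diff optimal_radius_asymptotics assms tendsto_const)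
    then show "?\<epsilon> \<in> o(\<lambda>_. 1)" by (intro smalloI_tendsto) auto
    fix n :: nat assume "1 \<le> n"
    then show "optimal_radius \<alpha> n = real n powr (\<alpha> / 2) * (?k + ?\<epsilon> n)" by simp
  qed
qed

end
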